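(* Let $\Upsilon$ be a tree. The Banach space $C_0(\Upsilon)$ admits an equivalent norm with the Kadec property if and only if there exists an increasing function $\rho:\Upsilon\to\mathbb{R}$ with no bad points.
   Context: A tree is a partially ordered set $(\Upsilon,\preceq)$ such that for each $t\in\Upsilon$ the set $\{s: s\preceq t\}$ is well-ordered by $\preceq$. Write $(0,t]=\{s:s\preceq t\}$, $(0,t)=\{s:s\prec t\}$, and let $r(t)$ be the order type of $(0,t)$. All trees are assumed Hausdorff: if $r(t)$ is a limit ordinal and $(0,t)=(0,t')$ then $t=t'$. $\Upsilon$ carries the coarsest topology in which every $(0,t]$ is open and closed (a locally compact Hausdorff topology). $C_0(\Upsilon)$ is the Banach space of continuous $f:\Upsilon\to\mathbb{R}$ such that $\{t:|f(t)|\ge\epsilon\}$ is compact for every $\epsilon>0$, with the supremum norm. The set $t^+$ of immediate successors of $t$ consists of those $u$ with $(0,u)=(0,t]$. A function $\rho:\Upsilon\to\mathbb{R}$ is increasing if $s\preceq t$ implies $\rho(s)\le\rho(t)$. For increasing $\rho$, a point $t$ is good for $\rho$ if there is a finite $F\subseteq t^+$ with $\inf_{u\in t^+\setminus F}\rho(u)>\rho(t)$ (an infimum over the empty set is $+\infty$); otherwise $t$ is bad for $\rho$. A norm on a Banach space $X$ has the Kadec property if the weak topology and the norm topology coincide on its unit sphere $\{x:\|x\|=1\}$. *)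

theory Defs
  imports "HOL-Analysis.Analysis"
begin

definition tdown :: "'a set \<Rightarrow> ('a \<Rightarrow> 'a \<Rightarrow> bool) \<Rightarrow> 'a \<Rightarrow> 'a set" where
  "tdown T le t = {s \<in> T. le s t}"

definition tbelow :: "'a set \<Rightarrow> ('a \<Rightarrow> 'a \<Rightarrow> bool) \<Rightarrow> 'a \<Rightarrow> 'a set" where
  "tbelow T le t = {s \<in> T. le s t \<and> s \<noteq> t}"

text \<open>The order type of (0,t) is a limit ordinal: nonempty and without a largest element.\<close>
definition limit_height :: "'a set \<Rightarrow> ('a \<Rightarrow> 'a \<Rightarrow> bool) \<Rightarrow> 'a \<Rightarrow> bool" where
  "limit_height T le t \<longleftrightarrow> tbelow T le t \<noteq> {} \<and>
     \<not> (\<exists>m \<in> tbelow T le t. \<forall>s \<in> tbelow T le t. le s m)"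

definition is_tree :: "'a set \<Rightarrow> ('a \<Rightarrow> 'a \<Rightarrow> bool) \<Rightarrow> bool" where
  "is_tree T le \<longleftrightarrow>
     (\<forall>t \<in> T. le t t) \<and>
     (\<forall>s \<in> T. \<forall>t \<in> T. le s t \<and> le t s \<longrightarrow> s = t) \<and>
     (\<forall>s \<in> T. \<forall>t \<in> T. \<forall>u \<in> T. le s t \<and> le t u \<longrightarrow> le s u) \<and>
     \<comment> \<open>each (0,t] is well-ordered\<close>
     (\<forall>t \<in> T. (\<forall>s \<in> tdown T le t. \<forall>s' \<in> tdown T le t. le s s' \<or> le s' s) \<and>
        (\<forall>A. A \<subseteq> tdown T le t \<and> A \<noteq> {} \<longrightarrow> (\<exists>m \<in> A. \<forall>a \<in> A. le m a)))"

definition hausdorff_tree :: "'a set \<Rightarrow> ('a \<Rightarrow> 'a \<Rightarrow> bool) \<Rightarrow> bool" where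
  "hausdorff_tree T le \<longleftrightarrow>
     (\<forall>t \<in> T. \<forall>t' \<in> T. limit_height T le t \<and> tbelow T le t = tbelow T le t' \<longrightarrow> t = t')"

definition tree_topology :: "'a set \<Rightarrow> ('a \<Rightarrow> 'a \<Rightarrow> bool) \<Rightarrow> 'a topology" where
  "tree_topology T le = topology_generated_by
     ({T} \<union> {tdown T le t | t. t \<in> T} \<union> {T - tdown T le t | t. t \<in> T})"

definition C0 :: "'a set \<Rightarrow> ('a \<Rightarrow> 'a \<Rightarrow> bool) \<Rightarrow> ('a \<Rightarrow> real) set" where
  "C0 T le = {f. continuous_map (tree_topology T le) euclideanreal f \<and>
       (\<forall>\<epsilon>>0. compactin (tree_topology T le) {t \<in> T. \<epsilon> \<le> \<bar>f t\<bar>}) \<and>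
       (\<forall>t. t \<notin> T \<longrightarrow> f t = 0)}"

definition supnorm :: "'a set \<Rightarrow> ('a \<Rightarrow> real) \<Rightarrow> real" where
  "supnorm T f = Sup (insert 0 ((\<lambda>t. \<bar>f t\<bar>) ` T))"

definition equiv_norm :: "'a set \<Rightarrow> ('a \<Rightarrow> 'a \<Rightarrow> bool) \<Rightarrow> (('a \<Rightarrow> real) \<Rightarrow> real) \<Rightarrow> bool" where
  "equiv_norm T le N \<longleftrightarrow>
     (\<forall>f \<in> C0 T le. \<forall>g \<in> C0 T le. N (\<lambda>t. f t + g t) \<le> N f + N g) \<and>
     (\<forall>f \<in> C0 T le. \<forall>c. N (\<lambda>t. c * f t) = \<bar>c\<bar> * N f) \<and>
     (\<exists>a b. 0 < a \<and> 0 < b \<and>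
        (\<forall>f \<in> C0 T le. a * supnorm T f \<le> N f \<and> N f \<le> b * supnorm T f))"

definition dual_C0 :: "'a set \<Rightarrow> ('a \<Rightarrow> 'a \<Rightarrow> bool) \<Rightarrow> (('a \<Rightarrow> real) \<Rightarrow> real) set" where
  "dual_C0 T le = {\<phi>.
     (\<forall>f \<in> C0 T le. \<forall>g \<in> C0 T le. \<phi> (\<lambda>t. f t + g t) = \<phi> f + \<phi> g) \<and>
     (\<forall>f \<in> C0 T le. \<forall>c. \<phi> (\<lambda>t. c * f t) = c * \<phi> f) \<and>
     (\<exists>C. \<forall>f \<in> C0 T le. \<bar>\<phi> f\<bar> \<le> C * supnorm T f)}"

definition weak_topology_C0 :: "'a set \<Rightarrow> ('a \<Rightarrow> 'a \<Rightarrow> bool) \<Rightarrow> ('a \<Rightarrow> real) topology" where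
  "weak_topology_C0 T le = topology_generated_by
     {{f \<in> C0 T le. \<phi> f \<in> U} | \<phi> U. \<phi> \<in> dual_C0 T le \<and> open U}"

definition norm_topology_C0 :: "'a set \<Rightarrow> ('a \<Rightarrow> 'a \<Rightarrow> bool) \<Rightarrow> (('a \<Rightarrow> real) \<Rightarrow> real) \<Rightarrow> ('a \<Rightarrow> real) topology" where
  "norm_topology_C0 T le N = topology_generated_by
     ({C0 T le} \<union> {{g \<in> C0 T le. N (\<lambda>t. g t - f t) < e} | f e. f \<in> C0 T le \<and> 0 < e})"

definition kadec :: "'a set \<Rightarrow> ('a \<Rightarrow> 'a \<Rightarrow> bool) \<Rightarrow> (('a \<Rightarrow> real) \<Rightarrow> real) \<Rightarrow> bool" where
  "kadec T le N \<longleftrightarrow>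
     (let S = {f \<in> C0 T le. N f = 1} in
      subtopology (weak_topology_C0 T le) S = subtopology (norm_topology_C0 T le N) S)"

definition tsucc :: "'a set \<Rightarrow> ('a \<Rightarrow> 'a \<Rightarrow> bool) \<Rightarrow> 'a \<Rightarrow> 'a set" where
  "tsucc T le t = {u \<in> T. tbelow T le u = tdown T le t}"

definition increasing_on_tree :: "'a set \<Rightarrow> ('a \<Rightarrow> 'a \<Rightarrow> bool) \<Rightarrow> ('a \<Rightarrow> real) \<Rightarrow> bool" where
  "increasing_on_tree T le \<rho> \<longleftrightarrow> (\<forall>s \<in> T. \<forall>t \<in> T. le s t \<longrightarrow> \<rho> s \<le> \<rho> t)"

definition good_point :: "'a set \<Rightarrow> ('a \<Rightarrow> 'a \<Rightarrow> bool) \<Rightarrow> ('a \<Rightarrow> real) \<Rightarrow> 'a \<Rightarrow> bool" where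
  "good_point T le \<rho> t \<longleftrightarrow>
     (\<exists>F. finite F \<and> F \<subseteq> tsucc T le t \<and>
        (INF u \<in> tsucc T le t - F. ereal (\<rho> u)) > ereal (\<rho> t))"

end

theory Submission
  imports Defs
begin

text \<open>
  Write \<open>ch t\<close> for the indicator of \<open>(0,t]\<close>. Given a Kadec norm \<open>N\<close>, functionals are small on all but finitely
  many of the disjoint sets of successors of a point, so the Kadec property forces, for every \<open>t\<close>, a positive gap
  between \<open>N (ch t)\<close> and \<open>N (ch r)\<close> for all \<open>r\<close> beyond \<open>t\<close> outside finitely many directions. Hence the tree is
  a countable union of sets each of whose points sees its set in only finitely many directions, and such a set
  yields an increasing function that jumps at all its points.

  Conversely, let \<open>w \<ge> 1\<close> be increasing without bad points. The norm is a weighted sum of the infimal convolutions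
  \<open>kfun l\<close> (\<open>l = 2\<^sup>-\<^sup>k\<close>) of the supremum norm with \<open>l\<close> times the cost \<open>\<Sum> w a * \<bar>c a\<bar>\<close> of a combination
  \<open>\<Sum> c a * ch a\<close>. A functional \<open>\<phi>\<close> norming \<open>f\<close> for \<open>kfun l\<close> satisfies \<open>\<bar>\<phi> (ch t)\<bar> \<le> l * w t\<close>. If \<open>g\<close> is weakly close
  to \<open>f\<close> and of the same norm, its near-optimal combination must sit where this is almost an equality, with the
  sign of \<open>\<phi> (ch t)\<close>. Since \<open>w\<close> has no bad points, this and the values at finitely many points determine the
  combination uniformly up to a small error; finitely many points suffice by compactness of the space of paths.
\<close>

section \<open>Paths and the tree topology\<close>

text \<open>In the first direction \<open>N (ch t)\<close> need not be monotone and its gap has no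
  sign, so it cannot serve as \<rho> itself. The sets used instead collect points with a common gap
  size whose values \<open>N (ch t)\<close> nearly agree; then no point of such a set lies beyond a
  non-exceptional successor of another one. In the second direction no single \<open>kfun l\<close>
  is enough: it sees \<open>f\<close> only up to an error \<open>kfun l f\<close>, which becomes
  arbitrarily small only along a sequence of scales. So all scales enter the norm, and the accuracy
  asked for selects one of them. The individual coefficients of a near-optimal combination are not
  determined by \<open>f\<close>: along a path without last point they may drift, and only their sum
  can be recovered, from values at both ends of the path. That the sum controls the masses needs
  their signs, which \<phi> provides. Beyond a point \<open>t\<close>, in contrast, the jump of the
  weight makes the masses themselves small, except in finitely many directions; these are left to
  other paths, and compactness ensures that finitely many paths suffice.\<close>

locale tree_space =
  fixes T :: "'a set" and le :: "'a \<Rightarrow> 'a \<Rightarrow> bool"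
  assumes tree: "is_tree T le" and hausdorff: "hausdorff_tree T le"
begin

lemma le_refl: "t \<in> T \<Longrightarrow> le t t"
  using tree unfolding is_tree_def by (elim conjE) (rule bspec)

lemma le_antisym:
  assumes "s \<in> T" "t \<in> T" "le s t" "le t s"
  shows "s = t"
proof -
  have "\<forall>s \<in> T. \<forall>t \<in> T. le s t \<and> le t s \<longrightarrow> s = t"
    using tree unfolding is_tree_def by (elim conjE) assumption
  then show ?thesis using assms by blast
qed

lemma le_trans:
  assumes "s \<in> T" "t \<in> T" "u \<in> T" "le s t" "le t u"
  shows "le s u"
proof -
  have "\<forall>s \<in> T. \<forall>t \<in> T. \<forall>u \<in> T. le s t \<and> le t u \<longrightarrow> le s u"
    using tree unfolding is_tree_def by (elim conjE) assumption
  then show ?thesis using assms by blast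
qed

lemma well_ordered_below:
  assumes "t \<in> T"
  shows "(\<forall>s \<in> tdown T le t. \<forall>s' \<in> tdown T le t. le s s' \<or> le s' s) \<and>
    (\<forall>A. A \<subseteq> tdown T le t \<and> A \<noteq> {} \<longrightarrow> (\<exists>m \<in> A. \<forall>a \<in> A. le m a))"
  using tree unfolding is_tree_def by (elim conjE) (rule bspec[OF _ assms])

lemma le_linear_below:
  assumes "s \<in> T" "s' \<in> T" "t \<in> T" "le s t" "le s' t"
  shows "le s s' \<or> le s' s"
  using conjunct1[OF well_ordered_below[OF assms(3)]] assms by (simp add: tdown_def)

lemma least_below:
  assumes "t \<in> T" "A \<subseteq> tdown T le t" "A \<noteq> {}"
  obtains m where "m \<in> A" "\<And>a. a \<in> A \<Longrightarrow> le m a"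
proof -
  have "\<exists>m \<in> A. \<forall>a \<in> A. le m a"
    using conjunct2[OF well_ordered_below[OF assms(1)]] assms(2,3) by simp
  then show thesis using that by blast
qed

lemma tree_induct [consumes 1, case_names less]:
  assumes "t \<in> T"
    and step: "\<And>t. t \<in> T \<Longrightarrow> (\<And>s. s \<in> tbelow T le t \<Longrightarrow> P s) \<Longrightarrow> P t"
  shows "P t"
proof (rule ccontr)
  assume "\<not> P t"
  define A where "A = {s \<in> tdown T le t. \<not> P s}"
  have "A \<subseteq> tdown T le t" "A \<noteq> {}"
    using \<open>\<not> P t\<close> assms(1) le_refl by (auto simp: A_def tdown_def)
  then obtain m where m: "m \<in> A" "\<And>a. a \<in> A \<Longrightarrow> le m a"
    using least_below[OF assms(1)] by metis
  have mT: "m \<in> T" "le m t" "\<not> P m"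
    using m(1) by (auto simp: A_def tdown_def)
  have "P m"
  proof (rule step[OF mT(1)])
    fix s assume "s \<in> tbelow T le m"
    then have s: "s \<in> T" "le s m" "s \<noteq> m"
      by (auto simp: tbelow_def)
    show "P s"
    proof (rule ccontr)
      assume "\<not> P s"
      then have "s \<in> A"
        using s mT assms(1) le_trans[of s m t] by (simp add: A_def tdown_def)
      then show False
        using m(2) s mT le_antisym[of s m] by simp
    qed
  qed
  with mT show False by simp
qed

text \<open>With \<open>s\<close> identified with (0,s], every limit of points of the tree in the
  cube of subsets of \<open>T\<close> is a downward closed chain. Paths thus contain the points
  added by compactification: besides the sets (0,t] there are the empty path and the chains without
  a last point.\<close>

definition path :: "'a set \<Rightarrow> bool" where
  "path X \<longleftrightarrow> X \<subseteq> T \<and> (\<forall>x\<in>X. \<forall>y\<in>T. le y x \<longrightarrow> y \<in> X) \<and> (\<forall>x\<in>X. \<forall>y\<in>X. le x y \<or> le y x)"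

text \<open>A point \<open>s\<close> lies in \<open>up x\<close> iff \<open>x\<close> belongs to
  (0,s], so these sets are the coordinates of the embedding of the tree into the cube.\<close>

definition up :: "'a \<Rightarrow> 'a set" where
  "up x = {s \<in> T. le x s}"

lemma pathI:
  assumes "X \<subseteq> T" "\<And>x y. x \<in> X \<Longrightarrow> y \<in> T \<Longrightarrow> le y x \<Longrightarrow> y \<in> X"
    "\<And>x y. x \<in> X \<Longrightarrow> y \<in> X \<Longrightarrow> le x y \<or> le y x"
  shows "path X"
  using assms unfolding path_def by simp

lemma pathD:
  assumes "path X"
  shows "X \<subseteq> T" "\<And>x y. x \<in> X \<Longrightarrow> y \<in> T \<Longrightarrow> le y x \<Longrightarrow> y \<in> X"
    "\<And>x y. x \<in> X \<Longrightarrow> y \<in> X \<Longrightarrow> le x y \<or> le y x"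
  using assms unfolding path_def by simp_all

lemma path_tdown:
  assumes "t \<in> T"
  shows "path (tdown T le t)"
proof (rule pathI)
  fix x y assume "x \<in> tdown T le t" "y \<in> T" "le y x"
  then show "y \<in> tdown T le t"
    using le_trans[of y x t] assms by (simp add: tdown_def)
next
  fix x y assume "x \<in> tdown T le t" "y \<in> tdown T le t"
  then show "le x y \<or> le y x"
    using le_linear_below[of x y t] assms by (simp add: tdown_def)
qed (simp add: tdown_def)

lemma path_empty: "path {}"
  by (simp add: path_def)

lemma tbelow_eq: "tbelow T le t = tdown T le t - {t}"
  by (auto simp: tbelow_def tdown_def)

lemma path_tbelow:
  assumes "t \<in> T"
  shows "path (tbelow T le t)"
proof (rule pathI)
  fix x y assume "x \<in> tbelow T le t" "y \<in> T" "le y x"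
  then show "y \<in> tbelow T le t"
    using le_trans[of y x t] le_antisym[of x t] assms by (auto simp: tbelow_def)
next
  fix x y assume "x \<in> tbelow T le t" "y \<in> tbelow T le t"
  then show "le x y \<or> le y x"
    using le_linear_below[of x y t] assms by (simp add: tbelow_def)
qed (auto simp: tbelow_def)

text \<open>The point \<open>x\<close> is the direction in which \<open>s\<close> lies beyond the
  path \<open>X\<close>. This makes sense for every path, with or without a last point, and for the
  empty one.\<close>

lemma path_first:
  assumes "path X" "X \<subseteq> tdown T le s" "s \<in> T" "s \<notin> X"
  obtains x where "x \<in> T" "le x s" "x \<notin> X" "tbelow T le x = X"
proof -
  have "tdown T le s - X \<subseteq> tdown T le s" "tdown T le s - X \<noteq> {}"
    using assms le_refl by (auto simp: tdown_def)
  then obtain x where x: "x \<in> tdown T le s - X" "\<And>a. a \<in> tdown T le s - X \<Longrightarrow> le x a"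
    using least_below[OF assms(3)] by metis
  have xT: "x \<in> T" "le x s" "x \<notin> X"
    using x(1) by (auto simp: tdown_def)
  have "tbelow T le x = X"
  proof (intro equalityI subsetI)
    fix y assume "y \<in> tbelow T le x"
    then have y: "y \<in> T" "le y x" "y \<noteq> x"
      by (auto simp: tbelow_def)
    then have "y \<in> tdown T le s"
      using xT assms(3) le_trans[of y x s] by (simp add: tdown_def)
    then show "y \<in> X"
      using x(2)[of y] y xT le_antisym[of y x] by auto
  next
    fix y assume "y \<in> X"
    then have y: "y \<in> T" "le y s"
      using assms(2) by (auto simp: tdown_def)
    have "\<not> le x y"
      using pathD(2)[OF assms(1) \<open>y \<in> X\<close>] xT by auto
    then have "le y x"
      using le_linear_below[of y x s] y xT assms(3) by simp
    then show "y \<in> tbelow T le x"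
      using y xT \<open>y \<in> X\<close> by (auto simp: tbelow_def)
  qed
  with xT that show thesis by blast
qed

lemma limit_heightI:
  assumes "t \<in> T" "tbelow T le t \<noteq> {}" "\<And>m. m \<in> T \<Longrightarrow> tbelow T le t \<noteq> tdown T le m"
  shows "limit_height T le t"
  unfolding limit_height_def
proof (intro conjI notI)
  show "tbelow T le t = {} \<Longrightarrow> False" using assms by simp
  assume "\<exists>m\<in>tbelow T le t. \<forall>s\<in>tbelow T le t. le s m"
  then obtain m where m: "m \<in> tbelow T le t" "\<forall>s\<in>tbelow T le t. le s m"
    by blast
  then have "m \<in> T" by (auto simp: tbelow_def)
  moreover have "tbelow T le t = tdown T le m"
    using m pathD(2)[OF path_tbelow[OF assms(1)], of m] by (auto simp: tdown_def tbelow_def)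
  ultimately show False
    using assms(3) by blast
qed

lemma limit_height_not_tdown: "limit_height T le t \<Longrightarrow> m \<in> T \<Longrightarrow> tbelow T le t \<noteq> tdown T le m"
  using le_refl[of m] by (auto simp: limit_height_def tdown_def)

lemma limit_height_unique:
  "t \<in> T \<Longrightarrow> t' \<in> T \<Longrightarrow> limit_height T le t \<Longrightarrow> tbelow T le t = tbelow T le t' \<Longrightarrow> t = t'"
  using hausdorff unfolding hausdorff_tree_def by simp

lemma path_closure:
  assumes "path e" "e \<noteq> {}" "\<And>m. m \<in> T \<Longrightarrow> e \<noteq> tdown T le m" "e \<subseteq> tdown T le s" "s \<in> T"
  obtains t where "t \<in> T" "le t s" "tbelow T le t = e" "limit_height T le t"
proof -
  have "s \<notin> e"
  proof
    assume "s \<in> e"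
    then have "e = tdown T le s"
      using pathD(2)[OF assms(1) \<open>s \<in> e\<close>] assms(4) by (auto simp: tdown_def)
    with assms(3,5) show False by blast
  qed
  then obtain t where t: "t \<in> T" "le t s" "tbelow T le t = e"
    using path_first[OF assms(1,4,5)] by metis
  moreover have "limit_height T le t"
    using limit_heightI[OF t(1)] assms(2,3) t(3) by simp
  ultimately show thesis using that by blast
qed

text \<open>The path below \<open>t\<close> has a limit on the branch to \<open>s\<close>; by the
  Hausdorff condition this limit is \<open>t\<close> itself.\<close>

lemma limit_le:
  assumes "t \<in> T" "limit_height T le t" "s \<in> T" "tbelow T le t \<subseteq> tdown T le s"
  shows "le t s"
proof -
  have ne: "tbelow T le t \<noteq> {}"
    using assms(2) by (simp add: limit_height_def)
  obtain t' where t': "t' \<in> T" "le t' s" "tbelow T le t' = tbelow T le t"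
    using path_closure[OF path_tbelow[OF assms(1)] ne limit_height_not_tdown[OF assms(2)] assms(4,3)] by metis
  then show ?thesis
    using limit_height_unique[OF assms(1) t'(1) assms(2)] by simp
qed

text \<open>The intersection is a path. If it had no last point, it would have a limit below
  \<open>a\<close> and one below \<open>b\<close>; these coincide in a Hausdorff tree, and the
  common limit would belong to the intersection.\<close>

lemma meet_cases:
  assumes "a \<in> T" "b \<in> T"
  obtains "tdown T le a \<inter> tdown T le b = {}" 
    | m where "m \<in> T" "tdown T le a \<inter> tdown T le b = tdown T le m"
proof -
  define X where "X = tdown T le a \<inter> tdown T le b"
  have "path X"
  proof (rule pathI)
    show "X \<subseteq> T" by (auto simp: X_def tdown_def)
    show "y \<in> X" if "x \<in> X" "y \<in> T" "le y x" for x y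
      using pathD(2)[OF path_tdown[OF assms(1)], of x y] pathD(2)[OF path_tdown[OF assms(2)], of x y] that
      by (simp add: X_def)
    show "le x y \<or> le y x" if "x \<in> X" "y \<in> X" for x y
      using pathD(3)[OF path_tdown[OF assms(1)], of x y] that by (simp add: X_def)
  qed
  have "X = {} \<or> (\<exists>m\<in>T. X = tdown T le m)"
  proof (rule ccontr)
    assume H: "\<not> (X = {} \<or> (\<exists>m\<in>T. X = tdown T le m))"
    then have ne: "X \<noteq> {}" and nm: "\<And>m. m \<in> T \<Longrightarrow> X \<noteq> tdown T le m" by blast+
    have sub: "X \<subseteq> tdown T le a" "X \<subseteq> tdown T le b"
      by (auto simp: X_def)
    obtain x where x: "x \<in> T" "le x a" "tbelow T le x = X" "limit_height T le x"
      by (rule path_closure[OF \<open>path X\<close> ne nm sub(1) assms(1)])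
    obtain y where y: "y \<in> T" "le y b" "tbelow T le y = X" "limit_height T le y"
      by (rule path_closure[OF \<open>path X\<close> ne nm sub(2) assms(2)])
    have "x = y"
      using limit_height_unique[OF x(1) y(1) x(4)] x(3) y(3) by simp
    then have "x \<in> tbelow T le x"
      using x y by (simp add: X_def tdown_def)
    then show False by (simp add: tbelow_def)
  qed
  then show thesis using that unfolding X_def by blast
qed

section \<open>The tree topology and compactness of (0,t]\<close>

abbreviation "\<T> \<equiv> tree_topology T le"

lemma topspace_tree: "topspace \<T> = T"
  unfolding tree_topology_def topology_generated_by_topspace by (auto simp: tdown_def)

lemma openin_tdown: "t \<in> T \<Longrightarrow> openin \<T> (tdown T le t)"
  unfolding tree_topology_def by (rule topology_generated_by_Basis) auto

lemma closedin_tdown: "t \<in> T \<Longrightarrow> closedin \<T> (tdown T le t)"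
  unfolding closedin_def topspace_tree
proof (intro conjI)
  show "openin \<T> (T - tdown T le t)" if "t \<in> T"
    unfolding tree_topology_def using that by (intro topology_generated_by_Basis) auto
qed (simp add: tdown_def)

text \<open>Induction over the generation of the topology. The case with content is the complement
  of (0,u]: by \<open>limit_le\<close> some \<open>s\<close> below \<open>t\<close> is not below
  \<open>u\<close>, and then the whole interval (s,t] avoids (0,u].\<close>

lemma limit_nbhd:
  assumes "openin \<T> U" "t \<in> U" "limit_height T le t"
  shows "\<exists>s\<in>tbelow T le t. \<forall>x\<in>tdown T le t. \<not> le x s \<longrightarrow> x \<in> U"
proof -
  have tT: "t \<in> T"
    using openin_subset[OF assms(1)] assms(2) by (auto simp: topspace_tree)
  have "generate_topology_on ({T} \<union> {tdown T le t | t. t \<in> T} \<union> {T - tdown T le t | t. t \<in> T}) U"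
    using assms(1) unfolding tree_topology_def openin_topology_generated_by_iff .
  then show ?thesis
    using assms(2)
  proof (induction rule: generate_topology_on.induct)
    case Empty
    then show ?case by simp
  next
    case (Int a b)
    then obtain s1 s2 where s: "s1 \<in> tbelow T le t" "\<forall>x\<in>tdown T le t. \<not> le x s1 \<longrightarrow> x \<in> a"
      "s2 \<in> tbelow T le t" "\<forall>x\<in>tdown T le t. \<not> le x s2 \<longrightarrow> x \<in> b"
      by auto
    have sT: "s1 \<in> T" "s2 \<in> T"
      using s by (auto simp: tbelow_def)
    have "le s1 s2 \<or> le s2 s1"
      using pathD(3)[OF path_tbelow[OF tT] s(1,3)] .
    then obtain s where "s \<in> tbelow T le t" "le s1 s" "le s2 s"
      using s(1,3) sT le_refl by blast
    then show ?case
      using s(2,4) sT le_trans[of _ s1 s] le_trans[of _ s2 s]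
      by (intro bexI[of _ s]) (auto simp: tdown_def tbelow_def)
  next
    case (UN K)
    then obtain k where k: "k \<in> K" "t \<in> k" by blast
    show ?case
      using UN.IH[OF k] k(1) by blast
  next
    case (Basis S)
    obtain r where r: "r \<in> tbelow T le t"
      using assms(3) by (auto simp: limit_height_def)
    consider "S = T" | u where "u \<in> T" "S = tdown T le u" | u where "u \<in> T" "S = T - tdown T le u"
      using Basis(1) by blast
    then show ?case
    proof cases
      case 1
      then show ?thesis using r by (auto simp: tdown_def)
    next
      case 2
      then have "x \<in> S" if "x \<in> tdown T le t" for x
        using that Basis(2) tT le_trans[of x t u] by (simp add: tdown_def)
      then show ?thesis using r by blast
    next
      case 3
      then have "\<not> tbelow T le t \<subseteq> tdown T le u"
        using limit_le[OF tT assms(3), of u] Basis(2) by (auto simp: tdown_def)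
      then obtain s where s: "s \<in> tbelow T le t" "\<not> le s u"
        by (auto simp: tdown_def tbelow_def)
      have "x \<in> S" if x: "x \<in> tdown T le t" "\<not> le x s" for x
      proof -
        have "le s x"
          using le_linear_below[of s x t] s x tT by (auto simp: tdown_def tbelow_def)
        then show ?thesis
          using 3 s x le_trans[of s x u] by (auto simp: tdown_def tbelow_def)
      qed
      then show ?thesis using s(1) by blast
    qed
  qed
qed

lemma point_cases:
  assumes "t \<in> T"
  obtains "tbelow T le t = {}" | p where "p \<in> T" "t \<in> tsucc T le p" | "limit_height T le t"
  using limit_heightI[OF assms] assms by (auto simp: tsucc_def)

text \<open>At a limit point one member of the cover already contains an interval (s,t], and the
  induction hypothesis treats the remaining (0,s].\<close>

lemma compactin_tdown: "t \<in> T \<Longrightarrow> compactin \<T> (tdown T le t)"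
proof (induction t rule: tree_induct)
  case (less t)
  have eq: "tdown T le t = insert t (tbelow T le t)"
    using less(1) le_refl by (auto simp: tbelow_eq tdown_def)
  have sing: "compactin \<T> {t}"
    using less(1) by (simp add: topspace_tree)
  show ?case
    using less(1)
  proof (cases rule: point_cases)
    case 1
    then show ?thesis using sing eq by simp
  next
    case (2 p)
    then have "tbelow T le t = tdown T le p" "p \<in> tbelow T le t"
      using le_refl[of p] by (auto simp: tsucc_def tdown_def)
    then show ?thesis
      using compactin_Un[OF sing less(2)[of p]] eq by simp
  next
    case 3
    show ?thesis
      unfolding compactin_def
    proof (intro conjI allI impI)
      show "tdown T le t \<subseteq> topspace \<T>"
        by (auto simp: topspace_tree tdown_def)
      fix \<U> assume U: "Ball \<U> (openin \<T>) \<and> tdown T le t \<subseteq> \<Union> \<U>"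
      then have "t \<in> \<Union> \<U>"
        unfolding eq by simp
      then obtain U where U1: "U \<in> \<U>" "t \<in> U" "openin \<T> U"
        using U by blast
      obtain s where s: "s \<in> tbelow T le t" "\<forall>x\<in>tdown T le t. \<not> le x s \<longrightarrow> x \<in> U"
        using limit_nbhd[OF U1(3,2) 3] by blast
      have sub: "tdown T le s \<subseteq> tdown T le t"
        using s(1) less(1) le_trans[of _ s t] by (auto simp: tdown_def tbelow_def)
      obtain \<F> where "finite \<F>" "\<F> \<subseteq> \<U>" "tdown T le s \<subseteq> \<Union> \<F>"
        using less(2)[OF s(1)] conjunct1[OF U] order_trans[OF sub conjunct2[OF U]]
        unfolding compactin_def by blast
      then have "finite (insert U \<F>) \<and> insert U \<F> \<subseteq> \<U> \<and> tdown T le t \<subseteq> \<Union> (insert U \<F>)"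
        using s(2) U1(1) by (auto simp: tdown_def)
      then show "\<exists>\<F>. finite \<F> \<and> \<F> \<subseteq> \<U> \<and> tdown T le t \<subseteq> \<Union> \<F>" by blast
    qed
  qed
qed

section \<open>The space \<open>C\<^sub>0\<close> and combinations of indicators\<close>

abbreviation "C \<equiv> C0 T le"

lemma C0_D:
  assumes "f \<in> C"
  shows "continuous_map \<T> euclideanreal f" "\<And>\<epsilon>. \<epsilon> > 0 \<Longrightarrow> compactin \<T> {t \<in> T. \<epsilon> \<le> \<bar>f t\<bar>}"
    "\<And>t. t \<notin> T \<Longrightarrow> f t = 0"
  using assms by (simp_all add: C0_def)

lemma closedin_level:
  assumes "continuous_map \<T> euclideanreal f"
  shows "closedin \<T> {t \<in> T. \<epsilon> \<le> \<bar>f t\<bar>}"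
proof -
  have "closed {y::real. \<epsilon> \<le> \<bar>y\<bar>}"
    by (intro closed_Collect_le continuous_intros)
  then have "closedin \<T> {t \<in> topspace \<T>. f t \<in> {y. \<epsilon> \<le> \<bar>y\<bar>}}"
    using closedin_continuous_map_preimage[OF assms] unfolding closed_closedin by blast
  then show ?thesis by (simp add: topspace_tree)
qed

lemma C0_dominated:
  assumes "continuous_map \<T> euclideanreal f" "\<And>t. t \<notin> T \<Longrightarrow> f t = 0"
    and "\<And>\<epsilon>. \<epsilon> > 0 \<Longrightarrow> \<exists>K. compactin \<T> K \<and> {t \<in> T. \<epsilon> \<le> \<bar>f t\<bar>} \<subseteq> K"
  shows "f \<in> C"
  unfolding C0_def using assms closed_compactin[OF _ _ closedin_level[OF assms(1)]] by blast

lemma C0_zero: "(\<lambda>t. 0) \<in> C"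
  by (rule C0_dominated) (auto intro!: exI[of _ "{}"])

lemma C0_add:
  assumes "f \<in> C" "g \<in> C"
  shows "(\<lambda>t. f t + g t) \<in> C"
proof (rule C0_dominated)
  show "continuous_map \<T> euclideanreal (\<lambda>t. f t + g t)"
    using C0_D(1)[OF assms(1)] C0_D(1)[OF assms(2)] by (intro continuous_intros)
  show "f t + g t = 0" if "t \<notin> T" for t
    using C0_D(3)[OF assms(1) that] C0_D(3)[OF assms(2) that] by simp
  fix \<epsilon> :: real assume "\<epsilon> > 0"
  then have "compactin \<T> ({t \<in> T. \<epsilon>/2 \<le> \<bar>f t\<bar>} \<union> {t \<in> T. \<epsilon>/2 \<le> \<bar>g t\<bar>})"
    using C0_D(2)[OF assms(1), of "\<epsilon>/2"] C0_D(2)[OF assms(2), of "\<epsilon>/2"] by (intro compactin_Un) simp_all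
  then show "\<exists>K. compactin \<T> K \<and> {t \<in> T. \<epsilon> \<le> \<bar>f t + g t\<bar>} \<subseteq> K"
    by (intro exI conjI) (assumption, auto)
qed

lemma C0_scale:
  assumes "f \<in> C"
  shows "(\<lambda>t. c * f t) \<in> C"
proof (rule C0_dominated)
  show "continuous_map \<T> euclideanreal (\<lambda>t. c * f t)"
    using C0_D(1)[OF assms(1)] by (intro continuous_intros)
  show "c * f t = 0" if "t \<notin> T" for t
    using C0_D(3)[OF assms that] by simp
  fix \<epsilon> :: real assume e: "\<epsilon> > 0"
  have "\<epsilon> / (\<bar>c\<bar> + 1) \<le> \<bar>f t\<bar>" if "\<epsilon> \<le> \<bar>c * f t\<bar>" for t
  proof -
    have "\<epsilon> \<le> (\<bar>c\<bar> + 1) * \<bar>f t\<bar>"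
      using that by (simp add: abs_mult algebra_simps)
    then show ?thesis by (simp add: field_simps)
  qed
  moreover have "compactin \<T> {t \<in> T. \<epsilon> / (\<bar>c\<bar> + 1) \<le> \<bar>f t\<bar>}"
    using C0_D(2)[OF assms(1), of "\<epsilon> / (\<bar>c\<bar> + 1)"] e by simp
  ultimately show "\<exists>K. compactin \<T> K \<and> {t \<in> T. \<epsilon> \<le> \<bar>c * f t\<bar>} \<subseteq> K"
    by (intro exI conjI) (assumption, auto)
qed

lemma C0_diff:
  assumes "f \<in> C" "g \<in> C"
  shows "(\<lambda>t. f t - g t) \<in> C"
  using C0_add[OF assms(1) C0_scale[OF assms(2), of "-1"]] by simp

lemma C0_sum:
  "finite A \<Longrightarrow> (\<And>a. a \<in> A \<Longrightarrow> h a \<in> C) \<Longrightarrow> (\<lambda>t. \<Sum>a\<in>A. h a t) \<in> C"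
  by (induction A rule: finite_induct) (auto simp: C0_zero intro!: C0_add)

definition ch :: "'a \<Rightarrow> 'a \<Rightarrow> real" where
  "ch t x = (if x \<in> T \<and> le x t then 1 else 0)"

lemma C0_ch:
  assumes "t \<in> T"
  shows "ch t \<in> C"
proof (rule C0_dominated)
  have "openin \<T> {x \<in> topspace \<T>. ch t x \<in> U}" for U
  proof -
    have o: "openin \<T> (tdown T le t)" "openin \<T> (T - tdown T le t)" "openin \<T> T"
      using openin_tdown[OF assms] closedin_tdown[OF assms] openin_topspace[of \<T>]
      by (auto simp: closedin_def topspace_tree)
    have "{x \<in> T. ch t x \<in> U} = (if 1 \<in> U then tdown T le t else {}) \<union> (if 0 \<in> U then T - tdown T le t else {})"
      by (auto simp: ch_def tdown_def split: if_splits)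
    then show ?thesis
      unfolding topspace_tree using o by (simp add: openin_Un)
  qed
  then show "continuous_map \<T> euclideanreal (ch t)"
    by (simp add: continuous_map_def)
  show "ch t x = 0" if "x \<notin> T" for x
    using that by (simp add: ch_def)
  show "\<exists>K. compactin \<T> K \<and> {x \<in> T. \<epsilon> \<le> \<bar>ch t x\<bar>} \<subseteq> K" if "\<epsilon> > 0" for \<epsilon> :: real
    using compactin_tdown[OF assms] that
    by (intro exI[of _ "tdown T le t"]) (auto simp: ch_def tdown_def)
qed

text \<open>The sets (0,j] are open and cover the compact level set. Later arguments use this as the
  statement that \<open>f\<close> is small off finitely many chains.\<close>

lemma C0_support:
  assumes "f \<in> C" "\<epsilon> > 0"
  obtains J where "finite J" "J \<subseteq> T" "\<And>x. x \<in> T \<Longrightarrow> \<epsilon> \<le> \<bar>f x\<bar> \<Longrightarrow> \<exists>j\<in>J. le x j"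
proof -
  have c: "compactin \<T> {t \<in> T. \<epsilon> \<le> \<bar>f t\<bar>}"
    using C0_D(2) assms by simp
  moreover have "{t \<in> T. \<epsilon> \<le> \<bar>f t\<bar>} \<subseteq> \<Union> (tdown T le ` T)"
    using le_refl by (auto simp: tdown_def)
  moreover have "Ball (tdown T le ` T) (openin \<T>)"
    using openin_tdown by blast
  ultimately obtain \<F> where F: "finite \<F>" "\<F> \<subseteq> tdown T le ` T" "{t \<in> T. \<epsilon> \<le> \<bar>f t\<bar>} \<subseteq> \<Union> \<F>"
    unfolding compactin_def by meson
  obtain J where J: "J \<subseteq> T" "finite J" "\<F> = tdown T le ` J"
    using finite_subset_image[OF F(1,2)] by blast
  show thesis
    using that[OF J(2,1)] F(3) by (auto simp: J(3) tdown_def)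
qed

lemma C0_bounded:
  assumes "f \<in> C"
  obtains B where "\<And>t. \<bar>f t\<bar> \<le> B"
proof -
  have "compactin euclideanreal (f ` {t \<in> T. 1 \<le> \<bar>f t\<bar>})"
    using image_compactin[OF C0_D(2)[OF assms] C0_D(1)[OF assms]] by simp
  then have "bounded (f ` {t \<in> T. 1 \<le> \<bar>f t\<bar>})"
    using compact_imp_bounded by simp
  then obtain B where B: "\<And>t. t \<in> T \<Longrightarrow> 1 \<le> \<bar>f t\<bar> \<Longrightarrow> \<bar>f t\<bar> \<le> B"
    unfolding bounded_iff by auto
  have "\<bar>f t\<bar> \<le> max B 1" for t
    using B[of t] C0_D(3)[OF assms, of t] by (cases "t \<in> T"; cases "1 \<le> \<bar>f t\<bar>") auto
  then show thesis by (rule that)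
qed

section \<open>The supremum norm\<close>

abbreviation "sn \<equiv> supnorm T"

lemma supnorm_upper:
  assumes "f \<in> C"
  shows "\<bar>f t\<bar> \<le> sn f"
proof -
  obtain B where "\<And>t. \<bar>f t\<bar> \<le> B"
    using C0_bounded[OF assms] by blast
  then have bdd: "bdd_above (insert 0 ((\<lambda>t. \<bar>f t\<bar>) ` T))"
    by (auto intro!: bdd_aboveI[of _ B])
  show ?thesis
  proof (cases "t \<in> T")
    case True
    then show ?thesis unfolding supnorm_def using cSup_upper[OF _ bdd] by blast
  next
    case False
    then show ?thesis
      unfolding supnorm_def using cSup_upper[OF _ bdd, of 0] C0_D(3)[OF assms] by simp
  qed
qed

lemma supnorm_nonneg: "f \<in> C \<Longrightarrow> 0 \<le> sn f"
  using supnorm_upper[of f undefined] by linarith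

lemma supnorm_least: "0 \<le> B \<Longrightarrow> (\<And>t. t \<in> T \<Longrightarrow> \<bar>f t\<bar> \<le> B) \<Longrightarrow> sn f \<le> B"
  unfolding supnorm_def by (rule cSup_least) auto

lemma supnorm_add: "f \<in> C \<Longrightarrow> g \<in> C \<Longrightarrow> sn (\<lambda>t. f t + g t) \<le> sn f + sn g"
  by (rule supnorm_least)
    (auto intro!: add_nonneg_nonneg supnorm_nonneg order_trans[OF abs_triangle_ineq] add_mono supnorm_upper)

lemma supnorm_scale_le: "f \<in> C \<Longrightarrow> sn (\<lambda>t. c * f t) \<le> \<bar>c\<bar> * sn f"
  by (rule supnorm_least) (auto simp: abs_mult intro!: mult_nonneg_nonneg supnorm_nonneg mult_left_mono supnorm_upper)

lemma supnorm_ch: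
  assumes "t \<in> T"
  shows "sn (ch t) = 1"
proof (rule antisym)
  show "sn (ch t) \<le> 1" by (rule supnorm_least) (auto simp: ch_def)
  show "1 \<le> sn (ch t)"
    using supnorm_upper[OF C0_ch[OF assms], of t] le_refl[OF assms] assms by (simp add: ch_def)
qed

section \<open>Finite combinations of indicators and their density\<close>

definition comb :: "'a set \<Rightarrow> ('a \<Rightarrow> real) \<Rightarrow> 'a \<Rightarrow> real" where
  "comb A c x = (\<Sum>a\<in>A. c a * ch a x)"

lemma C0_comb: "finite A \<Longrightarrow> A \<subseteq> T \<Longrightarrow> comb A c \<in> C"
proof -
  assume "finite A" "A \<subseteq> T"
  then have "(\<lambda>x. \<Sum>a\<in>A. c a * ch a x) \<in> C"
    using C0_ch by (intro C0_sum C0_scale) auto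
  moreover have "comb A c = (\<lambda>x. \<Sum>a\<in>A. c a * ch a x)"
    by (simp add: comb_def fun_eq_iff)
  ultimately show ?thesis by simp
qed

lemma comb_superset:
  assumes "finite B" "A \<subseteq> B"
  shows "comb A c = comb B (\<lambda>a. if a \<in> A then c a else 0)"
proof
  fix x
  show "comb A c x = comb B (\<lambda>a. if a \<in> A then c a else 0) x"
    unfolding comb_def
    by (rule sum.mono_neutral_cong_left) (use assms in auto)
qed

lemma comb_add:
  assumes "finite A" "finite B"
  shows "(\<lambda>x. comb A c x + comb B d x) =
    comb (A \<union> B) (\<lambda>a. (if a \<in> A then c a else 0) + (if a \<in> B then d a else 0))"
proof -
  have 1: "comb A c = comb (A \<union> B) (\<lambda>a. if a \<in> A then c a else 0)"
    by (rule comb_superset) (use assms in auto)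
  have 2: "comb B d = comb (A \<union> B) (\<lambda>a. if a \<in> B then d a else 0)"
    by (rule comb_superset) (use assms in auto)
  show ?thesis
    unfolding 1 2 by (simp add: comb_def fun_eq_iff sum.distrib distrib_right)
qed

lemma comb_scale: "(\<lambda>x. k * comb A c x) = comb A (\<lambda>a. k * c a)"
  by (simp add: comb_def fun_eq_iff sum_distrib_left mult.assoc)

lemma comb_sing: "comb {t} (\<lambda>_. 1) = ch t"
  by (simp add: comb_def fun_eq_iff)

lemma comb_above:
  assumes "finite A" "x \<in> T"
  shows "comb A c x = (\<Sum>a\<in>{a\<in>A. le x a}. c a)"
  unfolding comb_def by (rule sum.mono_neutral_cong_right) (use assms in \<open>auto simp: ch_def\<close>)

definition combs :: "('a \<Rightarrow> real) set" where
  "combs = {comb A c | A c. finite A \<and> A \<subseteq> T}"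

lemma combsI: "finite A \<Longrightarrow> A \<subseteq> T \<Longrightarrow> comb A c \<in> combs"
  unfolding combs_def by blast

lemma combsE:
  assumes "f \<in> combs"
  obtains A c where "finite A" "A \<subseteq> T" "f = comb A c"
  using assms unfolding combs_def by blast

lemma combs_add:
  assumes "f \<in> combs" "g \<in> combs"
  shows "(\<lambda>x. f x + g x) \<in> combs"
proof -
  obtain A c where A: "finite A" "A \<subseteq> T" "f = comb A c"
    using assms(1) by (rule combsE)
  obtain B d where B: "finite B" "B \<subseteq> T" "g = comb B d"
    using assms(2) by (rule combsE)
  show ?thesis
    unfolding A(3) B(3) comb_add[OF A(1) B(1)] by (rule combsI) (use A B in auto)
qed

lemma combs_scale: "f \<in> combs \<Longrightarrow> (\<lambda>x. k * f x) \<in> combs"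
  by (erule combsE) (simp add: comb_scale combsI)

lemma combs_diff: "f \<in> combs \<Longrightarrow> g \<in> combs \<Longrightarrow> (\<lambda>x. f x - g x) \<in> combs"
  using combs_add[of f "\<lambda>x. -1 * g x"] combs_scale[of g "-1"] by simp

lemma combs_zero: "(\<lambda>x. 0) \<in> combs"
proof -
  have "comb {} (\<lambda>_. 0) = (\<lambda>x. 0)"
    by (simp add: comb_def fun_eq_iff)
  then show ?thesis
    using combsI[of "{}" "\<lambda>_. 0"] by simp
qed

lemma combs_ch: "t \<in> T \<Longrightarrow> ch t \<in> combs"
  using combsI[of "{t}" "\<lambda>_. 1"] by (simp add: comb_sing)

lemma combs_sum: "finite A \<Longrightarrow> (\<And>a. a \<in> A \<Longrightarrow> h a \<in> combs) \<Longrightarrow> (\<lambda>x. \<Sum>a\<in>A. h a x) \<in> combs"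
  by (induction A rule: finite_induct) (auto simp: combs_zero intro!: combs_add)

text \<open>Since two sets (0,a] and (0,b] meet in such a set or not at all, the combinations are
  closed under restriction to (0,b]. This permits gluing approximations chain by chain.\<close>

lemma combs_ch_mult_ch:
  assumes "a \<in> T" "b \<in> T"
  shows "(\<lambda>x. ch a x * ch b x) \<in> combs"
  using assms
proof (cases rule: meet_cases)
  case 1
  then have "(\<lambda>x. ch a x * ch b x) = (\<lambda>x. 0)"
    by (auto simp: ch_def tdown_def fun_eq_iff)
  then show ?thesis by (simp add: combs_zero)
next
  case (2 m)
  have "(x \<in> T \<and> le x a \<and> le x b) = (x \<in> T \<and> le x m)" for x
    using 2(2) by (auto simp: tdown_def)
  then have "(\<lambda>x. ch a x * ch b x) = ch m"
    by (auto simp: ch_def fun_eq_iff)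
  then show ?thesis using combs_ch[OF 2(1)] by simp
qed

lemma combs_mult_ch:
  assumes "f \<in> combs" "b \<in> T"
  shows "(\<lambda>x. f x * ch b x) \<in> combs"
proof -
  obtain A c where A: "finite A" "A \<subseteq> T" "f = comb A c"
    using assms(1) by (rule combsE)
  have "(\<lambda>x. \<Sum>a\<in>A. c a * (ch a x * ch b x)) \<in> combs"
    by (rule combs_sum[OF A(1)], rule combs_scale, rule combs_ch_mult_ch) (use A(2) assms(2) in auto)
  moreover have "(\<lambda>x. comb A c x * ch b x) = (\<lambda>x. \<Sum>a\<in>A. c a * (ch a x * ch b x))"
    by (simp add: fun_eq_iff comb_def sum_distrib_right mult.assoc)
  ultimately show ?thesis
    unfolding A(3) by simp
qed

text \<open>Given an approximation up to some \<open>s\<close> below \<open>t\<close>, the constant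
  \<open>f t\<close> is used on the interval (s,t]. This is good enough if (s,t] is just
  \<open>t\<close>, at a successor, or if \<open>s\<close> comes from continuity of
  \<open>f\<close>, at a limit. Vanishing off (0,t] prepares the gluing of several chains.\<close>

lemma approx_on_chain:
  assumes "f \<in> C" "\<epsilon> > 0" "t \<in> T"
  shows "\<exists>g\<in>combs. \<forall>x. (le x t \<and> x \<in> T \<longrightarrow> \<bar>f x - g x\<bar> \<le> \<epsilon>) \<and> (\<not> (le x t \<and> x \<in> T) \<longrightarrow> g x = 0)"
  using assms(3)
proof (induction t rule: tree_induct)
  case (less t)
  have step: ?case if s: "s \<in> tbelow T le t" "\<And>x. x \<in> T \<Longrightarrow> le x t \<Longrightarrow> \<not> le x s \<Longrightarrow> \<bar>f x - f t\<bar> \<le> \<epsilon>" for s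
  proof -
    have sT: "s \<in> T" "le s t" "\<And>x. x \<in> T \<Longrightarrow> le x s \<Longrightarrow> le x t"
      using s(1) less(1) le_trans[of _ s t] by (auto simp: tbelow_def)
    obtain g where g: "g \<in> combs" "\<And>x. le x s \<and> x \<in> T \<Longrightarrow> \<bar>f x - g x\<bar> \<le> \<epsilon>"
      "\<And>x. \<not> (le x s \<and> x \<in> T) \<Longrightarrow> g x = 0"
      using less(2)[OF s(1)] by blast
    \<comment> \<open>\<open>ch t - ch s\<close> is the indicator of the interval (s,t].\<close>
    define g' where "g' = (\<lambda>x. g x + f t * (ch t x - ch s x))"
    have "g' \<in> combs"
      unfolding g'_def using sT less(1)
      by (intro combs_add[OF g(1)] combs_scale combs_diff combs_ch)
    moreover have "\<bar>f x - g' x\<bar> \<le> \<epsilon>" if x: "le x t" "x \<in> T" for x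
    proof (cases "le x s")
      case True
      then have "g' x = g x"
        using x by (simp add: g'_def ch_def)
      then show ?thesis using g(2)[of x] True x by simp
    next
      case False
      then have "g' x = f t"
        using x g(3)[of x] by (simp add: g'_def ch_def)
      then show ?thesis using s(2)[OF x(2,1) False] by simp
    qed
    moreover have "g' x = 0" if x: "\<not> (le x t \<and> x \<in> T)" for x
    proof -
      have "\<not> (le x s \<and> x \<in> T)"
        using x sT(3)[of x] by blast
      then show ?thesis
        using g(3)[of x] x unfolding g'_def ch_def by auto
    qed
    ultimately show ?thesis
      by (intro bexI[of _ g'] allI conjI impI) blast+
  qed
  show ?case
    using less(1)
  proof (cases rule: point_cases)
    case 1
    then have eq: "x = t" if "le x t" "x \<in> T" for x
      using that by (auto simp: tbelow_def)
    have "\<bar>f x - f t * ch t x\<bar> \<le> \<epsilon>" if "le x t" "x \<in> T" for x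
      using eq[OF that] that assms(2) by (simp add: ch_def)
    moreover have "f t * ch t x = 0" if "\<not> (le x t \<and> x \<in> T)" for x
      using that by (auto simp: ch_def)
    moreover have "(\<lambda>x. f t * ch t x) \<in> combs"
      by (rule combs_scale[OF combs_ch[OF less(1)]])
    ultimately show ?thesis
      by (intro bexI[of _ "\<lambda>x. f t * ch t x"] allI conjI impI) blast+
  next
    case (2 p)
    then have eq: "tbelow T le t = tdown T le p" by (simp add: tsucc_def)
    show ?thesis
    proof (rule step)
      show "p \<in> tbelow T le t"
        using 2(1) le_refl[of p] by (simp add: eq tdown_def)
      fix x assume x: "x \<in> T" "le x t" "\<not> le x p"
      then have "x \<notin> tbelow T le t"
        unfolding eq by (simp add: tdown_def)
      then have "x = t"
        using x by (simp add: tbelow_def)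
      then show "\<bar>f x - f t\<bar> \<le> \<epsilon>"
        using assms(2) by simp
    qed
  next
    case 3
    have "openin \<T> {x \<in> topspace \<T>. f x \<in> ball (f t) \<epsilon>}"
      using openin_continuous_map_preimage[OF C0_D(1)[OF assms(1)], of "ball (f t) \<epsilon>"]
      by (simp only: open_openin[symmetric] open_ball simp_thms)
    then obtain s where s: "s \<in> tbelow T le t"
      "\<forall>x\<in>tdown T le t. \<not> le x s \<longrightarrow> x \<in> {x \<in> topspace \<T>. f x \<in> ball (f t) \<epsilon>}"
      using limit_nbhd[OF _ _ 3, of "{x \<in> topspace \<T>. f x \<in> ball (f t) \<epsilon>}"] less(1) assms(2)
      by (auto simp: topspace_tree)
    show ?thesis
    proof (rule step[OF s(1)])
      fix x assume "x \<in> T" "le x t" "\<not> le x s"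
      then show "\<bar>f x - f t\<bar> \<le> \<epsilon>"
        using s(2) by (auto simp: tdown_def dist_real_def)
    qed
  qed
qed

text \<open>On the complement of \<open>(0,b]\<close> the approximation of \<open>f\<close> already found is kept, on \<open>(0,b]\<close>
  it is replaced; in this way errors do not add up.\<close>

lemma approx_on_chains:
  assumes "f \<in> C" "\<epsilon> > 0" "finite J" "J \<subseteq> T"
  shows "\<exists>g\<in>combs. \<forall>x. ((\<exists>j\<in>J. le x j) \<and> x \<in> T \<longrightarrow> \<bar>f x - g x\<bar> \<le> \<epsilon>) \<and> (\<not> ((\<exists>j\<in>J. le x j) \<and> x \<in> T) \<longrightarrow> g x = 0)"
  using assms(3,4)
proof (induction J rule: finite_induct)
  case empty
  then show ?case using combs_zero by auto
next
  case (insert b J)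
  then obtain g where g: "g \<in> combs" "\<And>x. (\<exists>j\<in>J. le x j) \<and> x \<in> T \<Longrightarrow> \<bar>f x - g x\<bar> \<le> \<epsilon>"
    "\<And>x. \<not> ((\<exists>j\<in>J. le x j) \<and> x \<in> T) \<Longrightarrow> g x = 0"
    by auto
  obtain h where h: "h \<in> combs" "\<And>x. le x b \<and> x \<in> T \<Longrightarrow> \<bar>f x - h x\<bar> \<le> \<epsilon>"
    "\<And>x. \<not> (le x b \<and> x \<in> T) \<Longrightarrow> h x = 0"
    using approx_on_chain[OF assms(1,2), of b] insert(4) by auto
  have "(\<lambda>x. g x - g x * ch b x + h x) \<in> combs"
    using insert(4) g(1) h(1) by (intro combs_add combs_diff combs_mult_ch) auto
  moreover have "\<bar>f x - (g x - g x * ch b x + h x)\<bar> \<le> \<epsilon>" if "(\<exists>j\<in>insert b J. le x j) \<and> x \<in> T" for x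
    using g(2)[of x] h(2,3)[of x] that by (cases "le x b") (auto simp: ch_def)
  moreover have "g x - g x * ch b x + h x = 0" if "\<not> ((\<exists>j\<in>insert b J. le x j) \<and> x \<in> T)" for x
    using g(3)[of x] h(3)[of x] that by auto
  ultimately show ?case
    by (intro bexI[of _ "\<lambda>x. g x - g x * ch b x + h x"] allI conjI impI) blast+
qed

lemma combs_dense:
  assumes "f \<in> C" "\<epsilon> > 0"
  obtains A c where "finite A" "A \<subseteq> T" "\<And>x. \<bar>f x - comb A c x\<bar> \<le> \<epsilon>"
proof -
  obtain J where J: "finite J" "J \<subseteq> T" "\<And>x. x \<in> T \<Longrightarrow> \<epsilon> \<le> \<bar>f x\<bar> \<Longrightarrow> \<exists>j\<in>J. le x j"
    using C0_support[OF assms] by blast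
  obtain g where g: "g \<in> combs" "\<And>x. (\<exists>j\<in>J. le x j) \<and> x \<in> T \<Longrightarrow> \<bar>f x - g x\<bar> \<le> \<epsilon>"
    "\<And>x. \<not> ((\<exists>j\<in>J. le x j) \<and> x \<in> T) \<Longrightarrow> g x = 0"
    using approx_on_chains[OF assms J(1,2)] by blast
  have "\<bar>f x - g x\<bar> \<le> \<epsilon>" for x
  proof (cases "(\<exists>j\<in>J. le x j) \<and> x \<in> T")
    case True
    then show ?thesis using g(2) by blast
  next
    case False
    then have "\<bar>f x\<bar> \<le> \<epsilon>"
      using J(3)[of x] C0_D(3)[OF assms(1), of x] assms(2) by (cases "x \<in> T") force+
    then show ?thesis using g(3)[OF False] by simp
  qed
  then show thesis
    using that g(1) by (metis combsE)
qed

end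

section \<open>A Hahn--Banach theorem and a compactness principle\<close>

definition fun_subspace :: "('b \<Rightarrow> real) set \<Rightarrow> bool" where
  "fun_subspace V \<longleftrightarrow> (\<lambda>t. 0) \<in> V \<and> (\<forall>f\<in>V. \<forall>g\<in>V. (\<lambda>t. f t + g t) \<in> V) \<and> (\<forall>f\<in>V. \<forall>c. (\<lambda>t. c * f t) \<in> V)"

definition sublinear_on :: "('b \<Rightarrow> real) set \<Rightarrow> (('b \<Rightarrow> real) \<Rightarrow> real) \<Rightarrow> bool" where
  "sublinear_on V p \<longleftrightarrow> (\<forall>f\<in>V. \<forall>g\<in>V. p (\<lambda>t. f t + g t) \<le> p f + p g) \<and>
     (\<forall>f\<in>V. \<forall>c\<ge>0. p (\<lambda>t. c * f t) = c * p f)"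

lemma sublinear_onI:
  assumes "\<And>f g. f \<in> V \<Longrightarrow> g \<in> V \<Longrightarrow> p (\<lambda>t. f t + g t) \<le> p f + p g"
    "\<And>f c. f \<in> V \<Longrightarrow> c \<ge> 0 \<Longrightarrow> p (\<lambda>t. c * f t) = c * p f"
  shows "sublinear_on V p"
  using assms unfolding sublinear_on_def by simp

lemma sublinear_onD:
  assumes "sublinear_on V p" "f \<in> V"
  shows "g \<in> V \<Longrightarrow> p (\<lambda>t. f t + g t) \<le> p f + p g"
    "c \<ge> 0 \<Longrightarrow> p (\<lambda>t. c * f t) = c * p f"
  using assms unfolding sublinear_on_def by auto

context
  fixes V :: "('b \<Rightarrow> real) set"
  assumes V: "fun_subspace V"
begin

lemma subspace_add: "f \<in> V \<Longrightarrow> g \<in> V \<Longrightarrow> (\<lambda>t. f t + g t) \<in> V"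
  and subspace_scale: "f \<in> V \<Longrightarrow> (\<lambda>t. c * f t) \<in> V"
  and subspace_zero: "(\<lambda>t. 0) \<in> V"
  using V unfolding fun_subspace_def by auto

lemma subspace_minus: "f \<in> V \<Longrightarrow> (\<lambda>t. - f t) \<in> V"
  using subspace_scale[of f "-1"] by simp

lemma sublinear_zero: "sublinear_on V p \<Longrightarrow> p (\<lambda>t. 0) = 0"
  using sublinear_onD(2)[OF _ subspace_zero, of p 0] by simp

lemma sublinear_minus_ge:
  assumes "sublinear_on V p" "f \<in> V"
  shows "- p (\<lambda>t. - f t) \<le> p f"
  using sublinear_onD(1)[OF assms subspace_minus[OF assms(2)]] sublinear_zero[OF assms(1)] by simp

text \<open>The classical modification of a sublinear functional in one direction: the result stays
  sublinear and below \<open>p\<close>, but is at most \<open>- p y\<close> at the negative of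
  \<open>y\<close>, so that it is linear along \<open>y\<close>.\<close>

definition tilt :: "(('b \<Rightarrow> real) \<Rightarrow> real) \<Rightarrow> ('b \<Rightarrow> real) \<Rightarrow> ('b \<Rightarrow> real) \<Rightarrow> real" where
  "tilt p y x = (INF t\<in>{0..}. p (\<lambda>s. x s + t * y s) - t * p y)"

context
  fixes p y
  assumes p: "sublinear_on V p" and y: "y \<in> V"
begin

lemma tilt_le:
  assumes "x \<in> V" "t \<ge> 0"
  shows "tilt p y x \<le> p (\<lambda>s. x s + t * y s) - t * p y"
proof -
  \<comment> \<open>A lower bound independent of \<open>t\<close>; it makes the infimum
    finite.\<close>
  have "- p (\<lambda>s. - x s) \<le> p (\<lambda>s. x s + t * y s) - t * p y" if "t \<ge> 0" for t
  proof -
    have "p (\<lambda>s. (x s + t * y s) + - x s) \<le> p (\<lambda>s. x s + t * y s) + p (\<lambda>s. - x s)"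
      using assms(1) y by (intro sublinear_onD(1)[OF p] subspace_add subspace_scale subspace_minus)
    then show ?thesis
      using sublinear_onD(2)[OF p y that] by simp
  qed
  then have "bdd_below ((\<lambda>t. p (\<lambda>s. x s + t * y s) - t * p y) ` {0..})"
    by (intro bdd_belowI2[where m = "- p (\<lambda>s. - x s)"]) simp
  then show ?thesis
    unfolding tilt_def using assms(2) by (intro cINF_lower) simp_all
qed

lemma tilt_ge:
  assumes "\<And>t. t \<ge> 0 \<Longrightarrow> b \<le> p (\<lambda>s. x s + t * y s) - t * p y"
  shows "b \<le> tilt p y x"
  unfolding tilt_def by (rule cINF_greatest) (use assms in auto)

lemma tilt_le_self: "x \<in> V \<Longrightarrow> tilt p y x \<le> p x"
  using tilt_le[of x 0] by simp

lemma tilt_minus: "tilt p y (\<lambda>s. - y s) \<le> - p y"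
  using tilt_le[OF subspace_minus[OF y], of 1] sublinear_zero[OF p] by simp

lemma tilt_sublinear: "sublinear_on V (tilt p y)"
proof (rule sublinear_onI)
  fix f g assume fg: "f \<in> V" "g \<in> V"
  have two: "tilt p y (\<lambda>t. f t + g t) \<le> (p (\<lambda>s. f s + a * y s) - a * p y) + (p (\<lambda>s. g s + b * y s) - b * p y)"
    if "a \<ge> 0" "b \<ge> 0" for a b
  proof -
    have "tilt p y (\<lambda>t. f t + g t) \<le> p (\<lambda>s. (f s + g s) + (a + b) * y s) - (a + b) * p y"
      using that fg by (intro tilt_le subspace_add) auto
    also have "(\<lambda>s. (f s + g s) + (a + b) * y s) = (\<lambda>s. (f s + a * y s) + (g s + b * y s))"
      by (simp add: algebra_simps)
    also have "p (\<lambda>s. (f s + a * y s) + (g s + b * y s)) \<le> p (\<lambda>s. f s + a * y s) + p (\<lambda>s. g s + b * y s)"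
      using fg y by (intro sublinear_onD(1)[OF p] subspace_add subspace_scale)
    finally show ?thesis by (simp add: algebra_simps)
  qed
  have one: "tilt p y (\<lambda>t. f t + g t) - (p (\<lambda>s. f s + a * y s) - a * p y) \<le> tilt p y g" if "a \<ge> 0" for a
  proof (rule tilt_ge)
    fix b :: real assume "b \<ge> 0"
    then show "tilt p y (\<lambda>t. f t + g t) - (p (\<lambda>s. f s + a * y s) - a * p y) \<le> p (\<lambda>s. g s + b * y s) - b * p y"
      using two[OF that, of b] by linarith
  qed
  have "tilt p y (\<lambda>t. f t + g t) - tilt p y g \<le> tilt p y f"
  proof (rule tilt_ge)
    fix a :: real assume "a \<ge> 0"
    then show "tilt p y (\<lambda>t. f t + g t) - tilt p y g \<le> p (\<lambda>s. f s + a * y s) - a * p y"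
      using one by fastforce
  qed
  then show "tilt p y (\<lambda>t. f t + g t) \<le> tilt p y f + tilt p y g"
    by simp
next
  have pos: "tilt p y (\<lambda>t. c * f t) \<le> c * tilt p y f" if "f \<in> V" "c > 0" for f c
  proof -
    have "tilt p y (\<lambda>t. c * f t) / c \<le> tilt p y f"
    proof (rule tilt_ge)
      fix t :: real assume "t \<ge> 0"
      have "tilt p y (\<lambda>t. c * f t) \<le> p (\<lambda>s. c * f s + (c * t) * y s) - (c * t) * p y"
        using that \<open>t \<ge> 0\<close> by (intro tilt_le subspace_scale) auto
      also have "(\<lambda>s. c * f s + (c * t) * y s) = (\<lambda>s. c * (f s + t * y s))"
        by (simp add: algebra_simps)
      also have "p (\<lambda>s. c * (f s + t * y s)) = c * p (\<lambda>s. f s + t * y s)"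
        using that y by (intro sublinear_onD(2)[OF p] subspace_add subspace_scale) auto
      finally have "tilt p y (\<lambda>t. c * f t) \<le> c * (p (\<lambda>s. f s + t * y s) - t * p y)"
        by (simp add: algebra_simps)
      then show "tilt p y (\<lambda>t. c * f t) / c \<le> p (\<lambda>s. f s + t * y s) - t * p y"
        using that by (simp add: divide_simps mult.commute)
    qed
    then show ?thesis
      using that by (simp add: divide_simps mult.commute)
  qed
  fix f and c :: real assume f: "f \<in> V" "c \<ge> 0"
  show "tilt p y (\<lambda>t. c * f t) = c * tilt p y f"
  proof (cases "c = 0")
    case True
    have "0 \<le> tilt p y (\<lambda>t. 0)"
      by (rule tilt_ge) (simp add: sublinear_onD(2)[OF p y])
    moreover have "tilt p y (\<lambda>t. 0) \<le> 0"
      using tilt_le_self[OF subspace_zero] sublinear_zero[OF p] by simp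
    ultimately show ?thesis using True by simp
  next
    case False
    then have c: "c > 0" using f by simp
    have "tilt p y f \<le> (1 / c) * tilt p y (\<lambda>t. c * f t)"
      using pos[OF subspace_scale[OF f(1)], of "1 / c" c] c by simp
    then have "c * tilt p y f \<le> tilt p y (\<lambda>t. c * f t)"
      using c by (simp add: field_simps)
    then show ?thesis using pos[OF f(1) c] by simp
  qed
qed

end

text \<open>The value outside \<open>V\<close> is fixed, as otherwise a functional could be lowered
  there without end and no minimal one would exist.\<close>

definition minorants :: "(('b \<Rightarrow> real) \<Rightarrow> real) \<Rightarrow> (('b \<Rightarrow> real) \<Rightarrow> real) set" where
  "minorants p = {q. sublinear_on V q \<and> (\<forall>x\<in>V. q x \<le> p x) \<and> (\<forall>x. x \<notin> V \<longrightarrow> q x = 0)}"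

lemma minorants_restrict:
  assumes "sublinear_on V q" "\<And>x. x \<in> V \<Longrightarrow> q x \<le> p x"
  shows "(\<lambda>x. if x \<in> V then q x else 0) \<in> minorants p"
proof -
  have "sublinear_on V (\<lambda>x. if x \<in> V then q x else 0)"
    using sublinear_onD[OF assms(1)] by (intro sublinear_onI) (simp_all add: subspace_add subspace_scale)
  then show ?thesis
    using assms(2) by (simp add: minorants_def)
qed

lemma minorants_lower:
  assumes "q \<in> minorants p" "x \<in> V"
  shows "- p (\<lambda>s. - x s) \<le> q x"
proof -
  have "- q (\<lambda>s. - x s) \<le> q x"
    using assms by (intro sublinear_minus_ge) (auto simp: minorants_def)
  moreover have "q (\<lambda>s. - x s) \<le> p (\<lambda>s. - x s)"
    using assms subspace_minus by (auto simp: minorants_def)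
  ultimately show ?thesis by simp
qed

text \<open>The pointwise infimum works: \<open>minorants_lower\<close> keeps it finite, and
  subadditivity survives because two members of a chain can be replaced by the smaller one.\<close>

lemma minorants_chain:
  assumes ne: "K \<noteq> {}" and sub: "K \<subseteq> minorants p"
    and chain: "\<And>q q'. q \<in> K \<Longrightarrow> q' \<in> K \<Longrightarrow> (\<forall>x. q x \<le> q' x) \<or> (\<forall>x. q' x \<le> q x)"
  shows "\<exists>u\<in>minorants p. \<forall>q\<in>K. \<forall>x. u x \<le> q x"
proof -
  define u where "u = (\<lambda>x. INF q\<in>K. q x)"
  have out: "q x = 0" if "q \<in> K" "x \<notin> V" for q x
    using that sub by (auto simp: minorants_def)
  have low: "u x \<le> q x" if "q \<in> K" for q x
    unfolding u_def
  proof (rule cINF_lower[OF _ that])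
    show "bdd_below ((\<lambda>q. q x) ` K)"
    proof (cases "x \<in> V")
      case True
      then show ?thesis
        using minorants_lower sub by (intro bdd_belowI2[where m = "- p (\<lambda>s. - x s)"]) blast
    next
      case False
      show ?thesis
      proof (rule bdd_belowI2[where m = 0])
        fix q assume "q \<in> K"
        then show "0 \<le> q x" using out[OF _ False, of q] by simp
      qed
    qed
  qed
  have great: "b \<le> u x" if "\<And>q. q \<in> K \<Longrightarrow> b \<le> q x" for b x
    unfolding u_def by (rule cINF_greatest[OF ne]) (use that in blast)
  have sl: "sublinear_on V q" if "q \<in> K" for q
    using sub that by (auto simp: minorants_def)
  have "sublinear_on V u"
  proof (rule sublinear_onI)
    fix f g assume fg: "f \<in> V" "g \<in> V"
    have *: "u (\<lambda>t. f t + g t) \<le> q f + q' g" if q: "q \<in> K" "q' \<in> K" for q q'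
    proof -
      obtain r where r: "r \<in> K" "r f \<le> q f" "r g \<le> q' g"
        using chain[OF q] q by blast
      have "u (\<lambda>t. f t + g t) \<le> r (\<lambda>t. f t + g t)"
        using low[OF r(1)] .
      also have "\<dots> \<le> r f + r g"
        using sublinear_onD(1)[OF sl[OF r(1)] fg] .
      finally show ?thesis using r by simp
    qed
    have one: "u (\<lambda>t. f t + g t) - q f \<le> u g" if "q \<in> K" for q
      by (rule great) (use *[OF that] in fastforce)
    have "u (\<lambda>t. f t + g t) - u g \<le> u f"
      by (rule great) (use one in fastforce)
    then show "u (\<lambda>t. f t + g t) \<le> u f + u g" by simp
  next
    fix f and c :: real assume f: "f \<in> V" "c \<ge> 0"
    have eq: "q (\<lambda>t. c * f t) = c * q f" if "q \<in> K" for q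
      using sublinear_onD(2)[OF sl[OF that] f] .
    show "u (\<lambda>t. c * f t) = c * u f"
    proof (cases "c = 0")
      case True
      obtain q where "q \<in> K" using ne by blast
      have "u (\<lambda>t. c * f t) \<le> 0"
        using low[OF \<open>q \<in> K\<close>, of "\<lambda>t. c * f t"] eq[OF \<open>q \<in> K\<close>] True by simp
      moreover have "0 \<le> u (\<lambda>t. c * f t)"
      proof (rule great)
        fix q assume "q \<in> K"
        then show "0 \<le> q (\<lambda>t. c * f t)" using eq[of q] True by simp
      qed
      ultimately show ?thesis using True by simp
    next
      case False
      then have c: "c > 0" using f by simp
      have "c * u f \<le> u (\<lambda>t. c * f t)"
      proof (rule great)
        fix q assume "q \<in> K"
        then show "c * u f \<le> q (\<lambda>t. c * f t)"
          using low[of q f] eq[of q] c by (simp add: mult_left_mono)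
      qed
      moreover have "u (\<lambda>t. c * f t) / c \<le> u f"
      proof (rule great)
        fix q assume "q \<in> K"
        show "u (\<lambda>t. c * f t) / c \<le> q f"
          using low[OF \<open>q \<in> K\<close>, of "\<lambda>t. c * f t"] eq[OF \<open>q \<in> K\<close>] c
          by (simp add: divide_simps mult.commute)
      qed
      ultimately show ?thesis
        using c by (simp add: divide_simps mult.commute)
    qed
  qed
  moreover have "u x \<le> p x" if "x \<in> V" for x
  proof -
    obtain q where "q \<in> K" using ne by blast
    then show ?thesis
      using low[of q x] sub that by (force simp: minorants_def)
  qed
  moreover have "u x = 0" if "x \<notin> V" for x
  proof -
    have "u x = (INF q\<in>K. 0)"
      unfolding u_def by (intro arg_cong[where f = Inf] image_cong) (use out[OF _ that] in blast)+
    then show ?thesis using ne by simp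
  qed
  ultimately have "u \<in> minorants p"
    by (simp add: minorants_def)
  then show ?thesis using low by blast
qed

lemma minorants_minimal:
  assumes "sublinear_on V p"
  obtains m where "m \<in> minorants p" "\<And>q. q \<in> minorants p \<Longrightarrow> (\<And>x. q x \<le> m x) \<Longrightarrow> q = m"
proof -
  \<comment> \<open>The order is reversed, so that Zorn's lemma yields a minimal element.\<close>
  define P where "P = (\<lambda>(q::('b \<Rightarrow> real) \<Rightarrow> real) q'. \<forall>x. q' x \<le> q x)"
  have "\<exists>m\<in>minorants p. \<forall>q\<in>minorants p. P m q \<longrightarrow> q = m"
  proof (rule predicate_Zorn)
    show "partial_order_on (minorants p) (relation_of P (minorants p))"
      by (rule partial_order_on_relation_ofI) (auto simp: P_def fun_eq_iff intro: order_trans antisym)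
    fix K assume K: "K \<in> Chains (relation_of P (minorants p))"
    show "\<exists>u\<in>minorants p. \<forall>a\<in>K. P a u"
    proof (cases "K = {}")
      case True
      then show ?thesis
        using minorants_restrict[OF assms, of p] by auto
    next
      case False
      moreover have "K \<subseteq> minorants p"
        using K by (auto simp: Chains_def relation_of_def)
      moreover have "(\<forall>x. q x \<le> q' x) \<or> (\<forall>x. q' x \<le> q x)" if "q \<in> K" "q' \<in> K" for q q'
        using K that unfolding Chains_def relation_of_def P_def by blast
      ultimately show ?thesis
        unfolding P_def by (rule minorants_chain)
    qed
  qed
  then show thesis
    using that unfolding P_def by blast
qed

text \<open>Tilting a minimal sublinear functional \<open>m\<close> in any direction
  \<open>y\<close> gives a minorant below \<open>m\<close>, hence \<open>m\<close> again. So
  \<open>m\<close> is odd, and an odd sublinear functional is linear. Minimality is taken below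
  \<open>tilt p f\<close> instead of \<open>p\<close>, which forces the value \<open>p f\<close> at
  \<open>f\<close>.\<close>

theorem Hahn_Banach_functions:
  assumes "sublinear_on V p" "f \<in> V"
  obtains \<phi> where "\<And>x y. x \<in> V \<Longrightarrow> y \<in> V \<Longrightarrow> \<phi> (\<lambda>t. x t + y t) = \<phi> x + \<phi> y"
    "\<And>x c. x \<in> V \<Longrightarrow> \<phi> (\<lambda>t. c * x t) = c * \<phi> x"
    "\<And>x. x \<in> V \<Longrightarrow> \<phi> x \<le> p x" "\<phi> f = p f"
proof -
  obtain m where m: "m \<in> minorants (tilt p f)"
    "\<And>q. q \<in> minorants (tilt p f) \<Longrightarrow> (\<And>x. q x \<le> m x) \<Longrightarrow> q = m"
    using minorants_minimal[OF tilt_sublinear[OF assms]] by metis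
  have sl: "sublinear_on V m" and le: "\<And>x. x \<in> V \<Longrightarrow> m x \<le> tilt p f x"
    and out: "\<And>x. x \<notin> V \<Longrightarrow> m x = 0"
    using m(1) by (auto simp: minorants_def)
  have neg: "m (\<lambda>t. - y t) = - m y" if y: "y \<in> V" for y
  proof -
    define q where "q = (\<lambda>x. if x \<in> V then tilt m y x else 0)"
    have "q \<in> minorants (tilt p f)"
      unfolding q_def
      by (rule minorants_restrict[OF tilt_sublinear[OF sl y]])
        (use tilt_le_self[OF sl y] le in \<open>blast intro: order_trans\<close>)
    moreover have "q x \<le> m x" for x
      using tilt_le_self[OF sl y] out by (simp add: q_def)
    ultimately have "q = m" by (rule m(2))
    then have "m (\<lambda>t. - y t) \<le> - m y"
      using tilt_minus[OF sl y] subspace_minus[OF y] by (auto simp: q_def fun_eq_iff split: if_splits)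
    then show ?thesis
      using sublinear_minus_ge[OF sl y] by simp
  qed
  show thesis
  proof (rule that)
    fix x y assume xy: "x \<in> V" "y \<in> V"
    have "m (\<lambda>t. (x t + y t) + - y t) \<le> m (\<lambda>t. x t + y t) + m (\<lambda>t. - y t)"
      using xy by (intro sublinear_onD(1)[OF sl] subspace_add subspace_minus)
    then have "m x \<le> m (\<lambda>t. x t + y t) - m y"
      using neg[OF xy(2)] by simp
    then show "m (\<lambda>t. x t + y t) = m x + m y"
      using sublinear_onD(1)[OF sl xy] by simp
  next
    fix x and c :: real assume x: "x \<in> V"
    show "m (\<lambda>t. c * x t) = c * m x"
    proof (cases "c \<ge> 0")
      case True
      then show ?thesis using sublinear_onD(2)[OF sl x] by simp
    next
      case False
      have "m (\<lambda>t. (- c) * x t) = (- c) * m x"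
        using False by (intro sublinear_onD(2)[OF sl x]) simp
      then show ?thesis
        using neg[OF subspace_scale[OF x, of "-c"]] by simp
    qed
  next
    show "m x \<le> p x" if "x \<in> V" for x
      using le[OF that] tilt_le_self[OF assms that] by simp
    have "m (\<lambda>t. - f t) \<le> - p f"
      using le[OF subspace_minus[OF assms(2)]] tilt_minus[OF assms] by simp
    then show "m f = p f"
      using neg[OF assms(2)] le[OF assms(2)] tilt_le_self[OF assms assms(2)] by simp
  qed
qed

end

text \<open>A maximal set of conditions \<open>s \<in> U x\<close>, \<open>s \<notin> U x\<close>, no finitely many of which define a member of the
  ideal, would determine a point \<open>e\<close> of the Cantor cube violating the local hypothesis.\<close>

lemma ideal_compactness:
  fixes Q :: "'b set \<Rightarrow> bool" and U :: "'i \<Rightarrow> 'b set"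
  assumes un: "\<And>A B. Q A \<Longrightarrow> Q B \<Longrightarrow> Q (A \<union> B)"
    and mono: "\<And>A B. Q B \<Longrightarrow> A \<subseteq> B \<Longrightarrow> Q A"
    and loc: "\<And>e. e \<subseteq> I \<Longrightarrow> \<exists>E F. finite E \<and> E \<subseteq> e \<and> finite F \<and> F \<subseteq> I - e \<and>
      Q {s \<in> S. (\<forall>x\<in>E. s \<in> U x) \<and> (\<forall>x\<in>F. s \<notin> U x)}"
  shows "Q S"
proof (rule ccontr)
  assume nQ: "\<not> Q S"
  define W where "W = (\<lambda>\<sigma>. {s \<in> S. \<forall>(x, b)\<in>\<sigma>. (s \<in> U x) = b})"
  define \<A> where "\<A> = {\<sigma>. \<sigma> \<subseteq> I \<times> UNIV \<and> (\<forall>\<tau>. finite \<tau> \<longrightarrow> \<tau> \<subseteq> \<sigma> \<longrightarrow> \<not> Q (W \<tau>))}"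
  have "\<exists>M\<in>\<A>. \<forall>X\<in>\<A>. M \<subseteq> X \<longrightarrow> X = M"
  proof (rule subset_Zorn')
    fix K assume K: "subset.chain \<A> K"
    show "\<Union> K \<in> \<A>"
    proof (cases "K = {}")
      case True
      have "W {} = S" by (auto simp: W_def)
      then show ?thesis
        using nQ True by (simp add: \<A>_def)
    next
      case False
      have KA: "K \<subseteq> \<A>"
        using K by (simp add: subset_chain_def)
      have "\<not> Q (W \<tau>)" if \<tau>: "finite \<tau>" "\<tau> \<subseteq> \<Union> K" for \<tau>
      proof -
        obtain B where "B \<in> K" "\<tau> \<subseteq> B"
          using finite_subset_Union_chain[OF \<tau> False K] by blast
        then show ?thesis
          using KA \<tau>(1) by (auto simp: \<A>_def)
      qed
      moreover have "\<Union> K \<subseteq> I \<times> UNIV"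
        using KA unfolding \<A>_def by blast
      ultimately show ?thesis
        by (simp add: \<A>_def)
    qed
  qed
  then obtain M where M: "M \<in> \<A>" and max: "\<And>X. X \<in> \<A> \<Longrightarrow> M \<subseteq> X \<Longrightarrow> X = M" by blast
  have dec: "(x, True) \<in> M \<or> (x, False) \<in> M" if x: "x \<in> I" for x
  proof (rule ccontr)
    assume no: "\<not> ((x, True) \<in> M \<or> (x, False) \<in> M)"
    have "\<exists>\<tau>. finite \<tau> \<and> \<tau> \<subseteq> insert (x, b) M \<and> Q (W \<tau>)" for b
    proof (rule ccontr)
      assume "\<not> ?thesis"
      then have "insert (x, b) M \<in> \<A>"
        using M x by (auto simp: \<A>_def)
      then have "insert (x, b) M = M"
        using max by blast
      then show False
        using no by (cases b) auto
    qed
    then obtain \<tau>1 \<tau>2 where \<tau>: "finite \<tau>1" "\<tau>1 \<subseteq> insert (x, True) M" "Q (W \<tau>1)"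
      "finite \<tau>2" "\<tau>2 \<subseteq> insert (x, False) M" "Q (W \<tau>2)"
      by meson
    \<comment> \<open>Both values of \<open>x\<close> were refuted by finite sets of conditions.
      Without the conditions on \<open>x\<close> these form a finite part of \<open>M\<close>, and
      its set splits, according to membership in \<open>U x\<close>, into two members of the
      ideal.\<close>
    define \<sigma> where "\<sigma> = (\<tau>1 - {(x, True)}) \<union> (\<tau>2 - {(x, False)})"
    have "W \<sigma> \<subseteq> W \<tau>1 \<union> W \<tau>2"
    proof
      fix s assume s: "s \<in> W \<sigma>"
      show "s \<in> W \<tau>1 \<union> W \<tau>2"
        using s by (cases "s \<in> U x") (auto simp: W_def \<sigma>_def)
    qed
    then have "Q (W \<sigma>)"
      using mono[OF un[OF \<tau>(3,6)]] by blast
    moreover have "finite \<sigma>" "\<sigma> \<subseteq> M"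
      using \<tau> by (auto simp: \<sigma>_def)
    ultimately show False
      using M by (simp add: \<A>_def)
  qed
  obtain E F where EF: "finite E" "E \<subseteq> {x \<in> I. (x, True) \<in> M}" "finite F" "F \<subseteq> I - {x \<in> I. (x, True) \<in> M}"
    "Q {s \<in> S. (\<forall>x\<in>E. s \<in> U x) \<and> (\<forall>x\<in>F. s \<notin> U x)}"
    using loc[of "{x \<in> I. (x, True) \<in> M}"] by auto
  have "E \<times> {True} \<union> F \<times> {False} \<subseteq> M"
    using EF dec by auto
  moreover have "finite (E \<times> {True} \<union> F \<times> {False})"
    using EF by simp
  moreover have "W (E \<times> {True} \<union> F \<times> {False}) = {s \<in> S. (\<forall>x\<in>E. s \<in> U x) \<and> (\<forall>x\<in>F. s \<notin> U x)}"
    by (auto simp: W_def)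
  moreover have "\<not> Q (W \<tau>)" if "finite \<tau>" "\<tau> \<subseteq> M" for \<tau>
    using M that by (simp add: \<A>_def)
  ultimately show False
    using EF(5) by metis
qed

section \<open>Functionals, the weak topology and the Kadec property\<close>

lemma good_pointI:
  assumes "finite F" "F \<subseteq> tsucc T le t" "d > 0" "\<And>u. u \<in> tsucc T le t - F \<Longrightarrow> \<rho> t + d \<le> \<rho> u"
  shows "good_point T le \<rho> t"
proof -
  have "ereal (\<rho> t) < ereal (\<rho> t + d)"
    using assms(3) by simp
  also have "\<dots> \<le> (INF u \<in> tsucc T le t - F. ereal (\<rho> u))"
    by (rule INF_greatest) (use assms(4) in simp)
  finally show ?thesis
    unfolding good_point_def using assms(1,2) by blast
qed

lemma good_pointE:
  assumes "good_point T le \<rho> t"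
  obtains F d where "finite F" "F \<subseteq> tsucc T le t" "d > 0" "\<And>u. u \<in> tsucc T le t - F \<Longrightarrow> \<rho> t + d \<le> \<rho> u"
proof -
  obtain F where F: "finite F" "F \<subseteq> tsucc T le t" "ereal (\<rho> t) < (INF u \<in> tsucc T le t - F. ereal (\<rho> u))"
    using assms unfolding good_point_def by blast
  obtain r where r: "ereal (\<rho> t) < ereal r" "ereal r < (INF u \<in> tsucc T le t - F. ereal (\<rho> u))"
    using ereal_dense2[OF F(3)] by blast
  have "\<rho> t + (r - \<rho> t) \<le> \<rho> u" if "u \<in> tsucc T le t - F" for u
    using less_INF_D[OF r(2) that] by simp
  then show thesis
    using that[OF F(1,2), of "r - \<rho> t"] r(1) by simp
qed

context tree_space
begin

abbreviation "D \<equiv> dual_C0 T le"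

lemma fun_subspace_C0: "fun_subspace C"
  unfolding fun_subspace_def using C0_zero C0_add C0_scale by blast

lemma dual_add: "\<phi> \<in> D \<Longrightarrow> f \<in> C \<Longrightarrow> g \<in> C \<Longrightarrow> \<phi> (\<lambda>t. f t + g t) = \<phi> f + \<phi> g"
  and dual_scale: "\<phi> \<in> D \<Longrightarrow> f \<in> C \<Longrightarrow> \<phi> (\<lambda>t. c * f t) = c * \<phi> f"
  unfolding dual_C0_def by blast+

lemma dual_diff: "\<phi> \<in> D \<Longrightarrow> f \<in> C \<Longrightarrow> g \<in> C \<Longrightarrow> \<phi> (\<lambda>t. f t - g t) = \<phi> f - \<phi> g"
  using dual_add[OF _ _ C0_scale, of \<phi> f g "-1"] dual_scale[of \<phi> g "-1"] by simp

lemma dual_zero: "\<phi> \<in> D \<Longrightarrow> \<phi> (\<lambda>t. 0) = 0"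
  using dual_scale[OF _ C0_zero, of \<phi> 0] by simp

lemma dual_sum:
  assumes "\<phi> \<in> D" "finite A" "\<And>a. a \<in> A \<Longrightarrow> h a \<in> C"
  shows "\<phi> (\<lambda>t. \<Sum>a\<in>A. c a * h a t) = (\<Sum>a\<in>A. c a * \<phi> (h a))"
  using assms(2,3)
proof (induction A rule: finite_induct)
  case empty
  then show ?case using dual_zero[OF assms(1)] by simp
next
  case (insert x A)
  have "(\<lambda>t. \<Sum>a\<in>A. c a * h a t) \<in> C"
    using insert by (intro C0_sum C0_scale) auto
  then show ?case
    using insert dual_add[OF assms(1) C0_scale[of "h x" "c x"]] dual_scale[OF assms(1), of "h x" "c x"] by simp
qed

lemma dual_bound:
  assumes "\<phi> \<in> D"
  obtains K where "K \<ge> 0" "\<And>f. f \<in> C \<Longrightarrow> \<bar>\<phi> f\<bar> \<le> K * sn f"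
proof -
  obtain K where K: "\<And>f. f \<in> C \<Longrightarrow> \<bar>\<phi> f\<bar> \<le> K * sn f"
    using assms unfolding dual_C0_def by blast
  have "\<bar>\<phi> f\<bar> \<le> max K 0 * sn f" if "f \<in> C" for f
    using K[OF that] mult_right_mono[of K "max K 0" "sn f"] supnorm_nonneg[OF that] by simp
  then show thesis
    using that[of "max K 0"] by simp
qed

lemma dualI:
  assumes "\<And>f g. f \<in> C \<Longrightarrow> g \<in> C \<Longrightarrow> \<phi> (\<lambda>t. f t + g t) = \<phi> f + \<phi> g"
    "\<And>f c. f \<in> C \<Longrightarrow> \<phi> (\<lambda>t. c * f t) = c * \<phi> f"
    "\<And>f. f \<in> C \<Longrightarrow> \<phi> f \<le> K * sn f" "K \<ge> 0"
  shows "\<phi> \<in> D"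
proof -
  have "\<bar>\<phi> f\<bar> \<le> K * sn f" if "f \<in> C" for f
  proof -
    have "- \<phi> f \<le> K * sn (\<lambda>t. (-1) * f t)"
      using assms(2)[OF that, of "-1"] assms(3)[OF C0_scale[OF that, of "-1"]] by simp
    also have "\<dots> \<le> K * sn f"
      using supnorm_scale_le[OF that, of "-1"] assms(4) by (simp add: mult_left_mono)
    finally show ?thesis using assms(3)[OF that] by simp
  qed
  then show ?thesis
    unfolding dual_C0_def using assms(1,2) by blast
qed

lemma dual_eval: "(\<lambda>f. f z) \<in> D"
proof (rule dualI[where K = 1])
  show "f z \<le> 1 * sn f" if "f \<in> C" for f
    using supnorm_upper[OF that, of z] by simp
qed simp_all

text \<open>Disjointly supported functions span a copy of \<open>c\<^sub>0\<close>, on which functionals are summable.\<close>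

lemma dual_disjoint_sum:
  assumes "\<phi> \<in> D" "K \<ge> 0" "\<And>f. f \<in> C \<Longrightarrow> \<bar>\<phi> f\<bar> \<le> K * sn f" "finite I" "\<And>i. i \<in> I \<Longrightarrow> h i \<in> C"
    "\<And>i t. i \<in> I \<Longrightarrow> \<bar>h i t\<bar> \<le> 1"
    "\<And>i j t. i \<in> I \<Longrightarrow> j \<in> I \<Longrightarrow> h i t \<noteq> 0 \<Longrightarrow> h j t \<noteq> 0 \<Longrightarrow> i = j"
  shows "(\<Sum>i\<in>I. \<bar>\<phi> (h i)\<bar>) \<le> K"
proof -
  \<comment> \<open>The signs turn \<open>\<phi> g\<close> into the sum of absolute values, while
    disjointness of the supports keeps \<open>g\<close> bounded by 1.\<close>
  define g where "g = (\<lambda>t. \<Sum>i\<in>I. sgn (\<phi> (h i)) * h i t)"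
  have gC: "g \<in> C"
    unfolding g_def using assms(4,5) by (intro C0_sum C0_scale) auto
  have "\<bar>g t\<bar> \<le> 1" for t
  proof (cases "\<exists>i\<in>I. h i t \<noteq> 0")
    case True
    then obtain i where i: "i \<in> I" "h i t \<noteq> 0" by blast
    have z: "h j t = 0" if "j \<in> I - {i}" for j
      using assms(7)[OF i(1), of j t] i(2) that by blast
    have "g t = (\<Sum>j\<in>{i}. sgn (\<phi> (h j)) * h j t)"
      unfolding g_def by (rule sum.mono_neutral_right) (use assms(4) i z in auto)
    then have "\<bar>g t\<bar> = \<bar>sgn (\<phi> (h i))\<bar> * \<bar>h i t\<bar>"
      by (simp add: abs_mult)
    also have "\<dots> \<le> 1 * 1"
      by (rule mult_mono) (use assms(6)[OF i(1), of t] in \<open>auto simp: abs_sgn_eq\<close>)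
    finally show ?thesis by simp
  next
    case False
    then show ?thesis by (simp add: g_def)
  qed
  then have "sn g \<le> 1"
    by (intro supnorm_least) auto
  then have "K * sn g \<le> K"
    using mult_left_mono[of "sn g" 1 K] assms(2) by simp
  moreover have "\<phi> g = (\<Sum>i\<in>I. sgn (\<phi> (h i)) * \<phi> (h i))"
    unfolding g_def by (rule dual_sum[OF assms(1,4,5)])
  moreover have "sgn (\<phi> (h i)) * \<phi> (h i) = \<bar>\<phi> (h i)\<bar>" for i
    by (simp add: abs_sgn mult.commute)
  ultimately show ?thesis
    using assms(3)[OF gC] by simp
qed

text \<open>The points \<open>u\<close> are directions at the path \<open>e\<close>. For
  \<open>r\<close> beyond \<open>u\<close> the function \<open>ch r - h0\<close> is supported
  between \<open>u\<close> and \<open>r\<close>, so one choice of \<open>r\<close> per direction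
  gives disjoint supports, and \<open>dual_disjoint_sum\<close> bounds the number of directions by
  \<open>K / \<gamma>\<close>.\<close>

lemma finite_exceptional:
  assumes "\<phi> \<in> D" "h0 \<in> C" "\<And>x. h0 x = (if x \<in> e then 1 else 0)" "\<gamma> > 0"
  shows "finite {u \<in> T. tbelow T le u = e \<and> (\<exists>r\<in>T. le u r \<and> \<gamma> \<le> \<bar>\<phi> (ch r) - \<phi> h0\<bar>)}" (is "finite ?S")
proof (rule ccontr)
  assume inf: "infinite ?S"
  obtain K where K: "K \<ge> 0" "\<And>f. f \<in> C \<Longrightarrow> \<bar>\<phi> f\<bar> \<le> K * sn f"
    using dual_bound[OF assms(1)] by blast
  obtain n where n: "K < real n * \<gamma>"
    using spec[OF reals_Archimedean3[OF assms(4)], of K] by (elim exE)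
  obtain I where I: "finite I" "card I = n" "I \<subseteq> ?S"
    using infinite_arbitrarily_large[OF inf, of n] by (elim exE conjE)
  have "\<forall>u\<in>I. \<exists>r. r \<in> T \<and> le u r \<and> \<gamma> \<le> \<bar>\<phi> (ch r) - \<phi> h0\<bar>"
    using I(3) by (intro ballI) (drule (1) subsetD, simp add: Bex_def)
  then obtain r where r: "\<And>u. u \<in> I \<Longrightarrow> r u \<in> T \<and> le u (r u) \<and> \<gamma> \<le> \<bar>\<phi> (ch (r u)) - \<phi> h0\<bar>"
    by metis
  have u: "u \<in> T" "tbelow T le u = e" if "u \<in> I" for u
    using subsetD[OF I(3) that] by simp_all
  define h where "h = (\<lambda>u t. ch (r u) t - h0 t)"
  have hC: "h u \<in> C" if "u \<in> I" for u
    unfolding h_def using r[OF that] assms(2) by (intro C0_diff C0_ch) simp_all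
  have supp: "t \<in> T \<and> le u t" if "u \<in> I" "h u t \<noteq> 0" for u t
  proof -
    have uT: "u \<in> T" "r u \<in> T" "le u (r u)" using u[OF that(1)] r[OF that(1)] by simp_all
    have "t \<in> T \<and> le t (r u)" if "t \<in> e"
      using that u(2)[OF \<open>u \<in> I\<close>] uT le_trans[of t u "r u"] by (auto simp: tbelow_def)
    then have t: "t \<in> T" "le t (r u)" "t \<notin> e"
      using that(2) unfolding h_def ch_def assms(3) by (auto split: if_splits)
    then have "le t u \<or> le u t"
      using le_linear_below[of t u "r u"] uT by blast
    then show ?thesis
      using t(1,3) u(2)[OF that(1)] le_refl[OF t(1)] by (auto simp: tbelow_def)
  qed
  have "(\<Sum>u\<in>I. \<bar>\<phi> (h u)\<bar>) \<le> K"
  proof (rule dual_disjoint_sum[OF assms(1) K I(1) hC])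
    show "\<bar>h u t\<bar> \<le> 1" if "u \<in> I" for u t
      unfolding h_def ch_def assms(3) by simp
    fix i j t assume ij: "i \<in> I" "j \<in> I" "h i t \<noteq> 0" "h j t \<noteq> 0"
    have t: "t \<in> T" "le i t" "le j t"
      using supp ij by blast+
    have "le i j \<or> le j i"
      using le_linear_below[OF u(1)[OF ij(1)] u(1)[OF ij(2)] t] .
    then show "i = j"
      using u[OF ij(1)] u[OF ij(2)] by (auto simp: tbelow_def set_eq_iff)
  qed
  moreover have "real n * \<gamma> \<le> (\<Sum>u\<in>I. \<bar>\<phi> (h u)\<bar>)"
  proof -
    have "\<gamma> \<le> \<bar>\<phi> (h u)\<bar>" if "u \<in> I" for u
      unfolding h_def using dual_diff[OF assms(1) C0_ch assms(2), of "r u"] r[OF that] by simp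
    then show ?thesis
      using sum_bounded_below[of I \<gamma> "\<lambda>u. \<bar>\<phi> (h u)\<bar>"] I(2) by simp
  qed
  ultimately show False using n by simp
qed

section \<open>Weak and norm neighbourhoods, and the Kadec property at a point\<close>

lemma weak_open_subset: "openin (weak_topology_C0 T le) W \<Longrightarrow> W \<subseteq> C"
  using openin_subset[of "weak_topology_C0 T le" W]
  unfolding weak_topology_C0_def topology_generated_by_topspace by blast

lemma weak_open_nbhd:
  assumes "openin (weak_topology_C0 T le) W" "f \<in> W"
  shows "\<exists>\<Phi> \<delta>. finite \<Phi> \<and> \<Phi> \<subseteq> D \<and> \<delta> > 0 \<and> (\<forall>g\<in>C. (\<forall>\<phi>\<in>\<Phi>. \<bar>\<phi> g - \<phi> f\<bar> < \<delta>) \<longrightarrow> g \<in> W)"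
proof -
  have "generate_topology_on {{f \<in> C. \<phi> f \<in> U} | \<phi> U. \<phi> \<in> D \<and> open U} W"
    using assms(1) unfolding weak_topology_C0_def openin_topology_generated_by_iff .
  then show ?thesis
    using assms(2)
  proof (induction rule: generate_topology_on.induct)
    case Empty
    then show ?case by simp
  next
    case (Int a b)
    then obtain \<Phi> \<delta> \<Phi>' \<delta>' where *: "finite \<Phi>" "\<Phi> \<subseteq> D" "\<delta> > 0"
      "\<forall>g\<in>C. (\<forall>\<phi>\<in>\<Phi>. \<bar>\<phi> g - \<phi> f\<bar> < \<delta>) \<longrightarrow> g \<in> a"
      "finite \<Phi>'" "\<Phi>' \<subseteq> D" "\<delta>' > 0"
      "\<forall>g\<in>C. (\<forall>\<phi>\<in>\<Phi>'. \<bar>\<phi> g - \<phi> f\<bar> < \<delta>') \<longrightarrow> g \<in> b"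
      by blast
    show ?case
      by (rule exI[of _ "\<Phi> \<union> \<Phi>'"], rule exI[of _ "min \<delta> \<delta>'"]) (use * in auto)
  next
    case (UN K)
    then obtain k where k: "k \<in> K" "f \<in> k" by blast
    obtain \<Phi> \<delta> where "finite \<Phi>" "\<Phi> \<subseteq> D" "\<delta> > 0" "\<forall>g\<in>C. (\<forall>\<phi>\<in>\<Phi>. \<bar>\<phi> g - \<phi> f\<bar> < \<delta>) \<longrightarrow> g \<in> k"
      using UN.IH[OF k] by blast
    then show ?case
      using k(1) by (intro exI[of _ \<Phi>] exI[of _ \<delta>]) blast
  next
    case (Basis S)
    then obtain \<phi> U where S: "S = {f \<in> C. \<phi> f \<in> U}" "\<phi> \<in> D" "open U"
      by blast
    then obtain \<delta> where "\<delta> > 0" "\<And>y. dist y (\<phi> f) < \<delta> \<Longrightarrow> y \<in> U"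
      using Basis(2) unfolding open_dist by blast
    then show ?case
      using S by (intro exI[of _ "{\<phi>}"] exI[of _ \<delta>]) (auto simp: dist_real_def)
  qed
qed

lemma weak_open_slab: "\<phi> \<in> D \<Longrightarrow> open U \<Longrightarrow> openin (weak_topology_C0 T le) {f \<in> C. \<phi> f \<in> U}"
  unfolding weak_topology_C0_def by (intro topology_generated_by_Basis) blast

context
  fixes N
  assumes N: "equiv_norm T le N"
begin

lemma norm_add: "f \<in> C \<Longrightarrow> g \<in> C \<Longrightarrow> N (\<lambda>t. f t + g t) \<le> N f + N g"
  and norm_scale: "f \<in> C \<Longrightarrow> N (\<lambda>t. c * f t) = \<bar>c\<bar> * N f"
  using N unfolding equiv_norm_def by blast+

lemma norm_bounds:
  obtains a b where "a > 0" "b > 0" "\<And>f. f \<in> C \<Longrightarrow> a * sn f \<le> N f" "\<And>f. f \<in> C \<Longrightarrow> N f \<le> b * sn f"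
  using N unfolding equiv_norm_def by blast

lemma norm_zero: "N (\<lambda>t. 0) = 0"
  using norm_scale[OF C0_zero, of 0] by simp

lemma norm_open_iff:
  "openin (norm_topology_C0 T le N) W \<longleftrightarrow>
    W \<subseteq> C \<and> (\<forall>f\<in>W. \<exists>e>0. \<forall>g\<in>C. N (\<lambda>t. g t - f t) < e \<longrightarrow> g \<in> W)" (is "?L \<longleftrightarrow> ?R")
proof
  define ball where "ball = (\<lambda>f e. {g \<in> C. N (\<lambda>t. g t - f t) < e})"
  assume R: ?R
  have "\<exists>B. openin (norm_topology_C0 T le N) B \<and> f \<in> B \<and> B \<subseteq> W" if "f \<in> W" for f
  proof -
    obtain e where e: "e > 0" "\<forall>g\<in>C. N (\<lambda>t. g t - f t) < e \<longrightarrow> g \<in> W"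
      using R \<open>f \<in> W\<close> by blast
    have "openin (norm_topology_C0 T le N) (ball f e)"
      unfolding norm_topology_C0_def ball_def using e(1) R \<open>f \<in> W\<close> by (intro topology_generated_by_Basis) blast
    moreover have "f \<in> ball f e"
      using R \<open>f \<in> W\<close> e(1) norm_zero by (auto simp: ball_def)
    moreover have "ball f e \<subseteq> W"
      using e(2) by (auto simp: ball_def)
    ultimately show ?thesis by blast
  qed
  then show ?L
    using openin_subopen by blast
next
  assume ?L
  then have "generate_topology_on ({C} \<union> {{g \<in> C. N (\<lambda>t. g t - f t) < e} | f e. f \<in> C \<and> 0 < e}) W"
    unfolding norm_topology_C0_def openin_topology_generated_by_iff .
  then show ?R
  proof (induction rule: generate_topology_on.induct)
    case Empty
    then show ?case by simp
  next
    case (Int a b)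
    have "\<exists>e>0. \<forall>g\<in>C. N (\<lambda>t. g t - f t) < e \<longrightarrow> g \<in> a \<inter> b" if f: "f \<in> a \<inter> b" for f
    proof -
      obtain e1 e2 where *: "e1 > 0" "\<forall>g\<in>C. N (\<lambda>t. g t - f t) < e1 \<longrightarrow> g \<in> a"
        "e2 > 0" "\<forall>g\<in>C. N (\<lambda>t. g t - f t) < e2 \<longrightarrow> g \<in> b"
        using Int.IH f by blast
      show ?thesis
        by (rule exI[of _ "min e1 e2"]) (use * in auto)
    qed
    then show ?case using Int.IH by blast
  next
    case (UN K)
    show ?case
    proof (intro conjI ballI)
      show "\<Union> K \<subseteq> C" using UN by blast
      fix f assume "f \<in> \<Union> K"
      then obtain k where k: "k \<in> K" "f \<in> k" by blast
      then obtain e where "e > 0" "\<forall>g\<in>C. N (\<lambda>t. g t - f t) < e \<longrightarrow> g \<in> k"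
        using UN by blast
      then show "\<exists>e>0. \<forall>g\<in>C. N (\<lambda>t. g t - f t) < e \<longrightarrow> g \<in> \<Union> K"
        using k(1) by (intro exI[of _ e]) blast
    qed
  next
    case (Basis S)
    show ?case
    proof (cases "S = C")
      case True
      then show ?thesis by (auto intro: exI[of _ 1])
    next
      case False
      then obtain f0 e0 where S: "S = {g \<in> C. N (\<lambda>t. g t - f0 t) < e0}" "f0 \<in> C"
        using Basis by blast
      have "\<exists>e>0. \<forall>g\<in>C. N (\<lambda>t. g t - f t) < e \<longrightarrow> g \<in> S" if f: "f \<in> S" for f
      proof -
        have "N (\<lambda>t. g t - f0 t) \<le> N (\<lambda>t. g t - f t) + N (\<lambda>t. f t - f0 t)" if "g \<in> C" for g
          using norm_add[OF C0_diff[OF that, of f] C0_diff[of f f0]] f S by simp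
        then show ?thesis
          using f by (intro exI[of _ "e0 - N (\<lambda>t. f t - f0 t)"]) (fastforce simp: S(1))
      qed
      then show ?thesis using S(1) by blast
    qed
  qed
qed

lemma weak_imp_norm_open:
  assumes "openin (weak_topology_C0 T le) W"
  shows "openin (norm_topology_C0 T le N) W"
  unfolding norm_open_iff
proof (intro conjI ballI)
  show "W \<subseteq> C" using weak_open_subset[OF assms] .
  fix f assume f: "f \<in> W"
  then have fC: "f \<in> C" using weak_open_subset[OF assms] by blast
  obtain a b where a: "a > 0" "\<And>f. f \<in> C \<Longrightarrow> a * sn f \<le> N f"
    using norm_bounds by metis
  obtain \<Phi> \<delta> where \<Phi>: "finite \<Phi>" "\<Phi> \<subseteq> D" "\<delta> > 0" "\<forall>g\<in>C. (\<forall>\<phi>\<in>\<Phi>. \<bar>\<phi> g - \<phi> f\<bar> < \<delta>) \<longrightarrow> g \<in> W"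
    using weak_open_nbhd[OF assms f] by blast
  have "\<exists>e>0. \<forall>g\<in>C. N (\<lambda>t. g t - f t) < e \<longrightarrow> (\<forall>\<phi>\<in>\<Phi>. \<bar>\<phi> g - \<phi> f\<bar> < \<delta>)"
    using \<Phi>(1,2)
  proof (induction \<Phi> rule: finite_induct)
    case empty
    then show ?case by (auto intro: exI[of _ 1])
  next
    case (insert \<phi> \<Phi>)
    then obtain e where e: "e > 0" "\<forall>g\<in>C. N (\<lambda>t. g t - f t) < e \<longrightarrow> (\<forall>\<phi>\<in>\<Phi>. \<bar>\<phi> g - \<phi> f\<bar> < \<delta>)"
      by blast
    obtain K where K: "K \<ge> 0" "\<And>f. f \<in> C \<Longrightarrow> \<bar>\<phi> f\<bar> \<le> K * sn f"
      using dual_bound[of \<phi>] insert by blast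
    \<comment> \<open>The denominator is \<open>K + 1\<close> because \<open>K\<close> may be
      0.\<close>
    have "\<bar>\<phi> g - \<phi> f\<bar> < \<delta>" if g: "g \<in> C" "N (\<lambda>t. g t - f t) < \<delta> * a / (K + 1)" for g
    proof -
      have d: "(\<lambda>t. g t - f t) \<in> C" using C0_diff g(1) fC by blast
      have "\<bar>\<phi> g - \<phi> f\<bar> \<le> K * sn (\<lambda>t. g t - f t)"
        using K(2)[OF d] dual_diff[of \<phi> g f] insert g(1) fC by simp
      also have "\<dots> \<le> (K + 1) * sn (\<lambda>t. g t - f t)"
        using supnorm_nonneg[OF d] by (simp add: algebra_simps)
      also have "\<dots> \<le> (K + 1) * (N (\<lambda>t. g t - f t) / a)"
        using a(2)[OF d] a(1) K(1) by (intro mult_left_mono) (simp_all add: field_simps)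
      also have "\<dots> < (K + 1) * (\<delta> / (K + 1))"
        using g(2) a(1) K(1) by (intro mult_strict_left_mono) (simp_all add: field_simps)
      finally show ?thesis using K(1) by simp
    qed
    moreover have "\<delta> * a / (K + 1) > 0"
      using \<Phi>(3) a K by simp
    ultimately show ?case
      using e by (intro exI[of _ "min e (\<delta> * a / (K + 1))"]) simp
  qed
  then show "\<exists>e>0. \<forall>g\<in>C. N (\<lambda>t. g t - f t) < e \<longrightarrow> g \<in> W"
    using \<Phi>(4) by blast
qed

text \<open>The weak topology is always coarser, so only norm balls have to be caught by weak
  neighbourhoods, one point of the sphere at a time.\<close>

lemma kadec_iff:
  "kadec T le N \<longleftrightarrow> (\<forall>f\<in>C. N f = 1 \<longrightarrow> (\<forall>e>0. \<exists>W. openin (weak_topology_C0 T le) W \<and> f \<in> W \<and>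
     (\<forall>g\<in>W. N g = 1 \<longrightarrow> N (\<lambda>t. g t - f t) < e)))" (is "?L \<longleftrightarrow> ?R")
proof
  define S where "S = {f \<in> C. N f = 1}"
  {
    assume ?L
    then have eq: "subtopology (weak_topology_C0 T le) S = subtopology (norm_topology_C0 T le N) S"
      by (simp add: kadec_def S_def Let_def)
    show ?R
    proof (intro ballI impI allI)
      fix f and e :: real assume f: "f \<in> C" "N f = 1" "e > 0"
      define B where "B = {g \<in> C. N (\<lambda>t. g t - f t) < e}"
      have "openin (norm_topology_C0 T le N) B"
        unfolding norm_topology_C0_def B_def using f by (intro topology_generated_by_Basis) blast
      then have "openin (subtopology (weak_topology_C0 T le) S) (B \<inter> S)"
        unfolding eq openin_subtopology by blast
      then obtain W where W: "openin (weak_topology_C0 T le) W" "B \<inter> S = W \<inter> S"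
        unfolding openin_subtopology by blast
      have "f \<in> B \<inter> S"
        using f norm_zero by (simp add: B_def S_def)
      then have "f \<in> W" using W(2) by blast
      moreover have "N (\<lambda>t. g t - f t) < e" if "g \<in> W" "N g = 1" for g
      proof -
        have "g \<in> W \<inter> S"
          using that weak_open_subset[OF W(1)] by (auto simp: S_def)
        then show ?thesis using W(2) by (auto simp: B_def)
      qed
      ultimately show "\<exists>W. openin (weak_topology_C0 T le) W \<and> f \<in> W \<and> (\<forall>g\<in>W. N g = 1 \<longrightarrow> N (\<lambda>t. g t - f t) < e)"
        using W(1) by blast
    qed
  next
    assume R: ?R
    have "openin (subtopology (weak_topology_C0 T le) S) X" if X: "openin (subtopology (norm_topology_C0 T le N) S) X" for X
    proof -
      obtain V where V: "openin (norm_topology_C0 T le N) V" "X = V \<inter> S"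
        using X unfolding openin_subtopology by blast
      have "\<exists>Y. openin (subtopology (weak_topology_C0 T le) S) Y \<and> f \<in> Y \<and> Y \<subseteq> X" if f: "f \<in> X" for f
      proof -
        have fS: "f \<in> C" "N f = 1" "f \<in> V" using f V(2) by (auto simp: S_def)
        obtain e where e: "e > 0" "\<forall>g\<in>C. N (\<lambda>t. g t - f t) < e \<longrightarrow> g \<in> V"
          using V(1) fS(3) unfolding norm_open_iff by blast
        obtain W where W: "openin (weak_topology_C0 T le) W" "f \<in> W"
          "\<forall>g\<in>W. N g = 1 \<longrightarrow> N (\<lambda>t. g t - f t) < e"
          using R fS(1,2) e(1) by blast
        have "W \<inter> S \<subseteq> X"
          using W(3) e(2) V(2) by (auto simp: S_def)
        moreover have "openin (subtopology (weak_topology_C0 T le) S) (W \<inter> S)"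
          using W(1) unfolding openin_subtopology by blast
        ultimately show ?thesis
          using W(2) fS by (intro exI[of _ "W \<inter> S"]) (simp add: S_def)
      qed
      then show ?thesis
        using openin_subopen by blast
    qed
    moreover have "openin (subtopology (norm_topology_C0 T le N) S) X" if "openin (subtopology (weak_topology_C0 T le) S) X" for X
      using that weak_imp_norm_open unfolding openin_subtopology by blast
    ultimately have "subtopology (weak_topology_C0 T le) S = subtopology (norm_topology_C0 T le N) S"
      unfolding topology_eq by blast
    then show ?L
      by (simp add: kadec_def S_def Let_def)
  }
qed

end

section \<open>From a Kadec norm to an increasing function\<close>

text \<open>If \<open>N (ch r)\<close> is close to \<open>N (ch t)\<close> for a non-exceptional
  \<open>r\<close>, the normalised indicators are weakly close points of the sphere. But at
  \<open>u\<close> one of them is 0 and the other at least \<open>1 / b\<close>, so their distance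
  in \<open>N\<close> is at least \<open>a / b\<close>. The Kadec property at the normalised
  \<open>ch t\<close> with radius \<open>a / b\<close> excludes this.\<close>

lemma kadec_branch_gap:
  assumes N: "equiv_norm T le N" and K: "kadec T le N" and t: "t \<in> T"
  shows "\<exists>F d. finite F \<and> F \<subseteq> tsucc T le t \<and> d > 0 \<and>
    (\<forall>u \<in> tsucc T le t - F. \<forall>r\<in>T. le u r \<longrightarrow> d \<le> \<bar>N (ch r) - N (ch t)\<bar>)"
proof -
  obtain a b where ab: "a > 0" "b > 0" "\<And>f. f \<in> C \<Longrightarrow> a * sn f \<le> N f" "\<And>f. f \<in> C \<Longrightarrow> N f \<le> b * sn f"
    using norm_bounds[OF N] by metis
  have Nch: "a \<le> N (ch r)" "N (ch r) \<le> b" if "r \<in> T" for r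
    using ab(3,4)[OF C0_ch[OF that]] supnorm_ch[OF that] by simp_all
  define \<alpha> where "\<alpha> = N (ch t)"
  have \<alpha>: "a \<le> \<alpha>" using Nch[OF t] by (simp add: \<alpha>_def)
  define f where "f = (\<lambda>x. (1/\<alpha>) * ch t x)"
  have fC: "f \<in> C" unfolding f_def using C0_scale[OF C0_ch[OF t]] .
  have Nf: "N f = 1"
    unfolding f_def using norm_scale[OF N C0_ch[OF t], of "1/\<alpha>"] \<alpha> ab(1) by (simp add: \<alpha>_def)
  obtain W where W: "openin (weak_topology_C0 T le) W" "f \<in> W"
    "\<And>g. g \<in> W \<Longrightarrow> N g = 1 \<Longrightarrow> N (\<lambda>x. g x - f x) < a / b"
    using K[unfolded kadec_iff[OF N]] fC Nf ab(1,2) by (metis divide_pos_pos)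
  obtain \<Phi> \<delta> where \<Phi>: "finite \<Phi>" "\<Phi> \<subseteq> D" "\<delta> > 0" "\<And>g. g \<in> C \<Longrightarrow> (\<forall>\<phi>\<in>\<Phi>. \<bar>\<phi> g - \<phi> f\<bar> < \<delta>) \<Longrightarrow> g \<in> W"
    using weak_open_nbhd[OF W(1,2)] by blast
  define M where "M = (\<Sum>\<phi>\<in>\<Phi>. \<bar>\<phi> (ch t)\<bar>)"
  have M: "\<bar>\<phi> (ch t)\<bar> \<le> M" if "\<phi> \<in> \<Phi>" for \<phi>
    unfolding M_def using member_le_sum[OF that, of "\<lambda>\<phi>. \<bar>\<phi> (ch t)\<bar>"] \<Phi>(1) by simp
  have M0: "M \<ge> 0" by (simp add: M_def sum_nonneg)
  \<comment> \<open>Chosen so that the change of \<phi> and the change of the normalising factor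
    each contribute at most \<open>\<delta> / 3\<close> to the difference of the values of
    \<phi>.\<close>
  define \<gamma> where "\<gamma> = \<delta> * a / 3"
  define d where "d = \<delta> * a * a / (3 * (M + 1))"
  have pos: "\<gamma> > 0" "d > 0"
    using \<Phi>(3) ab(1) M0 by (simp_all add: \<gamma>_def d_def)
  define X where "X = (\<lambda>\<phi>. {u \<in> T. tbelow T le u = tdown T le t \<and> (\<exists>r\<in>T. le u r \<and> \<gamma> \<le> \<bar>\<phi> (ch r) - \<phi> (ch t)\<bar>)})"
  have "finite (X \<phi>)" if "\<phi> \<in> \<Phi>" for \<phi>
    unfolding X_def using that \<Phi>(2) pos(1)
    by (intro finite_exceptional C0_ch[OF t]) (auto simp: ch_def tdown_def)
  define F where "F = (\<Union>\<phi>\<in>\<Phi>. X \<phi>)"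
  have "finite F"
    unfolding F_def using \<Phi>(1) \<open>\<And>\<phi>. \<phi> \<in> \<Phi> \<Longrightarrow> finite (X \<phi>)\<close> by blast
  moreover have "F \<subseteq> tsucc T le t"
    by (auto simp: F_def X_def tsucc_def)
  moreover have "d \<le> \<bar>N (ch r) - N (ch t)\<bar>"
    if u: "u \<in> tsucc T le t - F" and r: "r \<in> T" "le u r" for u r
  proof (rule ccontr)
    define \<beta> where "\<beta> = N (ch r)"
    assume "\<not> ?thesis"
    then have close: "\<bar>\<alpha> - \<beta>\<bar> < d" by (simp add: \<alpha>_def \<beta>_def abs_minus_commute)
    have \<beta>: "a \<le> \<beta>" "\<beta> \<le> b" using Nch[OF r(1)] by (simp_all add: \<beta>_def)
    define g where "g = (\<lambda>x. (1/\<beta>) * ch r x)"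
    have gC: "g \<in> C" unfolding g_def using C0_scale[OF C0_ch[OF r(1)]] .
    have Ng: "N g = 1"
      unfolding g_def using norm_scale[OF N C0_ch[OF r(1)], of "1/\<beta>"] \<beta> ab(1) by (simp add: \<beta>_def)
    have "\<bar>\<phi> g - \<phi> f\<bar> < \<delta>" if \<phi>: "\<phi> \<in> \<Phi>" for \<phi>
    proof -
      have \<phi>D: "\<phi> \<in> D" using \<phi> \<Phi>(2) by blast
      define x y where "x = \<phi> (ch r)" and "y = \<phi> (ch t)"
      have xy: "\<bar>x - y\<bar> < \<gamma>"
        using u r \<phi> by (force simp: F_def X_def x_def y_def tsucc_def)
      have y: "\<bar>y\<bar> \<le> M" using M[OF \<phi>] by (simp add: y_def)
      have "\<phi> g - \<phi> f = (x - y) / \<beta> + y * ((\<alpha> - \<beta>) / (\<alpha> * \<beta>))"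
        unfolding f_def g_def dual_scale[OF \<phi>D C0_ch[OF t]] dual_scale[OF \<phi>D C0_ch[OF r(1)]]
        using \<alpha> \<beta> ab(1) by (simp add: x_def y_def field_simps)
      also have "\<bar>\<dots>\<bar> \<le> \<bar>x - y\<bar> / \<beta> + \<bar>y\<bar> * (\<bar>\<alpha> - \<beta>\<bar> / (\<alpha> * \<beta>))"
        using \<alpha> \<beta> ab(1) by (intro order_trans[OF abs_triangle_ineq]) (simp add: abs_mult)
      also have "\<dots> \<le> \<gamma> / a + (M + 1) * (d / (a * a))"
        using \<alpha> \<beta> ab(1) xy y close M0 pos
        by (intro add_mono mult_mono frac_le mult_pos_pos mult_mono) auto
      also have "\<dots> = 2 / 3 * \<delta>"
      proof -
        have "d / (a * a) = \<delta> / (3 * (M + 1))"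
          using ab(1) by (simp add: d_def)
        moreover have "(M + 1) * (\<delta> / (3 * (M + 1))) = \<delta> / 3"
          using M0 by (simp add: divide_simps)
        ultimately show ?thesis
          using ab(1) by (simp add: \<gamma>_def)
      qed
      also have "\<dots> < \<delta>" using \<Phi>(3) by simp
      finally show ?thesis .
    qed
    then have "N (\<lambda>x. g x - f x) < a / b"
      using W(3)[OF \<Phi>(4)[OF gC] Ng] by blast
    moreover have "a * \<bar>g u - f u\<bar> \<le> N (\<lambda>x. g x - f x)"
    proof -
      have "a * \<bar>g u - f u\<bar> \<le> a * sn (\<lambda>x. g x - f x)"
        using supnorm_upper[OF C0_diff[OF gC fC], of u] ab(1) by (intro mult_left_mono) auto
      also have "\<dots> \<le> N (\<lambda>x. g x - f x)" by (rule ab(3)[OF C0_diff[OF gC fC]])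
      finally show ?thesis .
    qed
    moreover have "g u - f u = 1 / \<beta>"
    proof -
      have "u \<in> T" "u \<notin> tdown T le t" using u by (auto simp: tsucc_def tbelow_def)
      then show ?thesis using r by (simp add: f_def g_def ch_def tdown_def)
    qed
    moreover have "a / b \<le> a * (1 / \<beta>)"
      using \<beta> ab(1,2) by (simp add: frac_le)
    ultimately show False using \<beta> ab(1) by simp
  qed
  ultimately show ?thesis
    using pos(2) by (intro exI[of _ F] exI[of _ d]) simp
qed

text \<open>If every point of \<open>S\<close> sees \<open>S\<close> in only finitely many directions, then the indicator of having left
  \<open>S\<close> for good is increasing and jumps at every point of \<open>S\<close>. The tree is a countable union of such sets.\<close>

lemma kadec_imp_increasing:
  assumes N: "equiv_norm T le N" and K: "kadec T le N"
  shows "\<exists>\<rho>. increasing_on_tree T le \<rho> \<and> (\<forall>t\<in>T. good_point T le \<rho> t)"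
proof -
  define gap where "gap = (\<lambda>t d. \<exists>F. finite F \<and> F \<subseteq> tsucc T le t \<and>
    (\<forall>u \<in> tsucc T le t - F. \<forall>r\<in>T. le u r \<longrightarrow> d \<le> \<bar>N (ch r) - N (ch t)\<bar>))"
  \<comment> \<open>The index runs through all pairs of a rational centre \<open>q\<close> and a gap
    size. Values of \<open>N (ch t)\<close> on one \<open>S i\<close> differ by less than
    \<open>1 / Suc k\<close>, which is the gap required of its points.\<close>
  define S where "S = (\<lambda>i. case from_nat i of (q::rat, k::nat) \<Rightarrow>
    {t \<in> T. gap t (1 / real (Suc k)) \<and> \<bar>N (ch t) - of_rat q\<bar> < 1 / (2 * real (Suc k))})"
  define P where "P = (\<lambda>i u. (\<exists>s\<in>S i. le s u \<and> s \<noteq> u) \<and> \<not> (\<exists>s\<in>S i. le u s))"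
  define \<rho> where "\<rho> = (\<lambda>u. \<Sum>i. (1/2::real)^i * of_bool (P i u))"
  have ST: "S i \<subseteq> T" for i
    unfolding S_def by (auto split: prod.split)
  have summ: "summable (\<lambda>i. (1/2::real)^i * of_bool (P i u))" for u
    by (rule summable_comparison_test'[OF summable_geometric[of "1/2::real"], of 0]) auto
  have P_mono: "P i t" if "s \<in> T" "t \<in> T" "le s t" "P i s" for i s t
  proof -
    obtain s' where s': "s' \<in> S i" "le s' s" "s' \<noteq> s" and no: "\<And>x. x \<in> S i \<Longrightarrow> \<not> le s x"
      using \<open>P i s\<close> by (auto simp: P_def)
    have s'T: "s' \<in> T" using s'(1) ST by blast
    have "le s' t" using le_trans[OF s'T that(1,2) s'(2) that(3)] .
    moreover have "s' \<noteq> t" using no[OF s'(1)] that(3) by blast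
    moreover have "\<not> le t x" if x: "x \<in> S i" for x
      using no[OF x] le_trans[OF \<open>s \<in> T\<close> \<open>t \<in> T\<close> _ \<open>le s t\<close>, of x] x ST by blast
    ultimately show ?thesis
      using s'(1) by (auto simp: P_def)
  qed
  have \<rho>_mono: "\<rho> s \<le> \<rho> t" if "s \<in> T" "t \<in> T" "le s t" for s t
    unfolding \<rho>_def using P_mono[OF that] by (intro suminf_le summ) simp
  have good: "good_point T le \<rho> t" if t: "t \<in> T" for t
  proof -
    obtain F0 d where d: "finite F0" "F0 \<subseteq> tsucc T le t" "d > 0"
      "\<forall>u \<in> tsucc T le t - F0. \<forall>r\<in>T. le u r \<longrightarrow> d \<le> \<bar>N (ch r) - N (ch t)\<bar>"
      using kadec_branch_gap[OF N K t] by metis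
    obtain k where k: "1 / real (Suc k) < d"
      using nat_approx_posE[OF d(3)] by blast
    obtain q where q: "N (ch t) < of_rat q" "of_rat q < N (ch t) + 1 / (2 * real (Suc k))"
      using of_rat_dense[of "N (ch t)" "N (ch t) + 1 / (2 * real (Suc k))"] by auto
    obtain i where i: "from_nat i = (q, k)"
      by (metis from_nat_to_nat)
    have Si: "S i = {t \<in> T. gap t (1 / real (Suc k)) \<and> \<bar>N (ch t) - of_rat q\<bar> < 1 / (2 * real (Suc k))}"
      by (simp add: S_def i)
    have "gap t (1 / real (Suc k))"
      unfolding gap_def using d k by (intro exI[of _ F0]) fastforce
    then have tS: "t \<in> S i"
      unfolding Si using t q by simp
    then obtain F where F: "finite F" "F \<subseteq> tsucc T le t"
      "\<And>u r. u \<in> tsucc T le t - F \<Longrightarrow> r \<in> T \<Longrightarrow> le u r \<Longrightarrow> 1 / real (Suc k) \<le> \<bar>N (ch r) - N (ch t)\<bar>"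
      unfolding Si gap_def by blast
    show ?thesis
    proof (rule good_pointI[OF F(1,2)])
      show "(1/2::real)^i > 0" by simp
      fix u assume u: "u \<in> tsucc T le t - F"
      have uT: "u \<in> T" and tu: "le t u" "t \<noteq> u"
        using u t le_refl[OF t] by (auto simp: tsucc_def tbelow_def tdown_def set_eq_iff)
      have "\<not> le u s" if s: "s \<in> S i" for s
      proof
        assume "le u s"
        then have far: "1 / real (Suc k) \<le> \<bar>N (ch s) - N (ch t)\<bar>"
          using F(3)[OF u] s ST by blast
        define h where "h = 1 / (2 * real (Suc k))"
        have "1 / real (Suc k) = 2 * h"
          by (simp add: h_def del: of_nat_Suc)
        then have "2 * h \<le> \<bar>N (ch s) - N (ch t)\<bar>"
          using far by (simp only:)
        moreover have "\<bar>N (ch s) - of_rat q\<bar> < h" "\<bar>N (ch t) - of_rat q\<bar> < h"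
          using s tS unfolding Si h_def by simp_all
        ultimately show False by linarith
      qed
      then have Pu: "P i u"
        using tS tu by (auto simp: P_def)
      have nPt: "\<not> P i t"
        using tS le_refl[OF t] by (auto simp: P_def)
      \<comment> \<open>The terms of the difference of the two series are nonnegative, so the
        \<open>i\<close>-th one alone bounds the jump from below.\<close>
      define D where "D = (\<lambda>j. (1/2::real)^j * of_bool (P j u) - (1/2)^j * of_bool (P j t))"
      have "(\<Sum>j\<in>{i}. D j) \<le> suminf D"
        unfolding D_def using P_mono[OF t uT tu(1)]
        by (intro sum_le_suminf summable_diff summ) auto
      also have "suminf D = \<rho> u - \<rho> t"
        unfolding D_def \<rho>_def by (rule suminf_diff[symmetric, OF summ summ])
      finally show "\<rho> t + (1/2)^i \<le> \<rho> u"
        using Pu nPt by (simp add: D_def)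
    qed
  qed
  show ?thesis
    using \<rho>_mono good unfolding increasing_on_tree_def by blast
qed

end

section \<open>The norm of a weighted tree\<close>

locale weighted_tree = tree_space +
  fixes w :: "'a \<Rightarrow> real"
  assumes weight_ge_1: "t \<in> T \<Longrightarrow> 1 \<le> w t"
    and weight_mono: "s \<in> T \<Longrightarrow> t \<in> T \<Longrightarrow> le s t \<Longrightarrow> w s \<le> w t"
    and weight_good: "t \<in> T \<Longrightarrow> good_point T le w t"
begin

definition cost :: "'a set \<Rightarrow> ('a \<Rightarrow> real) \<Rightarrow> real" where
  "cost A c = (\<Sum>a\<in>A. w a * \<bar>c a\<bar>)"

text \<open>This is the K-functional of interpolation theory for the supremum norm and the weighted
  l1 norm of the coefficients. For small \<open>l\<close> elaborate combinations become
  cheap.\<close>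

definition kfun :: "real \<Rightarrow> ('a \<Rightarrow> real) \<Rightarrow> real" where
  "kfun l f = Inf {l * cost A c + sn (\<lambda>t. f t - comb A c t) | A c. finite A \<and> A \<subseteq> T}"

lemma cost_nonneg: "A \<subseteq> T \<Longrightarrow> 0 \<le> cost A c"
  unfolding cost_def using weight_ge_1 by (intro sum_nonneg mult_nonneg_nonneg) force+

lemma abs_comb_le_cost:
  assumes "A \<subseteq> T"
  shows "\<bar>comb A c x\<bar> \<le> cost A c"
  unfolding comb_def cost_def
proof (rule order_trans[OF sum_abs sum_mono])
  fix a assume "a \<in> A"
  then have "1 \<le> w a" using weight_ge_1 assms by blast
  then show "\<bar>c a * ch a x\<bar> \<le> w a * \<bar>c a\<bar>"
    using mult_right_mono[of 1 "w a" "\<bar>c a\<bar>"] by (simp add: ch_def abs_mult)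
qed

context
  fixes l :: real
  assumes l: "l > 0"
begin

lemma kfun_term_nonneg:
  assumes "f \<in> C" "finite A" "A \<subseteq> T"
  shows "0 \<le> l * cost A c + sn (\<lambda>t. f t - comb A c t)"
  using cost_nonneg[OF assms(3)] supnorm_nonneg[OF C0_diff[OF assms(1) C0_comb[OF assms(2,3)]]] l
  by (intro add_nonneg_nonneg mult_nonneg_nonneg) simp_all

lemma kfun_le:
  assumes "f \<in> C" "finite A" "A \<subseteq> T"
  shows "kfun l f \<le> l * cost A c + sn (\<lambda>t. f t - comb A c t)"
  unfolding kfun_def
proof (rule cInf_lower)
  show "bdd_below {l * cost A c + sn (\<lambda>t. f t - comb A c t) | A c. finite A \<and> A \<subseteq> T}"
    using kfun_term_nonneg[OF assms(1)] by (intro bdd_belowI[of _ 0]) blast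
qed (use assms in blast)

lemma kfun_ge:
  assumes "\<And>A c. finite A \<Longrightarrow> A \<subseteq> T \<Longrightarrow> b \<le> l * cost A c + sn (\<lambda>t. f t - comb A c t)"
  shows "b \<le> kfun l f"
  unfolding kfun_def by (rule cInf_greatest) (use assms in blast)+

lemma kfun_lessE:
  assumes "kfun l f < b"
  obtains A c where "finite A" "A \<subseteq> T" "l * cost A c + sn (\<lambda>t. f t - comb A c t) < b"
  using kfun_ge[of b f] assms by (meson not_le)

lemma kfun_nonneg: "f \<in> C \<Longrightarrow> 0 \<le> kfun l f"
  by (rule kfun_ge) (rule kfun_term_nonneg)

lemma kfun_le_supnorm: "f \<in> C \<Longrightarrow> kfun l f \<le> sn f"
  using kfun_le[of f "{}" "\<lambda>_. 0"] by (simp add: cost_def comb_def)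

text \<open>The indicator is its own combination, without remainder. Every functional below
  \<open>kfun l\<close> inherits the bound, which is where the weight meets duality.\<close>

lemma kfun_ch: "t \<in> T \<Longrightarrow> kfun l (ch t) \<le> l * w t"
  using kfun_le[OF C0_ch[of t], of "{t}" "\<lambda>_. 1"] supnorm_least[of 0 "\<lambda>_. 0"]
  by (simp add: cost_def comb_sing)

lemma kfun_add:
  assumes "f \<in> C" "g \<in> C"
  shows "kfun l (\<lambda>t. f t + g t) \<le> kfun l f + kfun l g"
proof -
  have two: "kfun l (\<lambda>t. f t + g t) \<le> (l * cost A c + sn (\<lambda>t. f t - comb A c t)) + (l * cost B d + sn (\<lambda>t. g t - comb B d t))"
    if A: "finite A" "A \<subseteq> T" and B: "finite B" "B \<subseteq> T" for A c B d
  proof -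
    define e where "e = (\<lambda>a. (if a \<in> A then c a else 0) + (if a \<in> B then d a else 0))"
    have "cost (A \<union> B) e \<le> (\<Sum>a\<in>A \<union> B. (if a \<in> A then w a * \<bar>c a\<bar> else 0) + (if a \<in> B then w a * \<bar>d a\<bar> else 0))"
      unfolding cost_def
    proof (rule sum_mono)
      fix a assume "a \<in> A \<union> B"
      then have "0 \<le> w a" using weight_ge_1[of a] A B by force
      then have "w a * \<bar>e a\<bar> \<le> w a * (\<bar>if a \<in> A then c a else 0\<bar> + \<bar>if a \<in> B then d a else 0\<bar>)"
        unfolding e_def by (intro mult_left_mono abs_triangle_ineq)
      then show "w a * \<bar>e a\<bar> \<le> (if a \<in> A then w a * \<bar>c a\<bar> else 0) + (if a \<in> B then w a * \<bar>d a\<bar> else 0)"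
        by (auto simp: distrib_left split: if_splits)
    qed
    also have "\<dots> = cost A c + cost B d"
      unfolding cost_def sum.distrib using A(1) B(1)
      by (intro arg_cong2[where f = "(+)"] sum.mono_neutral_cong_right) auto
    finally have c: "l * cost (A \<union> B) e \<le> l * cost A c + l * cost B d"
      using l by (simp add: distrib_left[symmetric])
    have "kfun l (\<lambda>t. f t + g t) \<le> l * cost (A \<union> B) e + sn (\<lambda>t. (f t + g t) - comb (A \<union> B) e t)"
      using A B by (intro kfun_le C0_add assms) auto
    also have "(\<lambda>t. (f t + g t) - comb (A \<union> B) e t) = (\<lambda>t. (f t - comb A c t) + (g t - comb B d t))"
    proof
      fix t
      have "comb (A \<union> B) e t = comb A c t + comb B d t"
        using fun_cong[OF comb_add[OF A(1) B(1), of c d], of t] by (simp add: e_def)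
      then show "(f t + g t) - comb (A \<union> B) e t = (f t - comb A c t) + (g t - comb B d t)"
        by simp
    qed
    also have "sn (\<lambda>t. (f t - comb A c t) + (g t - comb B d t)) \<le> sn (\<lambda>t. f t - comb A c t) + sn (\<lambda>t. g t - comb B d t)"
      using A B by (intro supnorm_add C0_diff C0_comb assms)
    finally show ?thesis using c by linarith
  qed
  have one: "kfun l (\<lambda>t. f t + g t) - (l * cost A c + sn (\<lambda>t. f t - comb A c t)) \<le> kfun l g"
    if A: "finite A" "A \<subseteq> T" for A c
    by (rule kfun_ge) (use two[OF A] in \<open>fastforce simp: algebra_simps\<close>)
  have "kfun l (\<lambda>t. f t + g t) - kfun l g \<le> kfun l f"
  proof (rule kfun_ge)
    fix A c assume "finite A" "A \<subseteq> T"
    from one[OF this, of c]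
    show "kfun l (\<lambda>t. f t + g t) - kfun l g \<le> l * cost A c + sn (\<lambda>t. f t - comb A c t)" by simp
  qed
  then show ?thesis by simp
qed

lemma kfun_scale_le:
  assumes "f \<in> C" "k \<noteq> 0"
  shows "kfun l (\<lambda>t. k * f t) \<le> \<bar>k\<bar> * kfun l f"
proof -
  have "kfun l (\<lambda>t. k * f t) / \<bar>k\<bar> \<le> kfun l f"
  proof (rule kfun_ge)
    fix A c assume A: "finite A" "A \<subseteq> T"
    have "kfun l (\<lambda>t. k * f t) \<le> l * cost A (\<lambda>a. k * c a) + sn (\<lambda>t. k * f t - comb A (\<lambda>a. k * c a) t)"
      using A by (intro kfun_le C0_scale assms)
    also have "cost A (\<lambda>a. k * c a) = \<bar>k\<bar> * cost A c"
      by (simp add: cost_def abs_mult sum_distrib_left mult.left_commute)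
    also have "(\<lambda>t. k * f t - comb A (\<lambda>a. k * c a) t) = (\<lambda>t. k * (f t - comb A c t))"
      using comb_scale[of k A c] by (simp add: fun_eq_iff right_diff_distrib)
    also have "sn (\<lambda>t. k * (f t - comb A c t)) \<le> \<bar>k\<bar> * sn (\<lambda>t. f t - comb A c t)"
      using A by (intro supnorm_scale_le C0_diff C0_comb assms)
    finally have "kfun l (\<lambda>t. k * f t) \<le> \<bar>k\<bar> * (l * cost A c + sn (\<lambda>t. f t - comb A c t))"
      by (simp add: algebra_simps)
    then show "kfun l (\<lambda>t. k * f t) / \<bar>k\<bar> \<le> l * cost A c + sn (\<lambda>t. f t - comb A c t)"
      using assms(2) by (simp add: divide_simps mult.commute)
  qed
  then show ?thesis
    using assms(2) by (simp add: divide_simps mult.commute)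
qed

lemma kfun_zero: "kfun l (\<lambda>t. 0) = 0"
  using kfun_le_supnorm[OF C0_zero] kfun_nonneg[OF C0_zero] supnorm_least[of 0 "\<lambda>_. 0"] by simp

lemma kfun_scale:
  assumes "f \<in> C"
  shows "kfun l (\<lambda>t. k * f t) = \<bar>k\<bar> * kfun l f"
proof (cases "k = 0")
  case True
  then show ?thesis by (simp add: kfun_zero)
next
  case False
  have "kfun l f \<le> \<bar>1/k\<bar> * kfun l (\<lambda>t. k * f t)"
    using kfun_scale_le[OF C0_scale[OF assms], of "1/k" k] False by simp
  then have "\<bar>k\<bar> * kfun l f \<le> kfun l (\<lambda>t. k * f t)"
    using False by (simp add: field_simps)
  then show ?thesis
    using kfun_scale_le[OF assms False] by simp
qed

lemma kfun_sublinear: "sublinear_on C (kfun l)"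
  by (rule sublinear_onI) (simp_all add: kfun_add kfun_scale)

end

text \<open>Weights at least 1 make the cost dominate the supremum norm of the combination. The
  scale 1 thus gives the supremum norm back, which makes the sum of all scales an equivalent
  norm.\<close>

lemma kfun_one: "f \<in> C \<Longrightarrow> sn f \<le> kfun 1 f"
proof (rule kfun_ge)
  fix A c assume A: "finite A" "A \<subseteq> T" and f: "f \<in> C"
  have d: "(\<lambda>t. f t - comb A c t) \<in> C"
    using A f by (intro C0_diff C0_comb)
  have "\<bar>f t\<bar> \<le> cost A c + sn (\<lambda>t. f t - comb A c t)" for t
    using abs_comb_le_cost[OF A(2), of c t] supnorm_upper[OF d, of t] by linarith
  then show "sn f \<le> 1 * cost A c + sn (\<lambda>t. f t - comb A c t)"
    using cost_nonneg[OF A(2)] supnorm_nonneg[OF d] by (intro supnorm_least) auto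
qed simp

text \<open>By density some combination is within \<open>\<epsilon> / 2\<close> of \<open>f\<close>;
  its cost is a fixed number, so it is negligible at a small enough scale.\<close>

lemma kfun_small:
  assumes "f \<in> C" "\<epsilon> > 0"
  obtains k where "kfun ((1/2)^k) f < \<epsilon>"
proof -
  obtain A c where A: "finite A" "A \<subseteq> T" "\<And>x. \<bar>f x - comb A c x\<bar> \<le> \<epsilon>/2"
    using combs_dense[OF assms(1), of "\<epsilon>/2"] assms(2) by auto
  have "(\<lambda>k. (1/2)^k * cost A c) \<longlonglongrightarrow> 0 * cost A c"
    by (intro tendsto_mult LIMSEQ_realpow_zero tendsto_const) auto
  then have "\<forall>\<^sub>F k in sequentially. (1/2)^k * cost A c < \<epsilon>/2"
    using assms(2) by (intro order_tendstoD(2)) auto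
  then obtain k where k: "(1/2)^k * cost A c < \<epsilon>/2"
    by (meson eventually_happens' sequentially_bot)
  have "kfun ((1/2)^k) f \<le> (1/2)^k * cost A c + sn (\<lambda>t. f t - comb A c t)"
    using A(1,2) by (intro kfun_le assms) simp_all
  also have "sn (\<lambda>t. f t - comb A c t) \<le> \<epsilon>/2"
    using A(3) assms(2) by (intro supnorm_least) auto
  finally show thesis
    using that[of k] k by simp
qed

text \<open>The coefficients are left variable so that the norm with one scale removed, as in
  \<open>knorm_split\<close>, obeys the same lemmas.\<close>

definition ksum :: "(nat \<Rightarrow> real) \<Rightarrow> ('a \<Rightarrow> real) \<Rightarrow> real" where
  "ksum b f = (\<Sum>k. b k * kfun ((1/2)^k) f)"

context
  fixes b :: "nat \<Rightarrow> real"
  assumes b: "\<And>k. 0 \<le> b k" "\<And>k. b k \<le> (1/2)^k"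
begin

lemma ksum_term_le: "f \<in> C \<Longrightarrow> b k * kfun ((1/2)^k) f \<le> (1/2)^k * sn f"
  using b by (intro mult_mono kfun_le_supnorm kfun_nonneg) simp_all

lemma ksum_summable:
  assumes "f \<in> C"
  shows "summable (\<lambda>k. b k * kfun ((1/2)^k) f)"
proof (rule summable_comparison_test'[of "\<lambda>k. (1/2)^k * sn f" 0])
  show "summable (\<lambda>k. (1/2::real)^k * sn f)"
    by (intro summable_mult2 summable_geometric) simp
  show "norm (b k * kfun ((1/2)^k) f) \<le> (1/2)^k * sn f" for k
    using ksum_term_le[OF assms, of k] b(1)[of k] kfun_nonneg[of "(1/2)^k" f] assms by simp
qed

lemma ksum_add:
  assumes "f \<in> C" "g \<in> C"
  shows "ksum b (\<lambda>t. f t + g t) \<le> ksum b f + ksum b g"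
proof -
  have "ksum b (\<lambda>t. f t + g t) \<le> (\<Sum>k. b k * kfun ((1/2)^k) f + b k * kfun ((1/2)^k) g)"
    unfolding ksum_def
  proof (intro suminf_le ksum_summable C0_add summable_add assms)
    show "b k * kfun ((1/2)^k) (\<lambda>t. f t + g t) \<le> b k * kfun ((1/2)^k) f + b k * kfun ((1/2)^k) g" for k
      using kfun_add[of "(1/2)^k", OF _ assms] b(1)[of k] by (simp add: distrib_left[symmetric] mult_left_mono)
  qed
  also have "\<dots> = ksum b f + ksum b g"
    unfolding ksum_def using assms by (intro suminf_add[symmetric] ksum_summable)
  finally show ?thesis .
qed

lemma ksum_scale:
  assumes "f \<in> C"
  shows "ksum b (\<lambda>t. c * f t) = \<bar>c\<bar> * ksum b f"
proof -
  have "ksum b (\<lambda>t. c * f t) = (\<Sum>k. \<bar>c\<bar> * (b k * kfun ((1/2)^k) f))"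
    unfolding ksum_def using kfun_scale[OF _ assms, of "(1/2)^_" c] by (simp add: mult.left_commute)
  also have "\<dots> = \<bar>c\<bar> * ksum b f"
    unfolding ksum_def by (rule suminf_mult[OF ksum_summable[OF assms]])
  finally show ?thesis .
qed

lemma ksum_le: "f \<in> C \<Longrightarrow> ksum b f \<le> 2 * sn f"
proof -
  assume f: "f \<in> C"
  have "ksum b f \<le> (\<Sum>k. (1/2)^k * sn f)"
    unfolding ksum_def using ksum_term_le[OF f]
    by (intro suminf_le ksum_summable[OF f] summable_mult2 summable_geometric) simp_all
  also have "\<dots> = 2 * sn f"
    using suminf_mult2[of "\<lambda>k. (1/2::real)^k" "sn f"] suminf_geometric[of "1/2::real"] by simp
  finally show ?thesis .
qed

lemma ksum_sublinear: "sublinear_on C (ksum b)"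
  by (rule sublinear_onI) (simp_all add: ksum_add ksum_scale)

end

abbreviation "knorm \<equiv> ksum (\<lambda>k. (1/2)^k)"

lemma equiv_norm_knorm: "equiv_norm T le knorm"
proof -
  have "1 * sn f \<le> knorm f" if f: "f \<in> C" for f
  proof -
    have "(\<Sum>k\<in>{0}. (1/2)^k * kfun ((1/2)^k) f) \<le> knorm f"
      unfolding ksum_def using kfun_nonneg f
      by (intro sum_le_suminf ksum_summable) auto
    then show ?thesis using kfun_one[OF f] by simp
  qed
  moreover have "knorm f \<le> 2 * sn f" if "f \<in> C" for f
    using that by (intro ksum_le) auto
  ultimately show ?thesis
    unfolding equiv_norm_def using ksum_add[of "\<lambda>k. (1/2)^k"] ksum_scale[of "\<lambda>k. (1/2)^k"]
    by (intro conjI ballI allI exI[of _ 1] exI[of _ 2]) auto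
qed

lemma knorm_split:
  assumes "f \<in> C"
  shows "knorm f = ksum (\<lambda>j. if j = k then 0 else (1/2)^j) f + (1/2)^k * kfun ((1/2)^k) f"
proof -
  have "(\<lambda>j. (if j = k then (1/2)^k * kfun ((1/2)^k) f else 0)) sums ((1/2)^k * kfun ((1/2)^k) f)"
    using sums_single[of k "\<lambda>j. (1/2)^j * kfun ((1/2)^j) f"] by (simp add: if_distrib cong: if_cong)
  moreover have "(\<lambda>j. (if j = k then 0 else (1/2)^j) * kfun ((1/2)^j) f) sums ksum (\<lambda>j. if j = k then 0 else (1/2)^j) f"
    unfolding ksum_def using assms by (intro summable_sums ksum_summable) auto
  ultimately have "(\<lambda>j. (if j = k then 0 else (1/2)^j) * kfun ((1/2)^j) f + (if j = k then (1/2)^k * kfun ((1/2)^k) f else 0))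
    sums (ksum (\<lambda>j. if j = k then 0 else (1/2)^j) f + (1/2)^k * kfun ((1/2)^k) f)"
    by (intro sums_add)
  moreover have "(\<lambda>j. (if j = k then 0 else (1/2)^j) * kfun ((1/2)^j) f + (if j = k then (1/2)^k * kfun ((1/2)^k) f else 0))
    = (\<lambda>j. (1/2)^j * kfun ((1/2)^j) f)"
    by auto
  ultimately show ?thesis
    unfolding ksum_def by (simp add: sums_iff)
qed

end

section \<open>Local control of near-optimal combinations\<close>

context tree_space
begin

lemma same_tbelow_unique:
  assumes "u \<in> T" "u' \<in> T" "tbelow T le u = tbelow T le u'" "s \<in> T" "le u s" "le u' s"
  shows "u = u'"
proof -
  have "le u u' \<or> le u' u"
    using le_linear_below[OF assms(1,2,4,5,6)] .
  then show ?thesis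
    using assms(1,2,3) by (auto simp: tbelow_def set_eq_iff)
qed

text \<open>Each \<open>j\<close> has its own witness; since \<open>e\<close> is a chain, the
  highest of finitely many witnesses serves for all.\<close>

lemma path_escape:
  assumes "path e" "e \<noteq> {}" "finite J" "J \<subseteq> T" "\<And>j. j \<in> J \<Longrightarrow> \<exists>y\<in>e. \<not> le y j"
  shows "\<exists>y\<in>e. \<forall>j\<in>J. \<not> le y j"
  using assms(3,4,5)
proof (induction J rule: finite_induct)
  case empty
  then show ?case using assms(2) by blast
next
  case (insert j J)
  obtain y1 where y1: "y1 \<in> e" "\<forall>j\<in>J. \<not> le y1 j"
    using insert by auto
  obtain y2 where y2: "y2 \<in> e" "\<not> le y2 j"
    using insert(5) by auto
  have yT: "y1 \<in> T" "y2 \<in> T" and jT: "j \<in> T" "J \<subseteq> T"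
    using pathD(1)[OF assms(1)] y1 y2 insert(4) by auto
  show ?case
    using pathD(3)[OF assms(1) y1(1) y2(1)]
  proof
    assume "le y1 y2"
    then have "\<forall>i\<in>J. \<not> le y2 i"
      using le_trans[OF yT] y1(2) jT(2) by blast
    then show ?case using y2 by blast
  next
    assume "le y2 y1"
    then have "\<not> le y1 j"
      using le_trans[OF yT(2,1) jT(1)] y2(2) by blast
    then show ?case using y1 by blast
  qed
qed

text \<open>Otherwise infinitely many disjoint intervals would carry a fixed amount of \<open>\<phi>\<close>.\<close>

lemma path_oscillation:
  assumes "\<phi> \<in> D" "path e" "e \<noteq> {}" "\<gamma> > 0" "G \<subseteq> T"
    and out: "\<And>x. x \<in> G \<Longrightarrow> \<exists>y\<in>e. \<not> le y x"
  shows "\<exists>y\<in>e. \<forall>s\<in>G. le y s \<longrightarrow> \<bar>\<phi> (ch s) - \<phi> (ch y)\<bar> < \<gamma>"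
proof (rule ccontr)
  assume "\<not> ?thesis"
  then have "\<forall>y\<in>e. \<exists>s. s \<in> G \<and> le y s \<and> \<gamma> \<le> \<bar>\<phi> (ch s) - \<phi> (ch y)\<bar>"
    by (meson not_le)
  then obtain g where g: "\<And>y. y \<in> e \<Longrightarrow> g y \<in> G \<and> le y (g y) \<and> \<gamma> \<le> \<bar>\<phi> (ch (g y)) - \<phi> (ch y)\<bar>"
    by metis
  \<comment> \<open>The next point of the sequence is taken outside (0,g y], so that the intervals
    from \<open>x n\<close> to \<open>g (x n)\<close> become disjoint.\<close>
  have "\<forall>y\<in>e. \<exists>z. z \<in> e \<and> \<not> le z (g y)"
    using out g by blast
  then obtain nx where nx: "\<And>y. y \<in> e \<Longrightarrow> nx y \<in> e \<and> \<not> le (nx y) (g y)"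
    by metis
  obtain y0 where y0: "y0 \<in> e" using assms(3) by blast
  define x where "x = (\<lambda>n. (nx ^^ n) y0)"
  have xe: "x n \<in> e" for n
    by (induction n) (use y0 nx in \<open>auto simp: x_def\<close>)
  have xT: "x n \<in> T" for n using pathD(1)[OF assms(2)] xe by blast
  have gT: "g (x n) \<in> T" for n using g[OF xe] assms(5) by blast
  have incr: "le (x n) (x (Suc n))" for n
  proof -
    have "\<not> le (x (Suc n)) (x n)"
      using nx[OF xe[of n]] le_trans[OF xT[of "Suc n"] xT[of n] gT[of n]] g[OF xe[of n]] by (auto simp: x_def)
    then show ?thesis
      using pathD(3)[OF assms(2) xe[of n] xe[of "Suc n"]] by blast
  qed
  have mono: "le (x m) (x n)" if "m \<le> n" for m n
    using that
  proof (induction n rule: dec_induct)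
    case base
    then show ?case using le_refl[OF xT] .
  next
    case (step n)
    then show ?case using le_trans[OF xT xT xT _ incr] by blast
  qed
  obtain K where K: "K \<ge> 0" "\<And>f. f \<in> C \<Longrightarrow> \<bar>\<phi> f\<bar> \<le> K * sn f"
    using dual_bound[OF assms(1)] by blast
  obtain n where n: "K < real n * \<gamma>"
    using spec[OF reals_Archimedean3[OF assms(4)], of K] by (elim exE)
  define h where "h = (\<lambda>i t. ch (g (x i)) t - ch (x i) t)"
  have hC: "h i \<in> C" for i
    unfolding h_def by (intro C0_diff C0_ch gT xT)
  have ge: "le (x i) (g (x i))" for i using g[OF xe] by blast
  have supp: "t \<in> T \<and> le t (g (x i)) \<and> le (x i) t" if "h i t \<noteq> 0" for i t
  proof -
    have "le t (g (x i))" if "t \<in> T" "le t (x i)"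
      using le_trans[OF that(1) xT gT that(2) ge] .
    then have t: "t \<in> T" "le t (g (x i))" "\<not> le t (x i)"
      using that by (auto simp: h_def ch_def split: if_splits)
    then show ?thesis
      using le_linear_below[OF t(1) xT gT t(2) ge] by blast
  qed
  have "i = j" if "h i t \<noteq> 0" "h j t \<noteq> 0" for i j t
  proof -
    have no: False if "i < j" "h i t \<noteq> 0" "h j t \<noteq> 0" for i j
    proof -
      have t: "t \<in> T" "le (x j) t" "le t (g (x i))"
        using supp[OF that(2)] supp[OF that(3)] by blast+
      have "le (x (Suc i)) (x j)" using mono \<open>i < j\<close> by simp
      then have "le (x (Suc i)) t"
        using le_trans[OF xT xT t(1) _ t(2)] by blast
      then have "le (x (Suc i)) (g (x i))"
        using le_trans[OF xT t(1) gT _ t(3)] by blast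
      then show False
        using nx[OF xe[of i]] by (simp add: x_def)
    qed
    show ?thesis using no[of i j] no[of j i] that by (meson linorder_neqE_nat)
  qed
  moreover have "\<bar>h i t\<bar> \<le> 1" for i t
    by (simp add: h_def ch_def)
  ultimately have "(\<Sum>i\<in>{..<n}. \<bar>\<phi> (h i)\<bar>) \<le> K"
    using hC by (intro dual_disjoint_sum[OF assms(1) K]) auto
  moreover have "real n * \<gamma> \<le> (\<Sum>i\<in>{..<n}. \<bar>\<phi> (h i)\<bar>)"
  proof -
    have "\<gamma> \<le> \<bar>\<phi> (h i)\<bar>" for i
      unfolding h_def using dual_diff[OF assms(1) C0_ch[OF gT] C0_ch[OF xT]] g[OF xe] by simp
    then show ?thesis
      using sum_bounded_below[of "{..<n}" \<gamma> "\<lambda>i. \<bar>\<phi> (h i)\<bar>"] by simp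
  qed
  ultimately show False using n by simp
qed

end

context weighted_tree
begin

context
  fixes l :: real and \<phi> :: "('a \<Rightarrow> real) \<Rightarrow> real" and f :: "'a \<Rightarrow> real" and \<epsilon> :: real
  assumes l: "l > 0" and \<phi>: "\<phi> \<in> D" and \<phi>_ch: "\<And>t. t \<in> T \<Longrightarrow> \<bar>\<phi> (ch t)\<bar> \<le> l * w t"
    and f: "f \<in> C" and \<epsilon>: "\<epsilon> > 0"
begin

text \<open>All terms of the defect are nonnegative, and it is small for the near-optimal combinations of functions
  weakly close to \<open>f\<close>, if \<open>\<phi>\<close> norms \<open>f\<close>.\<close>

definition defect :: "'a set \<Rightarrow> ('a \<Rightarrow> real) \<Rightarrow> real" where
  "defect B c = (\<Sum>b\<in>B. l * w b * \<bar>c b\<bar> - c b * \<phi> (ch b))"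

text \<open>What weak closeness to \<open>f\<close> provides about a near-optimal combination for
  \<open>g\<close>. The tolerance at the points of \<open>Z\<close> is one \<epsilon> for
  \<open>g - f\<close> and one for the remainder of the combination.\<close>

definition testing :: "'a set \<Rightarrow> real \<Rightarrow> 'a set \<Rightarrow> ('a \<Rightarrow> real) \<Rightarrow> bool" where
  "testing Z \<eta> B c \<longleftrightarrow> finite B \<and> B \<subseteq> T \<and> defect B c < \<eta> \<and> (\<forall>z\<in>Z. \<bar>comb B c z - f z\<bar> \<le> 2 * \<epsilon>)"

lemma testingI:
  "finite B \<Longrightarrow> B \<subseteq> T \<Longrightarrow> defect B c < \<eta> \<Longrightarrow> (\<And>z. z \<in> Z \<Longrightarrow> \<bar>comb B c z - f z\<bar> \<le> 2 * \<epsilon>) \<Longrightarrow> testing Z \<eta> B c"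
  by (simp add: testing_def)

lemma defect_eq:
  assumes "finite B" "B \<subseteq> T"
  shows "defect B c = l * cost B c - \<phi> (comb B c)"
proof -
  have "comb B c = (\<lambda>t. \<Sum>b\<in>B. c b * ch b t)"
    by (simp add: comb_def fun_eq_iff)
  then have "\<phi> (comb B c) = (\<Sum>b\<in>B. c b * \<phi> (ch b))"
    using dual_sum[OF \<phi> assms(1), of ch c] C0_ch assms(2) by auto
  then show ?thesis
    by (simp add: defect_def cost_def sum_subtractf sum_distrib_left mult.assoc)
qed

text \<open>Finitely many tests decide the combination on \<open>W\<close>. These sets form an
  ideal, since tests can be united without worsening the constant. The largest error that occurs, at
  paths without last point, is \<open>9 * \<epsilon>\<close>.\<close>

definition controlled :: "'a set \<Rightarrow> bool" where
  "controlled W \<longleftrightarrow> (\<exists>Z \<eta>. finite Z \<and> \<eta> > 0 \<and>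
     (\<forall>B c. testing Z \<eta> B c \<longrightarrow> (\<forall>s\<in>W. \<bar>comb B c s - f s\<bar> \<le> 10 * \<epsilon>)))"

lemma controlledI:
  assumes "finite Z" "\<eta> > 0" "\<And>B c s. testing Z \<eta> B c \<Longrightarrow> s \<in> W \<Longrightarrow> \<bar>comb B c s - f s\<bar> \<le> 10 * \<epsilon>"
  shows "controlled W"
  unfolding controlled_def using assms by blast

lemma controlledE:
  assumes "controlled W"
  obtains Z \<eta> where "finite Z" "\<eta> > 0" "\<And>B c s. testing Z \<eta> B c \<Longrightarrow> s \<in> W \<Longrightarrow> \<bar>comb B c s - f s\<bar> \<le> 10 * \<epsilon>"
  using assms unfolding controlled_def by blast

lemma controlled_mono: "controlled W \<Longrightarrow> W' \<subseteq> W \<Longrightarrow> controlled W'"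
  unfolding controlled_def by blast

lemma controlled_Un:
  assumes "controlled W" "controlled W'"
  shows "controlled (W \<union> W')"
proof -
  obtain Z \<eta> where Z: "finite Z" "\<eta> > 0" "\<And>B c s. testing Z \<eta> B c \<Longrightarrow> s \<in> W \<Longrightarrow> \<bar>comb B c s - f s\<bar> \<le> 10 * \<epsilon>"
    using controlledE[OF assms(1)] by metis
  obtain Z' \<eta>' where Z': "finite Z'" "\<eta>' > 0" "\<And>B c s. testing Z' \<eta>' B c \<Longrightarrow> s \<in> W' \<Longrightarrow> \<bar>comb B c s - f s\<bar> \<le> 10 * \<epsilon>"
    using controlledE[OF assms(2)] by metis
  show ?thesis
  proof (rule controlledI)
    show "finite (Z \<union> Z')" "min \<eta> \<eta>' > 0" using Z Z' by auto
    fix B c s assume t: "testing (Z \<union> Z') (min \<eta> \<eta>') B c" and s: "s \<in> W \<union> W'"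
    have "testing Z \<eta> B c" "testing Z' \<eta>' B c"
      using t by (auto simp: testing_def)
    then show "\<bar>comb B c s - f s\<bar> \<le> 10 * \<epsilon>"
      using Z(3) Z'(3) s by blast
  qed
qed

text \<open>A Chebyshev argument: the bound on \<open>\<phi> (ch b)\<close> makes every term of the
  defect nonnegative, so the terms with \<open>b\<close> in \<open>X\<close> add up to at most
  \<eta>.\<close>

lemma mass_le:
  assumes "testing Z \<eta> B c" "\<And>b. b \<in> B \<Longrightarrow> b \<in> X \<Longrightarrow> \<theta> * \<bar>c b\<bar> \<le> l * w b * \<bar>c b\<bar> - c b * \<phi> (ch b)"
  shows "\<theta> * (\<Sum>b\<in>{b\<in>B. b \<in> X}. \<bar>c b\<bar>) \<le> \<eta>"
proof -
  have B: "finite B" "B \<subseteq> T" "defect B c < \<eta>" using assms(1) by (auto simp: testing_def)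
  have nn: "0 \<le> l * w b * \<bar>c b\<bar> - c b * \<phi> (ch b)" if "b \<in> B" for b
  proof -
    have "c b * \<phi> (ch b) \<le> \<bar>c b\<bar> * \<bar>\<phi> (ch b)\<bar>"
      by (metis abs_ge_self abs_mult)
    also have "\<dots> \<le> \<bar>c b\<bar> * (l * w b)"
      using \<phi>_ch[of b] that B(2) by (intro mult_left_mono) auto
    finally show ?thesis by (simp add: mult.commute)
  qed
  have "\<theta> * (\<Sum>b\<in>{b\<in>B. b \<in> X}. \<bar>c b\<bar>) \<le> (\<Sum>b\<in>{b\<in>B. b \<in> X}. l * w b * \<bar>c b\<bar> - c b * \<phi> (ch b))"
    unfolding sum_distrib_left by (rule sum_mono) (use assms(2) in auto)
  also have "\<dots> \<le> defect B c"
    unfolding defect_def by (rule sum_mono2) (use B nn in auto)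
  finally show ?thesis using B(3) by simp
qed

lemma abs_comb_le_mass:
  assumes "finite B" "s \<in> T"
  shows "\<bar>comb B c s\<bar> \<le> (\<Sum>b\<in>{b\<in>B. le s b}. \<bar>c b\<bar>)"
  unfolding comb_above[OF assms] by (rule sum_abs)

text \<open>Beyond an empty path or a path with a last point only finitely many directions matter, namely those
  where \<open>f\<close> is large, where \<open>\<phi>\<close> differs from its value \<open>\<phi> h\<close> on the path, or which are exceptional for the
  weight; in the others the weight exceeds \<open>\<phi>\<close> by a fixed amount, which makes the mass there small.\<close>

lemma controlled_beyond:
  assumes e: "path e" and h: "h \<in> C" "\<And>x. h x = (if x \<in> e then 1 else 0)"
    and E: "finite E" "E \<subseteq> e" "\<And>s. s \<in> T \<Longrightarrow> \<forall>x\<in>E. le x s \<Longrightarrow> e \<subseteq> tdown T le s"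
    and Z: "finite Z" "\<And>s. s \<in> e \<Longrightarrow> \<forall>x\<in>E. le x s \<Longrightarrow> s \<in> Z"
    and G: "finite G" "G \<subseteq> T - e" and \<delta>: "\<delta> > 0"
    and heavy: "\<And>u s. u \<in> T \<Longrightarrow> tbelow T le u = e \<Longrightarrow> u \<notin> G \<Longrightarrow> s \<in> T \<Longrightarrow> le u s \<Longrightarrow> \<bar>\<phi> h\<bar> + \<delta> \<le> l * w s"
  shows "\<exists>E F. finite E \<and> E \<subseteq> e \<and> finite F \<and> F \<subseteq> T - e \<and>
    controlled {s \<in> T. (\<forall>x\<in>E. s \<in> up x) \<and> (\<forall>x\<in>F. s \<notin> up x)}"
proof -
  obtain J where J: "finite J" "J \<subseteq> T" "\<And>x. x \<in> T \<Longrightarrow> \<epsilon> \<le> \<bar>f x\<bar> \<Longrightarrow> \<exists>j\<in>J. le x j"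
    using C0_support[OF f \<epsilon>] by blast
  define F1 where "F1 = {u \<in> T. tbelow T le u = e \<and> (\<exists>r\<in>T. le u r \<and> \<delta>/2 \<le> \<bar>\<phi> (ch r) - \<phi> h\<bar>)}"
  define F2 where "F2 = (\<Union>j\<in>J. {u \<in> T. tbelow T le u = e \<and> le u j})"
  have "finite F1"
    unfolding F1_def using \<delta> by (intro finite_exceptional[OF \<phi> h]) simp
  moreover have "finite F2"
  proof -
    have "finite {u \<in> T. tbelow T le u = e \<and> le u j}" if "j \<in> J" for j
    proof (cases "\<exists>u. u \<in> T \<and> tbelow T le u = e \<and> le u j")
      case True
      then obtain u where u: "u \<in> T" "tbelow T le u = e" "le u j" by blast
      have "v = u" if "v \<in> T" "tbelow T le v = e" "le v j" for v
        using same_tbelow_unique[OF that(1) u(1) _ _ that(3) u(3)] that(2) u(2) \<open>j \<in> J\<close> J(2) by blast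
      then have "{u \<in> T. tbelow T le u = e \<and> le u j} \<subseteq> {u}" by blast
      then show ?thesis using finite_subset by blast
    next
      case False
      then have "{u \<in> T. tbelow T le u = e \<and> le u j} = {}" by blast
      then show ?thesis by (metis finite.emptyI)
    qed
    then show ?thesis
      unfolding F2_def using J(1) by blast
  qed
  ultimately have finF: "finite (G \<union> F1 \<union> F2)" using G(1) by simp
  have sub: "G \<union> F1 \<union> F2 \<subseteq> T - e"
    using G(2) by (auto simp: F1_def F2_def tbelow_def)
  have "controlled {s \<in> T. (\<forall>x\<in>E. s \<in> up x) \<and> (\<forall>x\<in>G \<union> F1 \<union> F2. s \<notin> up x)}"
  proof (rule controlledI[OF Z(1)])
    \<comment> \<open>Beyond the good directions the defect is at least \<open>\<delta> / 2\<close>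
      times the mass, so this threshold leaves a mass of at most \<epsilon>.\<close>
    show "\<epsilon> * \<delta> / 2 > 0" using \<epsilon> \<delta> by simp
    fix B c s assume t: "testing Z (\<epsilon> * \<delta> / 2) B c"
      and s: "s \<in> {s \<in> T. (\<forall>x\<in>E. s \<in> up x) \<and> (\<forall>x\<in>G \<union> F1 \<union> F2. s \<notin> up x)}"
    have sT: "s \<in> T" and sE: "\<forall>x\<in>E. le x s" and sF: "\<And>u. u \<in> G \<union> F1 \<union> F2 \<Longrightarrow> \<not> le u s"
      using s by (auto simp: up_def)
    show "\<bar>comb B c s - f s\<bar> \<le> 10 * \<epsilon>"
    proof (cases "s \<in> e")
      case True
      then have "\<bar>comb B c s - f s\<bar> \<le> 2 * \<epsilon>"
        using Z(2) sE t by (auto simp: testing_def)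
      then show ?thesis using \<epsilon> by simp
    next
      case False
      obtain u where u: "u \<in> T" "le u s" "u \<notin> e" "tbelow T le u = e"
        by (rule path_first[OF e E(3)[OF sT sE] sT False])
      have uF: "u \<notin> G" "u \<notin> F1" "u \<notin> F2" using sF u(2) by blast+
      have "\<bar>f s\<bar> < \<epsilon>"
      proof (rule ccontr)
        assume "\<not> \<bar>f s\<bar> < \<epsilon>"
        then obtain j where j: "j \<in> J" "le s j" using J(3)[OF sT] by auto
        then have "le u j" using le_trans[OF u(1) sT _ u(2)] J(2) by blast
        then show False using uF(3) u j by (auto simp: F2_def)
      qed
      moreover have "\<bar>comb B c s\<bar> \<le> \<epsilon>"
      proof -
        have "(\<delta>/2) * (\<Sum>b\<in>{b\<in>B. b \<in> up s}. \<bar>c b\<bar>) \<le> \<epsilon> * \<delta> / 2"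
        proof (rule mass_le[OF t])
          fix b assume b: "b \<in> B" "b \<in> up s"
          then have bT: "b \<in> T" "le s b" by (auto simp: up_def)
          have ub: "le u b" using le_trans[OF u(1) sT bT(1) u(2) bT(2)] .
          have "\<bar>\<phi> (ch b) - \<phi> h\<bar> < \<delta>/2"
            using uF(2) u bT(1) ub by (force simp: F1_def)
          moreover have "\<bar>\<phi> h\<bar> + \<delta> \<le> l * w b"
            using heavy[OF u(1,4) uF(1) bT(1) ub] .
          ultimately have "\<delta>/2 + \<bar>\<phi> (ch b)\<bar> \<le> l * w b" by linarith
          then have "(\<delta>/2 + \<bar>\<phi> (ch b)\<bar>) * \<bar>c b\<bar> \<le> l * w b * \<bar>c b\<bar>"
            by (intro mult_right_mono) auto
          moreover have "c b * \<phi> (ch b) \<le> \<bar>\<phi> (ch b)\<bar> * \<bar>c b\<bar>"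
            by (metis abs_ge_self abs_mult mult.commute)
          ultimately show "\<delta>/2 * \<bar>c b\<bar> \<le> l * w b * \<bar>c b\<bar> - c b * \<phi> (ch b)"
            by (simp add: distrib_right)
        qed
        moreover have "{b\<in>B. b \<in> up s} = {b\<in>B. le s b}"
          using t by (auto simp: up_def testing_def)
        ultimately have "\<delta> * (\<Sum>b\<in>{b\<in>B. le s b}. \<bar>c b\<bar>) \<le> \<delta> * \<epsilon>"
          by (simp add: mult.commute)
        then have "(\<Sum>b\<in>{b\<in>B. le s b}. \<bar>c b\<bar>) \<le> \<epsilon>"
          using \<delta> by simp
        then show ?thesis
          using abs_comb_le_mass[OF _ sT, of B c] t by (auto simp: testing_def)
      qed
      ultimately show ?thesis using \<epsilon> by linarith
    qed
  qed
  then show ?thesis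
    using E(1,2) finF sub by (intro exI[of _ E] exI[of _ "G \<union> F1 \<union> F2"] conjI)
qed

text \<open>Here \<open>h\<close> is 0, and the fixed excess of the weight over \<phi> is
  \<open>l\<close>, because all weights are at least 1.\<close>

lemma controlled_root:
  "\<exists>E F. finite E \<and> E \<subseteq> {} \<and> finite F \<and> F \<subseteq> T - {} \<and>
    controlled {s \<in> T. (\<forall>x\<in>E. s \<in> up x) \<and> (\<forall>x\<in>F. s \<notin> up x)}"
proof (rule controlled_beyond[where h = "\<lambda>t. 0" and E = "{}" and Z = "{}" and G = "{}" and \<delta> = l])
  show "\<bar>\<phi> (\<lambda>t. 0)\<bar> + l \<le> l * w s" if "s \<in> T" for s
    using weight_ge_1[OF that] l dual_zero[OF \<phi>] by simp
qed (use l in \<open>auto simp: path_empty C0_zero\<close>)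

text \<open>This is where the absence of bad points enters: outside finitely many successors the
  weight exceeds \<open>w t\<close> by \<open>d\<close>, while \<open>\<phi> (ch t)\<close> is
  bounded by \<open>l * w t\<close>. The excess is \<open>l * d\<close>.\<close>

lemma controlled_tdown:
  assumes t: "t \<in> T"
  shows "\<exists>E F. finite E \<and> E \<subseteq> tdown T le t \<and> finite F \<and> F \<subseteq> T - tdown T le t \<and>
    controlled {s \<in> T. (\<forall>x\<in>E. s \<in> up x) \<and> (\<forall>x\<in>F. s \<notin> up x)}"
proof -
  obtain G d where G: "finite G" "G \<subseteq> tsucc T le t" "d > 0" "\<And>u. u \<in> tsucc T le t - G \<Longrightarrow> w t + d \<le> w u"
    using good_pointE[OF weight_good[OF t]] by metis
  show ?thesis
  proof (rule controlled_beyond[where h = "ch t" and E = "{t}" and Z = "{t}" and G = G and \<delta> = "l * d"])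
    show "ch t x = (if x \<in> tdown T le t then 1 else 0)" for x
      by (simp add: ch_def tdown_def)
    show "tdown T le t \<subseteq> tdown T le s" if "s \<in> T" "\<forall>x\<in>{t}. le x s" for s
      using that t le_trans[of _ t s] by (auto simp: tdown_def)
    show "s \<in> {t}" if "s \<in> tdown T le t" "\<forall>x\<in>{t}. le x s" for s
      using that t le_antisym[of s t] by (auto simp: tdown_def)
    show "{t} \<subseteq> tdown T le t"
      using t le_refl[OF t] by (simp add: tdown_def)
    show "G \<subseteq> T - tdown T le t"
      using G(2) by (auto simp: tsucc_def tbelow_def)
    show "\<bar>\<phi> (ch t)\<bar> + l * d \<le> l * w s"
      if u: "u \<in> T" "tbelow T le u = tdown T le t" "u \<notin> G" and s: "s \<in> T" "le u s" for u s
    proof -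
      have "w t + d \<le> w u" using G(4) u by (simp add: tsucc_def)
      also have "\<dots> \<le> w s" using weight_mono[OF u(1) s] .
      finally have "l * (w t + d) \<le> l * w s" using l by simp
      then show ?thesis
        using \<phi>_ch[OF t] by (simp add: distrib_left)
    qed
  qed (use t l G in \<open>auto simp: path_tdown C0_ch\<close>)
qed

text \<open>Beyond a path without last point \<open>\<phi>\<close> hardly oscillates, so the masses there have essentially one
  sign. Their sum is known, as \<open>comb B c\<close> is controlled at both ends; here \<open>star\<close> is evaluation at the
  limit of the path, or zero if there is no limit.\<close>

lemma controlled_limit_aux:
  assumes e: "path e" "e \<noteq> {}" and Ft: "finite Ft" "Ft \<subseteq> T - e"
    and Y: "Y = {s \<in> T. \<exists>t\<in>Ft. le t s}"
    and out: "\<And>x. x \<in> T - Y \<Longrightarrow> \<exists>y\<in>e. \<not> le y x"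
    and star_comb: "\<And>B c s. finite B \<Longrightarrow> B \<subseteq> T \<Longrightarrow> s \<in> e \<Longrightarrow>
      comb B c s - star (comb B c) = (\<Sum>b\<in>{b\<in>B. le s b \<and> b \<notin> Y}. c b)"
    and star_close: "\<And>g. \<forall>z\<in>Ft. \<bar>g z - f z\<bar> \<le> 2 * \<epsilon> \<Longrightarrow> \<bar>star g - star f\<bar> \<le> 2 * \<epsilon>"
    and f_near: "\<exists>y\<in>e. \<forall>s\<in>e. le y s \<longrightarrow> \<bar>f s - star f\<bar> \<le> \<epsilon>"
    and off: "\<And>s b. s \<in> T - Y - e \<Longrightarrow> b \<in> T \<Longrightarrow> le s b \<Longrightarrow> b \<notin> Y"
  shows "\<exists>E F. finite E \<and> E \<subseteq> e \<and> finite F \<and> F \<subseteq> T - e \<and>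
    controlled {s \<in> T. (\<forall>x\<in>E. s \<in> up x) \<and> (\<forall>x\<in>F. s \<notin> up x)}"
proof -
  have eT: "e \<subseteq> T" using pathD(1)[OF e(1)] .
  obtain y1 where y1: "y1 \<in> e" "\<And>s. s \<in> T - Y \<Longrightarrow> le y1 s \<Longrightarrow> \<bar>\<phi> (ch s) - \<phi> (ch y1)\<bar> < l/2"
    using path_oscillation[OF \<phi> e, of "l/2" "T - Y"] out l by auto
  obtain y2 where y2: "y2 \<in> e" "\<And>s. s \<in> e \<Longrightarrow> le y2 s \<Longrightarrow> \<bar>f s - star f\<bar> \<le> \<epsilon>"
    using f_near by blast
  obtain J where J: "finite J" "J \<subseteq> T" "\<And>x. x \<in> T \<Longrightarrow> \<epsilon> \<le> \<bar>f x\<bar> \<Longrightarrow> \<exists>j\<in>J. le x j"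
    using C0_support[OF f \<epsilon>] by blast
  obtain y3 where y3: "y3 \<in> e" "\<And>j. j \<in> J - Y \<Longrightarrow> \<not> le y3 j"
  proof -
    have "\<exists>y\<in>e. \<forall>j\<in>J - Y. \<not> le y j"
      by (rule path_escape[OF e]) (use J(1,2) out in auto)
    then show thesis using that by blast
  qed
  have yT: "y1 \<in> T" "y2 \<in> T" "y3 \<in> T" using y1 y2 y3 eT by auto
  \<comment> \<open>A point of \<open>e\<close> above \<open>y1\<close>, \<open>y2\<close> and
    \<open>y3\<close>: beyond it \<phi> hardly oscillates off \<open>Y\<close>, \<open>f\<close> is
    almost constant on \<open>e\<close>, and \<open>f\<close> is small off \<open>e\<close> and
    \<open>Y\<close>.\<close>
  obtain s0 where s0: "s0 \<in> e" "le y1 s0" "le y2 s0" "le y3 s0"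
  proof -
    obtain z where z: "z \<in> e" "le y1 z" "le y2 z"
      using pathD(3)[OF e(1) y1(1) y2(1)] le_refl yT y1(1) y2(1) by blast
    have zT: "z \<in> T" using z(1) eT by blast
    consider "le z y3" | "le y3 z" using pathD(3)[OF e(1) z(1) y3(1)] by blast
    then show thesis
    proof cases
      case 1
      then show ?thesis
        using that[OF y3(1)] le_trans[OF yT(1) zT yT(3) z(2)] le_trans[OF yT(2) zT yT(3) z(3)] le_refl[OF yT(3)] by blast
    next
      case 2
      then show ?thesis using that[OF z] by blast
    qed
  qed
  have s0T: "s0 \<in> T" using s0(1) eT by blast
  have osc: "\<bar>\<phi> (ch s) - \<phi> (ch y1)\<bar> < l/2" if "s \<in> T - Y" "le s0 s" for s
    using y1(2)[OF that(1)] le_trans[OF yT(1) s0T _ s0(2) that(2)] that(1) by blast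
  have f_on: "\<bar>f s - star f\<bar> \<le> \<epsilon>" if "s \<in> e" "le s0 s" for s
    using y2(2)[OF that(1)] le_trans[OF yT(2) s0T _ s0(3) that(2)] that(1) eT by blast
  have f_off: "\<bar>f s\<bar> \<le> \<epsilon>" if s: "s \<in> T - Y - e" "le s0 s" for s
  proof (rule ccontr)
    assume "\<not> \<bar>f s\<bar> \<le> \<epsilon>"
    then obtain j where j: "j \<in> J" "le s j" using J(3)[of s] s by auto
    then have jT: "j \<in> T" "j \<in> J - Y" using off[OF s(1)] J(2) by blast+
    have "le s0 j" using le_trans[OF s0T _ jT(1) s(2) j(2)] s(1) by blast
    then have "le y3 j" using le_trans[OF yT(3) s0T jT(1) s0(4)] by blast
    then show False using y3(2) jT(2) by blast
  qed
  have "controlled {s \<in> T. (\<forall>x\<in>{s0}. s \<in> up x) \<and> (\<forall>x\<in>Ft. s \<notin> up x)}"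
  proof (rule controlledI)
    show "finite (insert s0 Ft)" using Ft(1) by simp
    \<comment> \<open>This threshold bounds the mass of the wrong sign by
      \<open>\<epsilon> / 2\<close>.\<close>
    show "\<epsilon> * l / 4 > 0" using \<epsilon> l by simp
    fix B c s assume t: "testing (insert s0 Ft) (\<epsilon> * l / 4) B c"
      and s: "s \<in> {s \<in> T. (\<forall>x\<in>{s0}. s \<in> up x) \<and> (\<forall>x\<in>Ft. s \<notin> up x)}"
    have B: "finite B" "B \<subseteq> T" "\<bar>comb B c s0 - f s0\<bar> \<le> 2 * \<epsilon>" "\<forall>z\<in>Ft. \<bar>comb B c z - f z\<bar> \<le> 2 * \<epsilon>"
      using t by (auto simp: testing_def)
    have sT: "s \<in> T" "le s0 s" "s \<notin> Y" using s by (auto simp: up_def Y)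
    define V where "V = {b\<in>B. le s0 b \<and> b \<notin> Y}"
    define \<sigma> :: real where "\<sigma> = (if \<phi> (ch y1) \<ge> 0 then 1 else -1)"
    have \<sigma>: "\<sigma> = 1 \<or> \<sigma> = -1" "0 \<le> \<sigma> * \<phi> (ch y1)"
      by (auto simp: \<sigma>_def)
    define neg where "neg = (\<lambda>b. if \<sigma> * c b < 0 then \<bar>c b\<bar> else 0)"
    have starB: "\<bar>star (comb B c) - star f\<bar> \<le> 2 * \<epsilon>"
      using star_close B(4) by blast
    \<comment> \<open>The errors are \<open>2 * \<epsilon>\<close> from the test at
      \<open>s0\<close>, \<open>2 * \<epsilon>\<close> from \<open>star\<close>, and \<epsilon> from
      the variation of \<open>f\<close> between them.\<close>
    have sumV: "\<bar>\<Sum>b\<in>V. c b\<bar> \<le> 5 * \<epsilon>"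
    proof -
      have "(\<Sum>b\<in>V. c b) = comb B c s0 - star (comb B c)"
        unfolding V_def using star_comb[OF B(1,2) s0(1)] by simp
      moreover have "\<bar>f s0 - star f\<bar> \<le> \<epsilon>" using f_on[OF s0(1) le_refl[OF s0T]] .
      ultimately show ?thesis using B(3) starB by linarith
    qed
    \<comment> \<open>For a coefficient of sign opposite to \<sigma>,
      \<open>c b * \<phi> (ch b)\<close> is at most \<open>(l/2) * \<bar>c b\<bar>\<close>, while
      its cost is at least \<open>l * \<bar>c b\<bar>\<close>. Coefficients of the right sign may
      have no defect at all; they are bounded through \<open>sumV\<close>.\<close>
    have "(l/2) * (\<Sum>b\<in>{b\<in>B. b \<in> {b. le s0 b \<and> b \<notin> Y \<and> \<sigma> * c b < 0}}. \<bar>c b\<bar>) \<le> \<epsilon> * l / 4"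
    proof (rule mass_le[OF t])
      fix b assume b: "b \<in> B" "b \<in> {b. le s0 b \<and> b \<notin> Y \<and> \<sigma> * c b < 0}"
      then have bT: "b \<in> T" using B(2) by blast
      have cb: "c b = - \<sigma> * \<bar>c b\<bar>" using b(2) \<sigma>(1) by auto
      have "\<bar>\<sigma> * \<phi> (ch b) - \<sigma> * \<phi> (ch y1)\<bar> < l/2"
        using osc[of b] b bT \<sigma>(1) by (auto simp: abs_minus_commute)
      then have "- (l/2) \<le> \<sigma> * \<phi> (ch b)" using \<sigma>(2) by linarith
      then have "- (l/2) * \<bar>c b\<bar> \<le> \<sigma> * \<phi> (ch b) * \<bar>c b\<bar>"
        by (intro mult_right_mono) auto
      also have "\<dots> = - (c b * \<phi> (ch b))"
        by (subst (2) cb) (simp add: algebra_simps)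
      finally have 1: "- (l/2) * \<bar>c b\<bar> \<le> - (c b * \<phi> (ch b))" .
      have "l \<le> l * w b" using weight_ge_1[OF bT] l by simp
      then have "l * \<bar>c b\<bar> \<le> l * w b * \<bar>c b\<bar>" by (intro mult_right_mono) auto
      moreover have "l/2 * \<bar>c b\<bar> = l * \<bar>c b\<bar> + - (l/2) * \<bar>c b\<bar>" by simp
      ultimately show "l/2 * \<bar>c b\<bar> \<le> l * w b * \<bar>c b\<bar> - c b * \<phi> (ch b)"
        using 1 by linarith
    qed
    moreover have "(\<Sum>b\<in>{b\<in>B. b \<in> {b. le s0 b \<and> b \<notin> Y \<and> \<sigma> * c b < 0}}. \<bar>c b\<bar>) = (\<Sum>b\<in>V. neg b)"
      unfolding V_def neg_def using B(1) by (intro sum.mono_neutral_cong_left) auto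
    ultimately have "l * (2 * (\<Sum>b\<in>V. neg b)) \<le> l * \<epsilon>"
      by (simp add: mult.commute)
    then have negV: "2 * (\<Sum>b\<in>V. neg b) \<le> \<epsilon>"
      using l by simp
    have massV: "(\<Sum>b\<in>V. \<bar>c b\<bar>) \<le> 6 * \<epsilon>"
    proof -
      have "\<bar>c b\<bar> = \<sigma> * c b + 2 * neg b" for b
        using \<sigma>(1) by (auto simp: neg_def)
      then have "(\<Sum>b\<in>V. \<bar>c b\<bar>) = \<sigma> * (\<Sum>b\<in>V. c b) + 2 * (\<Sum>b\<in>V. neg b)"
        by (simp add: sum.distrib sum_distrib_left)
      also have "\<sigma> * (\<Sum>b\<in>V. c b) \<le> \<bar>\<Sum>b\<in>V. c b\<bar>"
        using \<sigma>(1) by auto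
      finally show ?thesis using sumV negV by linarith
    qed
    have finV: "finite V" using B(1) by (simp add: V_def)
    show "\<bar>comb B c s - f s\<bar> \<le> 10 * \<epsilon>"
    proof (cases "s \<in> e")
      case True
      have "\<bar>comb B c s - star (comb B c)\<bar> \<le> (\<Sum>b\<in>{b\<in>B. le s b \<and> b \<notin> Y}. \<bar>c b\<bar>)"
        unfolding star_comb[OF B(1,2) True] by (rule sum_abs)
      also have "\<dots> \<le> (\<Sum>b\<in>V. \<bar>c b\<bar>)"
        using le_trans[OF s0T sT(1) _ sT(2)] B(2) finV by (intro sum_mono2) (auto simp: V_def)
      finally show ?thesis
        using massV starB f_on[OF True sT(2)] by linarith
    next
      case False
      then have sY: "s \<in> T - Y - e" using sT by blast
      have "\<bar>comb B c s\<bar> \<le> (\<Sum>b\<in>{b\<in>B. le s b}. \<bar>c b\<bar>)"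
        by (rule abs_comb_le_mass[OF B(1) sT(1)])
      also have "\<dots> \<le> (\<Sum>b\<in>V. \<bar>c b\<bar>)"
        using le_trans[OF s0T sT(1) _ sT(2)] B(2) off[OF sY] finV by (intro sum_mono2) (auto simp: V_def)
      finally show ?thesis
        using massV f_off[OF sY sT(2)] \<epsilon> by linarith
    qed
  qed
  then show ?thesis
    using s0(1) Ft by (intro exI[of _ "{s0}"] exI[of _ Ft] conjI) simp_all
qed

text \<open>If the path has a limit \<open>t\<close>, continuity makes \<open>f\<close> converge to
  \<open>f t\<close> along it, and the single condition at \<open>t\<close> cuts off everything
  beyond. If it is bounded by no point of the tree, it leaves each of the finitely many (0,j] that
  carry the large values of \<open>f\<close>, so \<open>f\<close> tends to 0 along it.\<close>

lemma controlled_limit: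
  assumes e: "path e" "e \<noteq> {}" "\<And>m. m \<in> T \<Longrightarrow> e \<noteq> tdown T le m"
  shows "\<exists>E F. finite E \<and> E \<subseteq> e \<and> finite F \<and> F \<subseteq> T - e \<and>
    controlled {s \<in> T. (\<forall>x\<in>E. s \<in> up x) \<and> (\<forall>x\<in>F. s \<notin> up x)}"
proof (cases "\<exists>x\<in>T. e \<subseteq> tdown T le x")
  case True
  have eT: "e \<subseteq> T" using pathD(1)[OF e(1)] .
  obtain x where x: "e \<subseteq> tdown T le x" "x \<in> T" using True by blast
  obtain t where t: "t \<in> T" "le t x" "tbelow T le t = e" "limit_height T le t"
    by (rule path_closure[OF e x])
  have te: "t \<notin> e" using t(3) by (auto simp: tbelow_def)
  have below: "le s t" if "s \<in> e" for s using that t(3) by (auto simp: tbelow_def)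
  show ?thesis
  proof (rule controlled_limit_aux[OF e(1,2), where Ft = "{t}" and Y = "up t" and star = "\<lambda>g. g t"])
    show "up t = {s \<in> T. \<exists>t\<in>{t}. le t s}" by (auto simp: up_def)
    show "\<exists>y\<in>e. \<not> le y x" if "x \<in> T - up t" for x
    proof (rule ccontr)
      assume "\<not> ?thesis"
      then have "tbelow T le t \<subseteq> tdown T le x" using t(3) eT by (auto simp: tdown_def)
      then show False using limit_le[OF t(1,4), of x] that by (auto simp: up_def)
    qed
    show "comb B c s - comb B c t = (\<Sum>b\<in>{b\<in>B. le s b \<and> b \<notin> up t}. c b)"
      if B: "finite B" "B \<subseteq> T" and s: "s \<in> e" for B c s
    proof -
      have sT: "s \<in> T" using s eT by blast
      have "{b\<in>B. le s b} = {b\<in>B. le s b \<and> b \<notin> up t} \<union> {b\<in>B. le t b}"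
        using B(2) le_trans[OF sT t(1) _ below[OF s]] by (auto simp: up_def)
      moreover have "{b\<in>B. le s b \<and> b \<notin> up t} \<inter> {b\<in>B. le t b} = {}"
        using B(2) by (auto simp: up_def)
      ultimately have "comb B c s = (\<Sum>b\<in>{b\<in>B. le s b \<and> b \<notin> up t}. c b) + comb B c t"
        unfolding comb_above[OF B(1) sT] comb_above[OF B(1) t(1)] using B(1)
        by (simp add: sum.union_disjoint)
      then show ?thesis by simp
    qed
    show "\<exists>y\<in>e. \<forall>s\<in>e. le y s \<longrightarrow> \<bar>f s - f t\<bar> \<le> \<epsilon>"
    proof -
      have "openin \<T> {x \<in> topspace \<T>. f x \<in> ball (f t) \<epsilon>}"
        using openin_continuous_map_preimage[OF C0_D(1)[OF f], of "ball (f t) \<epsilon>"]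
        by (simp only: open_openin[symmetric] open_ball simp_thms)
      then obtain r where r: "r \<in> e"
        "\<forall>x\<in>tdown T le t. \<not> le x r \<longrightarrow> x \<in> {x \<in> topspace \<T>. f x \<in> ball (f t) \<epsilon>}"
        using limit_nbhd[OF _ _ t(4), of "{x \<in> topspace \<T>. f x \<in> ball (f t) \<epsilon>}"] t(1,3) \<epsilon>
        by (auto simp: topspace_tree)
      have rT: "r \<in> T" using r(1) eT by blast
      have "\<exists>y\<in>e. \<forall>j\<in>{r}. \<not> le y j"
      proof (rule path_escape[OF e(1,2)])
        fix j assume "j \<in> {r}"
        have "e \<noteq> tdown T le r" using e(3)[OF rT] .
        moreover have "tdown T le r \<subseteq> e" using pathD(2)[OF e(1) r(1)] by (auto simp: tdown_def)
        ultimately show "\<exists>y\<in>e. \<not> le y j"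
          using eT \<open>j \<in> {r}\<close> by (auto simp: tdown_def)
      qed (use rT in auto)
      then obtain y where y: "y \<in> e" "\<not> le y r" by blast
      have "\<bar>f s - f t\<bar> \<le> \<epsilon>" if s: "s \<in> e" "le y s" for s
      proof -
        have "\<not> le s r" using le_trans[of y s r] s y rT eT by blast
        then have "s \<in> {x \<in> topspace \<T>. f x \<in> ball (f t) \<epsilon>}"
          using r(2) below[OF s(1)] s(1) eT by (auto simp: tdown_def)
        then show ?thesis by (auto simp: dist_real_def)
      qed
      then show ?thesis using y(1) by blast
    qed
    show "b \<notin> up t" if s: "s \<in> T - up t - e" and b: "b \<in> T" "le s b" for s b
    proof
      assume "b \<in> up t"
      then have "le s t \<or> le t s" using le_linear_below[of s t b] s b t(1) by (auto simp: up_def)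
      then show False using s t(1,3) le_refl[OF t(1)] by (auto simp: up_def tbelow_def)
    qed
  qed (use t(1) te in auto)
next
  case False
  have eT: "e \<subseteq> T" using pathD(1)[OF e(1)] .
  have out: "\<exists>y\<in>e. \<not> le y x" if "x \<in> T" for x
    using False that eT by (auto simp: tdown_def)
  show ?thesis
  proof (rule controlled_limit_aux[OF e(1,2), where Ft = "{}" and Y = "{}" and star = "\<lambda>g. 0"])
    show "\<exists>y\<in>e. \<not> le y x" if "x \<in> T - {}" for x using out that by simp
    show "comb B c s - 0 = (\<Sum>b\<in>{b\<in>B. le s b \<and> b \<notin> {}}. c b)" if "finite B" "B \<subseteq> T" "s \<in> e" for B c s
      using comb_above[OF that(1), of s c] that(3) eT by auto
    show "\<exists>y\<in>e. \<forall>s\<in>e. le y s \<longrightarrow> \<bar>f s - 0\<bar> \<le> \<epsilon>"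
    proof -
      obtain J where J: "finite J" "J \<subseteq> T" "\<And>x. x \<in> T \<Longrightarrow> \<epsilon> \<le> \<bar>f x\<bar> \<Longrightarrow> \<exists>j\<in>J. le x j"
        using C0_support[OF f \<epsilon>] by blast
      obtain y where y: "y \<in> e" "\<And>j. j \<in> J \<Longrightarrow> \<not> le y j"
        using path_escape[OF e(1,2) J(1,2)] out J(2) by blast
      have "\<bar>f s\<bar> \<le> \<epsilon>" if s: "s \<in> e" "le y s" for s
      proof (rule ccontr)
        assume "\<not> \<bar>f s\<bar> \<le> \<epsilon>"
        then obtain j where j: "j \<in> J" "le s j" using J(3)[of s] s(1) eT by auto
        then have "le y j" using le_trans[of y s j] s y(1) J(2) eT by blast
        then show False using y(2) j(1) by blast
      qed
      then show ?thesis using y(1) by auto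
    qed
  qed (use \<epsilon> in auto)
qed

text \<open>A point of the cube that is not a path is separated from all sets (0,s] by two of its
  coordinates, so its neighbourhood contributes the empty set. The paths are the three kinds treated
  above.\<close>

lemma controlled_all: "controlled T"
proof (rule ideal_compactness[where Q = controlled and I = T and U = up])
  show "controlled (A \<union> B)" if "controlled A" "controlled B" for A B
    using that by (rule controlled_Un)
  show "controlled A" if "controlled B" "A \<subseteq> B" for A B
    using that by (rule controlled_mono)
  have empty: "controlled {}"
    by (rule controlledI[of "{}" 1]) auto
  fix e assume eT: "e \<subseteq> T"
  consider "path e" "e = {}" | m where "m \<in> T" "e = tdown T le m"
    | "path e" "e \<noteq> {}" "\<And>m. m \<in> T \<Longrightarrow> e \<noteq> tdown T le m"
    | x y where "x \<in> e" "y \<in> T" "le y x" "y \<notin> e"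
    | x y where "x \<in> e" "y \<in> e" "\<not> le x y" "\<not> le y x"
    using eT unfolding path_def by blast
  then show "\<exists>E F. finite E \<and> E \<subseteq> e \<and> finite F \<and> F \<subseteq> T - e \<and>
    controlled {s \<in> T. (\<forall>x\<in>E. s \<in> up x) \<and> (\<forall>x\<in>F. s \<notin> up x)}"
  proof cases
    case 1
    show ?thesis unfolding 1(2) by (rule controlled_root)
  next
    case (2 m)
    show ?thesis unfolding 2(2) by (rule controlled_tdown[OF 2(1)])
  next
    case 3
    then show ?thesis by (rule controlled_limit)
  next
    case (4 x y)
    have "{s \<in> T. (\<forall>x\<in>{x}. s \<in> up x) \<and> (\<forall>x\<in>{y}. s \<notin> up x)} = {}"
      using le_trans[OF 4(2) _ _ 4(3)] 4(1) eT by (auto simp: up_def)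
    then have "controlled {s \<in> T. (\<forall>x\<in>{x}. s \<in> up x) \<and> (\<forall>x\<in>{y}. s \<notin> up x)}"
      using empty by (simp only:)
    then show ?thesis
      using 4 by (intro exI[of _ "{x}"] exI[of _ "{y}"]) simp
  next
    case (5 x y)
    have "{s \<in> T. (\<forall>x\<in>{x, y}. s \<in> up x) \<and> (\<forall>x\<in>{}. s \<notin> up x)} = {}"
      using le_linear_below[of x y] 5 eT by (auto simp: up_def)
    then have "controlled {s \<in> T. (\<forall>x\<in>{x, y}. s \<in> up x) \<and> (\<forall>x\<in>{}. s \<notin> up x)}"
      using empty by (simp only:)
    then show ?thesis
      using 5 by (intro exI[of _ "{x, y}"] exI[of _ "{}"]) simp
  qed
qed

end

end

section \<open>The Kadec property of the norm\<close>

context weighted_tree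
begin

text \<open>A functional supporting \<open>L\<close> at \<open>f\<close> keeps \<open>L g\<close>
  from dropping much below \<open>L f\<close> for \<open>g\<close> weakly close to \<open>f\<close>.
  As the norms agree, the remaining scale cannot exceed its value at \<open>f\<close> by much, so
  near-optimal combinations for \<open>g\<close> pass the tests made with \<phi>.\<close>

lemma kadec_knorm: "kadec T le knorm"
  unfolding kadec_iff[OF equiv_norm_knorm]
proof (intro ballI impI allI)
  fix f and e :: real assume f: "f \<in> C" and Nf: "knorm f = 1" and e: "e > 0"
  \<comment> \<open>The combination is within \<open>10 * \<epsilon>\<close> of \<open>f\<close> and
    within \<epsilon> of \<open>g\<close>; with the factor 2 from \<open>ksum_le\<close> this gives
    \<open>22 * \<epsilon>\<close>, less than \<open>e\<close>.\<close>
  define \<epsilon> where "\<epsilon> = e / 24"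
  have \<epsilon>: "\<epsilon> > 0" using e by (simp add: \<epsilon>_def)
  obtain k where k: "kfun ((1/2)^k) f < \<epsilon>" using kfun_small[OF f \<epsilon>] by blast
  define l :: real where "l = (1/2)^k"
  have l: "l > 0" by (simp add: l_def)
  define L where "L = ksum (\<lambda>j. if j = k then 0 else (1/2)^j)"
  have split: "knorm g = L g + l * kfun l g" if "g \<in> C" for g
    using knorm_split[OF that, of k] by (simp add: L_def l_def)
  have L_le: "L g \<le> 2 * sn g" if "g \<in> C" for g
    unfolding L_def by (rule ksum_le[OF _ _ that]) auto
  have slL: "sublinear_on C L"
    unfolding L_def by (rule ksum_sublinear) auto
  obtain \<psi> where \<psi>: "\<And>x y. x \<in> C \<Longrightarrow> y \<in> C \<Longrightarrow> \<psi> (\<lambda>t. x t + y t) = \<psi> x + \<psi> y"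
    "\<And>x c. x \<in> C \<Longrightarrow> \<psi> (\<lambda>t. c * x t) = c * \<psi> x"
    "\<And>x. x \<in> C \<Longrightarrow> \<psi> x \<le> L x" "\<psi> f = L f"
    by (rule Hahn_Banach_functions[OF fun_subspace_C0 slL f]) (rule that)
  have \<psi>D: "\<psi> \<in> D"
    using \<psi>(1,2) order_trans[OF \<psi>(3) L_le] by (intro dualI[where K = 2]) auto
  obtain \<phi> where \<phi>: "\<And>x y. x \<in> C \<Longrightarrow> y \<in> C \<Longrightarrow> \<phi> (\<lambda>t. x t + y t) = \<phi> x + \<phi> y"
    "\<And>x c. x \<in> C \<Longrightarrow> \<phi> (\<lambda>t. c * x t) = c * \<phi> x"
    "\<And>x. x \<in> C \<Longrightarrow> \<phi> x \<le> kfun l x" "\<phi> f = kfun l f"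
    by (rule Hahn_Banach_functions[OF fun_subspace_C0 kfun_sublinear[OF l] f]) (rule that)
  have \<phi>_sn: "\<phi> g \<le> sn g" if "g \<in> C" for g
    using \<phi>(3)[OF that] kfun_le_supnorm[OF l that] by simp
  have \<phi>D: "\<phi> \<in> D"
    using \<phi>(1,2) \<phi>_sn by (intro dualI[where K = 1]) auto
  have \<phi>_ch: "\<bar>\<phi> (ch t)\<bar> \<le> l * w t" if t: "t \<in> T" for t
  proof -
    have "- \<phi> (ch t) \<le> kfun l (\<lambda>s. (-1) * ch t s)"
      using \<phi>(2)[OF C0_ch[OF t], of "-1"] \<phi>(3)[OF C0_scale[OF C0_ch[OF t], of "-1"]] by simp
    also have "\<dots> = kfun l (ch t)"
      using kfun_scale[OF l C0_ch[OF t], of "-1"] by simp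
    finally show ?thesis
      using \<phi>(3)[OF C0_ch[OF t]] kfun_ch[OF l t] by linarith
  qed
  obtain Z \<eta> where Z: "finite Z" "\<eta> > 0"
    "\<And>B c s. testing l \<phi> f \<epsilon> Z \<eta> B c \<Longrightarrow> s \<in> T \<Longrightarrow> \<bar>comb B c s - f s\<bar> \<le> 10 * \<epsilon>"
    by (rule controlledE[OF l \<phi>D \<phi>_ch f \<epsilon> controlled_all[OF l \<phi>D \<phi>_ch f \<epsilon>]]) (assumption+, rule that)
  \<comment> \<open>The defect will be below \<open>2 * \<kappa>\<close>: one \<kappa> from the
    upper bound on \<open>kfun l g\<close>, one from the lower bound on \<open>\<phi> g\<close>. The
    second entry of the minimum keeps the remainder of the combination below \<epsilon>.\<close>
  define \<kappa> where "\<kappa> = min (\<eta> / 2) (\<epsilon> - kfun l f)"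
  have \<kappa>: "\<kappa> > 0" "2 * \<kappa> \<le> \<eta>" "kfun l f + \<kappa> \<le> \<epsilon>"
    using Z(2) k unfolding \<kappa>_def l_def by (auto simp: min_def)
  define W where "W = \<Inter> (insert {g \<in> C. \<psi> g \<in> {\<psi> f - l * \<kappa><..}} (insert {g \<in> C. \<phi> g \<in> {\<phi> f - \<kappa><..}}
    ((\<lambda>z. {g \<in> C. g z \<in> {f z - \<epsilon><..<f z + \<epsilon>}}) ` Z)))"
  have "openin (weak_topology_C0 T le) W"
    unfolding W_def
  proof (rule openin_Inter)
    fix X assume "X \<in> insert {g \<in> C. \<psi> g \<in> {\<psi> f - l * \<kappa><..}} (insert {g \<in> C. \<phi> g \<in> {\<phi> f - \<kappa><..}}
      ((\<lambda>z. {g \<in> C. g z \<in> {f z - \<epsilon><..<f z + \<epsilon>}}) ` Z))"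
    then show "openin (weak_topology_C0 T le) X"
      using weak_open_slab[OF \<psi>D open_greaterThan] weak_open_slab[OF \<phi>D open_greaterThan]
        weak_open_slab[OF dual_eval open_greaterThanLessThan]
      by (elim insertE imageE) (simp_all only:)
  qed (use Z(1) in simp_all)
  moreover have "f \<in> W"
    using f \<kappa>(1) l \<epsilon> by (auto simp: W_def)
  moreover have "knorm (\<lambda>t. g t - f t) < e" if gW: "g \<in> W" and Ng: "knorm g = 1" for g
  proof -
    have g: "g \<in> C" "\<psi> f - l * \<kappa> < \<psi> g" "\<phi> f - \<kappa> < \<phi> g" "\<And>z. z \<in> Z \<Longrightarrow> \<bar>g z - f z\<bar> < \<epsilon>"
      using gW unfolding W_def by (auto simp: abs_less_iff)
    \<comment> \<open>Both norms are 1, and \<open>L g\<close> is at least \<open>\<psi> g\<close>,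
      which exceeds \<open>L f - l * \<kappa>\<close>.\<close>
    have "l * kfun l g < l * (kfun l f + \<kappa>)"
      using split[OF g(1)] split[OF f] Nf Ng \<psi>(3)[OF g(1)] \<psi>(4) g(2) by (simp add: distrib_left)
    then have "kfun l g < kfun l f + \<kappa>" using l by simp
    then obtain B c where B: "finite B" "B \<subseteq> T" "l * cost B c + sn (\<lambda>t. g t - comb B c t) < kfun l f + \<kappa>"
      by (rule kfun_lessE[OF l])
    define h where "h = (\<lambda>t. g t - comb B c t)"
    have cC: "comb B c \<in> C" using C0_comb[OF B(1,2)] .
    have hC: "h \<in> C" unfolding h_def using C0_diff[OF g(1) cC] .
    have cost0: "0 \<le> l * cost B c" using cost_nonneg[OF B(2)] l by simp
    have h_small: "\<bar>h t\<bar> \<le> \<epsilon>" for t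
      using supnorm_upper[OF hC, of t] B(3) cost0 \<kappa>(3) unfolding h_def by linarith
    have "testing l \<phi> f \<epsilon> Z \<eta> B c"
    proof (rule testingI[OF l \<phi>D \<phi>_ch f \<epsilon> B(1,2)])
      have "defect l \<phi> B c = l * cost B c - \<phi> (comb B c)"
        by (rule defect_eq[OF l \<phi>D \<phi>_ch f \<epsilon> B(1,2)])
      also have "\<phi> (comb B c) = \<phi> g - \<phi> h"
        using dual_diff[OF \<phi>D g(1) cC] by (simp add: h_def)
      finally show "defect l \<phi> B c < \<eta>"
        using B(3) \<phi>_sn[OF hC] g(3) \<phi>(4) \<kappa>(2) unfolding h_def by linarith
      fix z assume "z \<in> Z"
      then show "\<bar>comb B c z - f z\<bar> \<le> 2 * \<epsilon>"
        using g(4)[of z] h_small[of z] by (simp add: h_def)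
    qed
    then have "\<bar>comb B c t - f t\<bar> \<le> 10 * \<epsilon>" if "t \<in> T" for t
      using Z(3) that by blast
    then have "\<bar>g t - f t\<bar> \<le> 11 * \<epsilon>" if "t \<in> T" for t
      using h_small[of t] that unfolding h_def by fastforce
    then have "sn (\<lambda>t. g t - f t) \<le> 11 * \<epsilon>"
      using \<epsilon> by (intro supnorm_least) auto
    moreover have "knorm (\<lambda>t. g t - f t) \<le> 2 * sn (\<lambda>t. g t - f t)"
      using C0_diff[OF g(1) f] by (intro ksum_le) auto
    ultimately show ?thesis
      using e by (simp add: \<epsilon>_def)
  qed
  ultimately show "\<exists>W. openin (weak_topology_C0 T le) W \<and> f \<in> W \<and> (\<forall>g\<in>W. knorm g = 1 \<longrightarrow> knorm (\<lambda>t. g t - f t) < e)"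
    by (intro exI[of _ W] conjI ballI impI)
qed

end

lemma (in tree_space) increasing_imp_kadec:
  assumes "increasing_on_tree T le \<rho>" "\<And>t. t \<in> T \<Longrightarrow> good_point T le \<rho> t"
  shows "\<exists>N. equiv_norm T le N \<and> kadec T le N"
proof -
  \<comment> \<open>\<rho> may be negative or unbounded below. The exponential is strictly
    increasing, so it keeps the jumps at all points, and adding 1 gives weights at least 1.\<close>
  interpret weighted_tree T le "\<lambda>t. 1 + exp (\<rho> t)"
  proof unfold_locales
    show "1 \<le> 1 + exp (\<rho> t)" for t by simp
    show "1 + exp (\<rho> s) \<le> 1 + exp (\<rho> t)" if "s \<in> T" "t \<in> T" "le s t" for s t
      using assms(1) that by (simp add: increasing_on_tree_def)
    show "good_point T le (\<lambda>t. 1 + exp (\<rho> t)) t" if t: "t \<in> T" for t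
    proof -
      obtain F d where F: "finite F" "F \<subseteq> tsucc T le t" "d > 0" "\<And>u. u \<in> tsucc T le t - F \<Longrightarrow> \<rho> t + d \<le> \<rho> u"
        using good_pointE[OF assms(2)[OF t]] by metis
      show ?thesis
      proof (rule good_pointI[OF F(1,2)])
        show "exp (\<rho> t + d) - exp (\<rho> t) > 0" using F(3) by simp
        show "1 + exp (\<rho> t) + (exp (\<rho> t + d) - exp (\<rho> t)) \<le> 1 + exp (\<rho> u)" if "u \<in> tsucc T le t - F" for u
          using F(4)[OF that] by simp
      qed
    qed
  qed
  show ?thesis
    using equiv_norm_knorm kadec_knorm by blast
qed

theorem theorem6p1:
  fixes T :: "'a set" and le :: "'a \<Rightarrow> 'a \<Rightarrow> bool"
  assumes "is_tree T le" and "hausdorff_tree T le"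
  shows "(\<exists>N. equiv_norm T le N \<and> kadec T le N) \<longleftrightarrow>
         (\<exists>\<rho>. increasing_on_tree T le \<rho> \<and> (\<forall>t \<in> T. good_point T le \<rho> t))"
proof -
  interpret tree_space T le
    by unfold_locales (use assms in auto)
  show ?thesis
    using kadec_imp_increasing increasing_imp_kadec by blast
qed

end
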